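(* Let $(T_1,T_2)$ be a pair of pure commuting contractions on some Hilbert space $H$, both with finite defect. Let $(S_\Psi,K_\Psi)$, $S_\Psi=(S_1^\Psi,S_2^\Psi)$, be the constrained isometric co-extension of $(T_1,T_2)$ corresponding to some rational matrix-valued pure inner function $\Psi\in H^\infty(\mathbb{D};B(\mathbb{C}^d))$ (as described in the context). Then $Z(\operatorname{Ann}(T_1,T_2))=\Omega_\Psi$.
   Context: $\mathbb{D}$ is the open unit disc, $H^2$ the Hardy space on $\mathbb{D}$, and $H^\infty(\mathbb{D}^2)$, $H^\infty(\mathbb{D};B(E',E))$ are the spaces of bounded holomorphic functions (scalar, operator-valued). $H^2\otimes E$ is identified with the $E$-valued Hardy space; $M_z$ is multiplication by $z$ on $H^2$; for $\Phi\in H^\infty(\mathbb{D};B(E',E))$, $M_\Phi:H^2\otimes E'\to H^2\otimes E$ is $(M_\Phi f)(z)=\Phi(z)f(z)$, and $\Phi$ is inner if $M_\Phi$ is an isometry. A contraction $T$ is pure if $\|T^{*n}h\|\to0$ for all $h$, and has finite defect if $\operatorname{ran}(I-TT^* )$ is finite-dimensional. A rational matrix-valued pure inner function is an inner $\Psi\in H^\infty(\mathbb{D};B(\mathbb{C}^d))$ with rational entries such that $\sigma(\Psi(\lambda))\subset\mathbb{D}$ for all $\lambda\in\mathbb{D}$. Setting: $d=\dim\operatorname{ran}(I-T_1T_1^* )$; $J:H\to H^2\otimes\mathbb{C}^d$ is an isometry with $JT_1^*=(M_z\otimes I)^*J$ (the usual minimal isometric co-extension of $T_1$); $\Psi\in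 H^\infty(\mathbb{D};B(\mathbb{C}^d))$ is a rational matrix-valued pure inner function with $JT_2^*=M_\Psi^*J$ (such $J$ and $\Psi$ are known to exist). Functional calculus: for $f\in H^\infty(\mathbb{D}^2)$, let $f(M_z\otimes I,M_\Psi)$ be the multiplication operator by the bounded function $z\mapsto f(z,\Psi(z))$, where $f(z,\Psi(z))$ is the holomorphic function $f(z,\cdot)$ of the matrix $\Psi(z)$. Put $f(T_1,T_2)=J^*f(M_z\otimes I,M_\Psi)J$, which extends the polynomial calculus. Then $\operatorname{Ann}(T_1,T_2)=\{f\in H^\infty(\mathbb{D}^2):f(T_1,T_2)=0\}$. Constrained isometric co-extension: $K_\Psi=\bigcap_{f\in\operatorname{Ann}(T_1,T_2)}\ker f(M_z\otimes I,M_\Psi)^*$, a closed subspace co-invariant for $M_z\otimes I$ and $M_\Psi$, and $S_1^\Psi=P_{K_\Psi}(M_z\otimes I)|_{K_\Psi}$, $S_2^\Psi=P_{K_\Psi}M_\Psi|_{K_\Psi}$, which are commuting contractions. $\Omega_\Psi\subset\mathbb{C}^2$ is the set of $(\lambda,\mu)$ such that $(\overline\lambda,\overline\mu)$ is a joint eigenvalue of $(S_1^{\Psi*},S_2^{\Psi*})$. For $F\subset H^\infty(\mathbb{D}^2)$, $Z(F)=\{(z,w)\in\mathbb{D}^2:f(z,w)=0\ \forall f\in F\}$. *)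

theory Defs
  imports "HOL-Complex_Analysis.Complex_Analysis"
begin

no_notation fps_nth (infixl \<open>$\<close> 75)

section \<open>Complex Hilbert spaces\<close>

text \<open>The inner product is linear in its first argument; its real part is the real inner product
  of the underlying real space, so that \<^term>\<open>norm x\<close> is the square root of \<open>\<langle>x, x\<rangle>\<close>.\<close>

class complex_inner = real_inner +
  fixes scaleC :: "complex \<Rightarrow> 'a \<Rightarrow> 'a" (infixr "*\<^sub>C" 75)
    and cinner :: "'a \<Rightarrow> 'a \<Rightarrow> complex"
  assumes scaleC_add_right: "c *\<^sub>C (x + y) = c *\<^sub>C x + c *\<^sub>C y"
    and scaleC_add_left: "(b + c) *\<^sub>C x = b *\<^sub>C x + c *\<^sub>C x"
    and scaleC_scaleC: "b *\<^sub>C (c *\<^sub>C x) = (b * c) *\<^sub>C x"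
    and scaleC_of_real: "complex_of_real r *\<^sub>C x = scaleR r x"
    and cinner_commute: "cinner x y = cnj (cinner y x)"
    and cinner_add_left: "cinner (x + y) z = cinner x z + cinner y z"
    and cinner_scaleC_left: "cinner (c *\<^sub>C x) y = c * cinner x y"
    and Re_cinner: "Re (cinner x y) = inner x y"

class complex_hilbert_space = complex_inner + complete_space

global_interpretation complex_vector: vector_space "scaleC :: complex \<Rightarrow> 'a \<Rightarrow> 'a :: complex_inner"
  defines cspan = complex_vector.span
    and cdim = complex_vector.dim
proof
  show "1 *\<^sub>C x = x" for x :: 'a
    using scaleC_of_real [of 1 x] by simp
qed (simp_all add: scaleC_add_right scaleC_add_left scaleC_scaleC)

abbreviation clinear :: "('a::complex_inner \<Rightarrow> 'b::complex_inner) \<Rightarrow> bool"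
  where "clinear \<equiv> Vector_Spaces.linear scaleC scaleC"

text \<open>For a closed subspace \<open>U\<close> and a bounded linear map \<open>T\<close> on \<open>U\<close>, \<open>cadj_on U T\<close> is the adjoint
  of \<open>T\<close> with respect to the Hilbert space structure of \<open>U\<close>.\<close>

definition cadj_on :: "'a::complex_inner set \<Rightarrow> ('a \<Rightarrow> 'b::complex_inner) \<Rightarrow> 'b \<Rightarrow> 'a"
  where "cadj_on U T y = (THE x. x \<in> U \<and> (\<forall>u\<in>U. cinner (T u) y = cinner u x))"

abbreviation cadj :: "('a::complex_inner \<Rightarrow> 'b::complex_inner) \<Rightarrow> 'b \<Rightarrow> 'a"
  where "cadj \<equiv> cadj_on UNIV"

definition orth_proj :: "'a::complex_inner set \<Rightarrow> 'a \<Rightarrow> 'a"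
  where "orth_proj K x = (THE p. p \<in> K \<and> (\<forall>k\<in>K. cinner (x - p) k = 0))"

text \<open>The compression of \<open>T\<close> to \<open>K\<close>; only its values on \<open>K\<close> are relevant.\<close>

definition compression :: "'a::complex_inner set \<Rightarrow> ('a \<Rightarrow> 'a) \<Rightarrow> 'a \<Rightarrow> 'a"
  where "compression K T x = orth_proj K (T x)"

definition contraction :: "('a::complex_inner \<Rightarrow> 'a) \<Rightarrow> bool"
  where "contraction T \<longleftrightarrow> clinear T \<and> (\<forall>x. norm (T x) \<le> norm x)"

definition linear_isometry :: "('a::complex_inner \<Rightarrow> 'b::complex_inner) \<Rightarrow> bool"
  where "linear_isometry T \<longleftrightarrow> clinear T \<and> (\<forall>x. norm (T x) = norm x)"

definition pure :: "('a::complex_inner \<Rightarrow> 'a) \<Rightarrow> bool"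
  where "pure T \<longleftrightarrow> (\<forall>x. (\<lambda>n. norm ((cadj T ^^ n) x)) \<longlonglongrightarrow> 0)"

definition defect_range :: "('a::complex_inner \<Rightarrow> 'a) \<Rightarrow> 'a set"
  where "defect_range T = range (\<lambda>x. x - T (cadj T x))"

definition finite_defect :: "('a::complex_inner \<Rightarrow> 'a) \<Rightarrow> bool"
  where "finite_defect T \<longleftrightarrow> (\<exists>B. finite B \<and> defect_range T \<subseteq> cspan B)"

definition joint_eigenvalue ::
  "'a::complex_inner set \<Rightarrow> ('a \<Rightarrow> 'a) \<Rightarrow> ('a \<Rightarrow> 'a) \<Rightarrow> complex \<Rightarrow> complex \<Rightarrow> bool"
  where "joint_eigenvalue K A B \<alpha> \<beta> \<longleftrightarrow>
    (\<exists>v\<in>K. v \<noteq> 0 \<and> A v = \<alpha> *\<^sub>C v \<and> B v = \<beta> *\<^sub>C v)"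


section \<open>The vector-valued Hardy space\<close>

abbreviation disc :: "complex set"
  where "disc \<equiv> ball 0 1"

abbreviation bidisc :: "(complex \<times> complex) set"
  where "bidisc \<equiv> disc \<times> disc"

definition taylor_coeff :: "(complex \<Rightarrow> complex) \<Rightarrow> nat \<Rightarrow> complex"
  where "taylor_coeff g n = (deriv ^^ n) g 0 / fact n"

definition vtaylor_coeff :: "(complex \<Rightarrow> complex ^ 'd) \<Rightarrow> nat \<Rightarrow> complex ^ 'd"
  where "vtaylor_coeff F n = (\<chi> i. taylor_coeff (\<lambda>z. F z $ i) n)"

definition vcinner :: "complex ^ 'd \<Rightarrow> complex ^ 'd \<Rightarrow> complex"
  where "vcinner x y = (\<Sum>i\<in>UNIV. x $ i * cnj (y $ i))"

text \<open>\<open>H\<^sup>2 \<otimes> \<complex>\<^sup>d\<close> as the space of holomorphic functions from the disc to \<open>\<complex>\<^sup>d\<close> with square-summable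
  Taylor coefficients. As the functions of HOL are total, they are extended by 0 off the disc.\<close>

typedef 'd hardy =
  "{F :: complex \<Rightarrow> complex ^ 'd::finite.
      (\<forall>i. (\<lambda>z. F z $ i) holomorphic_on disc) \<and> (\<forall>z. z \<notin> disc \<longrightarrow> F z = 0) \<and>
      summable (\<lambda>n. (norm (vtaylor_coeff F n))\<^sup>2)}"
  morphisms hardy_fun Abs_hardy
  by (rule exI [of _ "\<lambda>_. 0"]) (auto simp: vtaylor_coeff_def taylor_coeff_def vec_eq_iff norm_vec_def L2_set_def)

setup_lifting type_definition_hardy

abbreviation hcoeff :: "'d::finite hardy \<Rightarrow> nat \<Rightarrow> complex ^ 'd"
  where "hcoeff F \<equiv> vtaylor_coeff (hardy_fun F)"

lemma vtaylor_coeff_add: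
  assumes "\<forall>i. (\<lambda>z. F z $ i) holomorphic_on disc" "\<forall>i. (\<lambda>z. G z $ i) holomorphic_on disc"
  shows "vtaylor_coeff (\<lambda>z. F z + G z) n = vtaylor_coeff F n + vtaylor_coeff G n"
  using assms
  by (simp add: vec_eq_iff vtaylor_coeff_def taylor_coeff_def add_divide_distrib
      higher_deriv_add [of _ disc])

lemma vtaylor_coeff_scale:
  assumes "\<forall>i. (\<lambda>z. F z $ i) holomorphic_on disc"
  shows "vtaylor_coeff (\<lambda>z. c *s F z) n = c *s vtaylor_coeff F n"
  using assms
  by (simp add: vec_eq_iff vtaylor_coeff_def taylor_coeff_def higher_deriv_cmult [of _ disc])

lemma norm_vector_scalar_mult: "norm (c *s (x :: complex ^ 'd::finite)) = norm c * norm x"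
  by (simp add: norm_vec_def norm_mult L2_set_right_distrib)

lemma norm_add_square_le: "(norm (x + y))\<^sup>2 \<le> 2 * (norm x)\<^sup>2 + 2 * (norm (y :: 'a::real_normed_vector))\<^sup>2"
proof -
  have "(norm (x + y))\<^sup>2 \<le> (norm x + norm y)\<^sup>2"
    by (simp add: norm_triangle_ineq power_mono)
  also have "\<dots> \<le> 2 * (norm x)\<^sup>2 + 2 * (norm y)\<^sup>2"
    using sum_squares_bound [of "norm x" "norm y"] by (simp add: power2_sum)
  finally show ?thesis .
qed

lemma hardy_add_closed:
  assumes "\<forall>i. (\<lambda>z. F z $ i) holomorphic_on disc" "\<forall>i. (\<lambda>z. G z $ i) holomorphic_on disc"
    and "summable (\<lambda>n. (norm (vtaylor_coeff F n))\<^sup>2)" "summable (\<lambda>n. (norm (vtaylor_coeff G n))\<^sup>2)"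
  shows "summable (\<lambda>n. (norm (vtaylor_coeff (\<lambda>z. F z + G z) n))\<^sup>2)"
proof (rule summable_comparison_test')
  show "summable (\<lambda>n. 2 * (norm (vtaylor_coeff F n))\<^sup>2 + 2 * (norm (vtaylor_coeff G n))\<^sup>2)"
    using assms by (intro summable_add summable_mult)
  show "norm ((norm (vtaylor_coeff (\<lambda>z. F z + G z) n))\<^sup>2)
      \<le> 2 * (norm (vtaylor_coeff F n))\<^sup>2 + 2 * (norm (vtaylor_coeff G n))\<^sup>2" if "n \<ge> 0" for n
    using assms by (simp add: vtaylor_coeff_add norm_add_square_le)
qed

lemma hardy_scale_closed:
  assumes "\<forall>i. (\<lambda>z. F z $ i) holomorphic_on disc"
    and "summable (\<lambda>n. (norm (vtaylor_coeff F n))\<^sup>2)"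
  shows "summable (\<lambda>n. (norm (vtaylor_coeff (\<lambda>z. c *s F z) n))\<^sup>2)"
  using assms by (simp add: vtaylor_coeff_scale norm_vector_scalar_mult power_mult_distrib summable_mult)

lemma vcinner_self: "Re (vcinner x x) = (norm (x :: complex ^ 'd::finite))\<^sup>2"
  by (simp add: vcinner_def norm_vec_def L2_set_def sum_nonneg cmod_power2) (simp add: power2_eq_square)

lemma norm_vcinner_le: "norm (vcinner x y) \<le> (norm x)\<^sup>2 + (norm (y :: complex ^ 'd::finite))\<^sup>2"
proof -
  have "norm (x $ i * cnj (y $ i)) \<le> (norm (x $ i))\<^sup>2 + (norm (y $ i))\<^sup>2" for i
    using sum_squares_bound [of "norm (x $ i)" "norm (y $ i)"]
      mult_nonneg_nonneg [of "norm (x $ i)" "norm (y $ i)"]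
    by (simp add: norm_mult del: mult_nonneg_nonneg)
  then have "norm (vcinner x y) \<le> (\<Sum>i\<in>UNIV. (norm (x $ i))\<^sup>2 + (norm (y $ i))\<^sup>2)"
    unfolding vcinner_def by (intro order_trans [OF norm_sum] sum_mono)
  also have "\<dots> = (norm x)\<^sup>2 + (norm y)\<^sup>2"
    by (simp add: norm_vec_def L2_set_def sum_nonneg sum.distrib)
  finally show ?thesis .
qed

lemma vcinner_add_left: "vcinner (x + y) z = vcinner x z + vcinner y z"
  by (simp add: vcinner_def distrib_right sum.distrib)

lemma vcinner_scale_left: "vcinner (c *s x) y = c * vcinner x y"
  by (simp add: vcinner_def sum_distrib_left mult.assoc)

lemma vcinner_commute: "vcinner x y = cnj (vcinner y x)"
  by (simp add: vcinner_def mult.commute)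

lemma hardy_holomorphic: "(\<lambda>z. hardy_fun F z $ i) holomorphic_on disc"
  and hardy_off_disc: "z \<notin> disc \<Longrightarrow> hardy_fun F z = 0"
  and hardy_summable: "summable (\<lambda>n. (norm (hcoeff F n))\<^sup>2)"
  using hardy_fun [of F] by auto

lemma summable_vcinner: "summable (\<lambda>n. vcinner (hcoeff F n) (hcoeff G n))"
  by (rule summable_comparison_test' [OF summable_add [OF hardy_summable [of F] hardy_summable [of G]]])
    (simp add: norm_vcinner_le)

lemma hardy_eqI:
  assumes "\<And>n. hcoeff F n = hcoeff G n"
  shows "F = G"
proof -
  have "hardy_fun F z = hardy_fun G z" for z
  proof (cases "z \<in> disc")
    case True
    have "hardy_fun F z $ i = hardy_fun G z $ i" for i
    proof (rule holomorphic_fun_eq_on_ball [OF hardy_holomorphic hardy_holomorphic True])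
      show "(deriv ^^ n) (\<lambda>z. hardy_fun F z $ i) 0 = (deriv ^^ n) (\<lambda>z. hardy_fun G z $ i) 0" for n
        using assms [of n] by (simp add: vec_eq_iff vtaylor_coeff_def taylor_coeff_def)
    qed
    then show ?thesis by (simp add: vec_eq_iff)
  qed (simp add: hardy_off_disc)
  then show ?thesis
    by (simp add: hardy_fun_inject [symmetric] fun_eq_iff)
qed

instantiation hardy :: (finite) complex_inner
begin

lift_definition zero_hardy :: "'a hardy" is "\<lambda>_. 0"
  by (auto simp: vtaylor_coeff_def taylor_coeff_def vec_eq_iff norm_vec_def L2_set_def)

lift_definition plus_hardy :: "'a hardy \<Rightarrow> 'a hardy \<Rightarrow> 'a hardy" is "\<lambda>F G z. F z + G z"
  by (auto intro: holomorphic_intros hardy_add_closed)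

lift_definition scaleC_hardy :: "complex \<Rightarrow> 'a hardy \<Rightarrow> 'a hardy" is "\<lambda>c F z. c *s F z"
  by (auto intro: holomorphic_intros hardy_scale_closed)

definition uminus_hardy :: "'a hardy \<Rightarrow> 'a hardy"
  where "uminus_hardy F = (-1) *\<^sub>C F"

definition minus_hardy :: "'a hardy \<Rightarrow> 'a hardy \<Rightarrow> 'a hardy"
  where "minus_hardy F G = F + - G"

definition scaleR_hardy :: "real \<Rightarrow> 'a hardy \<Rightarrow> 'a hardy"
  where "scaleR_hardy r F = complex_of_real r *\<^sub>C F"

definition cinner_hardy :: "'a hardy \<Rightarrow> 'a hardy \<Rightarrow> complex"
  where "cinner_hardy F G = (\<Sum>n. vcinner (hcoeff F n) (hcoeff G n))"

definition inner_hardy :: "'a hardy \<Rightarrow> 'a hardy \<Rightarrow> real"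
  where "inner_hardy F G = Re (cinner F G)"

definition norm_hardy :: "'a hardy \<Rightarrow> real"
  where "norm_hardy F = sqrt (inner F F)"

definition sgn_hardy :: "'a hardy \<Rightarrow> 'a hardy"
  where "sgn_hardy F = scaleR (inverse (norm F)) F"

definition dist_hardy :: "'a hardy \<Rightarrow> 'a hardy \<Rightarrow> real"
  where "dist_hardy F G = norm (F - G)"

definition uniformity_hardy :: "('a hardy \<times> 'a hardy) filter"
  where "uniformity_hardy = (INF e\<in>{0 <..}. principal {(F, G). dist F G < e})"

definition open_hardy :: "'a hardy set \<Rightarrow> bool"
  where "open_hardy S \<longleftrightarrow> (\<forall>F\<in>S. \<forall>\<^sub>F (F', G) in uniformity. F' = F \<longrightarrow> G \<in> S)"

lemma hcoeff_zero: "hcoeff (0 :: 'a hardy) n = 0"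
  by (simp add: zero_hardy.rep_eq vtaylor_coeff_def taylor_coeff_def vec_eq_iff)

lemma hcoeff_add: "hcoeff (F + G :: 'a hardy) n = hcoeff F n + hcoeff G n"
  by (simp add: plus_hardy.rep_eq vtaylor_coeff_add hardy_holomorphic)

lemma hcoeff_scaleC: "hcoeff (c *\<^sub>C F :: 'a hardy) n = c *s hcoeff F n"
  by (simp add: scaleC_hardy.rep_eq vtaylor_coeff_scale hardy_holomorphic)

lemma inner_hardy_self: "inner F F = (\<Sum>n. (norm (hcoeff F n))\<^sup>2)" for F :: "'a hardy"
  by (simp add: inner_hardy_def cinner_hardy_def Re_suminf summable_vcinner vcinner_self)

instance
proof
  fix F G H :: "'a hardy" and b c :: complex and r s :: real
  note coeff = hcoeff_zero hcoeff_add hcoeff_scaleC scaleR_hardy_def uminus_hardy_def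
    minus_hardy_def vec_eq_iff algebra_simps
  show "F + G + H = F + (G + H)" "F + G = G + F" "0 + F = F" "- F + F = 0" "F - G = F + - G"
    "r *\<^sub>R (F + G) = r *\<^sub>R F + r *\<^sub>R G" "(r + s) *\<^sub>R F = r *\<^sub>R F + s *\<^sub>R F"
    "r *\<^sub>R s *\<^sub>R F = (r * s) *\<^sub>R F" "1 *\<^sub>R F = F"
    "c *\<^sub>C (F + G) = c *\<^sub>C F + c *\<^sub>C G" "(b + c) *\<^sub>C F = b *\<^sub>C F + c *\<^sub>C F"
    "b *\<^sub>C c *\<^sub>C F = (b * c) *\<^sub>C F" "complex_of_real r *\<^sub>C F = r *\<^sub>R F"
    by (rule hardy_eqI; simp add: coeff)+
  show comm: "cinner F G = cnj (cinner G F)" for F G :: "'a hardy"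
  proof -
    have "(\<lambda>n. vcinner (hcoeff G n) (hcoeff F n)) sums cinner G F"
      using summable_vcinner by (auto simp: cinner_hardy_def)
    then have "(\<lambda>n. vcinner (hcoeff F n) (hcoeff G n)) sums cnj (cinner G F)"
      by (subst vcinner_commute) (simp add: sums_cnj)
    then show ?thesis
      by (simp add: cinner_hardy_def sums_iff)
  qed
  show add: "cinner (F + G) H = cinner F H + cinner G H"
    by (simp add: cinner_hardy_def hcoeff_add vcinner_add_left suminf_add summable_vcinner)
  show scale: "cinner (c *\<^sub>C F) G = c * cinner F G" for c
    by (simp add: cinner_hardy_def hcoeff_scaleC vcinner_scale_left suminf_mult summable_vcinner)
  show "Re (cinner F G) = inner F G"
    by (simp add: inner_hardy_def)
  show "inner F G = inner G F"
    using comm [of F G] by (simp add: inner_hardy_def)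
  show "inner (F + G) H = inner F H + inner G H"
    by (simp add: inner_hardy_def add)
  show "inner (r *\<^sub>R F) G = r * inner F G"
    by (simp add: inner_hardy_def scaleR_hardy_def scale)
  show "0 \<le> inner F F"
    unfolding inner_hardy_self by (rule suminf_nonneg [OF hardy_summable]) simp
  have "F = 0" if "inner F F = 0"
    using that suminf_eq_zero_iff [OF hardy_summable [of F]]
    by (intro hardy_eqI) (simp add: inner_hardy_self hcoeff_zero)
  then show "inner F F = 0 \<longleftrightarrow> F = 0"
    by (auto simp: inner_hardy_self hcoeff_zero)
qed (simp_all add: norm_hardy_def sgn_hardy_def dist_hardy_def uniformity_hardy_def open_hardy_def)

end

lemma taylor_coeff_eqI:
  assumes "\<And>z. z \<in> disc \<Longrightarrow> (\<lambda>n. c n * z ^ n) sums g z"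
  shows "taylor_coeff g n = c n"
proof -
  have "\<forall>\<^sub>F z in nhds 0. z \<in> disc"
    by (rule eventually_nhds_in_open) auto
  then have "\<forall>\<^sub>F z in nhds 0. (\<lambda>n. fps_nth (Abs_fps c) n * z ^ n) sums g z"
    by eventually_elim (use assms in simp)
  then have "g has_fps_expansion Abs_fps c"
    by (rule has_fps_expansionI)
  then show ?thesis
    using fps_nth_fps_expansion [of g "Abs_fps c" n] by (simp add: taylor_coeff_def)
qed

lemma norm_hcoeff_sum_le: "(\<Sum>n<m. (norm (hcoeff F n))\<^sup>2) \<le> (norm F)\<^sup>2"
  unfolding power2_norm_eq_inner [of F] inner_hardy_self by (rule sum_le_suminf [OF hardy_summable]) auto

lemma norm_hcoeff_le: "norm (hcoeff F n) \<le> norm F"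
proof -
  have "(norm (hcoeff F n))\<^sup>2 \<le> (\<Sum>k<Suc n. (norm (hcoeff F k))\<^sup>2)"
    by (simp add: sum_nonneg)
  also have "\<dots> \<le> (norm F)\<^sup>2"
    by (rule norm_hcoeff_sum_le)
  finally show ?thesis
    by (rule power2_le_imp_le) simp
qed

lemma hcoeff_minus: "hcoeff (F - G) n = hcoeff F n - hcoeff G n"
  using hcoeff_add [of "F - G" G n] by simp

lemma hardy_with_coeffs:
  fixes c :: "nat \<Rightarrow> complex ^ 'd::finite"
  assumes c: "summable (\<lambda>n. (norm (c n))\<^sup>2)"
  obtains F where "\<And>n. hcoeff F n = c n"
proof -
  obtain B where B: "norm ((norm (c n))\<^sup>2) \<le> B" for n
    using summable_imp_bounded [OF c] by (auto simp: bounded_iff)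
  have bound: "norm (c n $ i) \<le> sqrt B" for n i
  proof -
    have "norm (c n) \<le> sqrt B"
      using B [of n] by (simp add: real_le_rsqrt)
    then show ?thesis
      using Finite_Cartesian_Product.norm_nth_le [of "c n" i] by linarith
  qed
  define F :: "complex \<Rightarrow> complex ^ 'd"
    where "F z = (if z \<in> disc then \<chi> i. \<Sum>n. c n $ i * z ^ n else 0)" for z
  have sums: "(\<lambda>n. c n $ i * z ^ n) sums (F z $ i)" if "z \<in> disc" for z i
  proof -
    have "summable (\<lambda>n. c n $ i * z ^ n)"
    proof (rule summable_comparison_test')
      show "summable (\<lambda>n. sqrt B * norm z ^ n)"
        using that by (intro summable_mult summable_geometric) auto
      show "norm (c n $ i * z ^ n) \<le> sqrt B * norm z ^ n" if "n \<ge> 0" for n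
        by (simp add: norm_mult norm_power bound mult_right_mono)
    qed
    then show ?thesis
      using that by (simp add: F_def summable_sums)
  qed
  have coeff: "vtaylor_coeff F n = c n" for n
    unfolding vtaylor_coeff_def vec_eq_iff using taylor_coeff_eqI [OF sums] by simp
  have "hardy_fun (Abs_hardy F) = F"
  proof (rule Abs_hardy_inverse, intro CollectI conjI allI impI)
    show "(\<lambda>z. F z $ i) holomorphic_on disc" for i
      by (rule power_series_holomorphic [where a = "\<lambda>n. c n $ i"]) (use sums in simp)
    show "F z = 0" if "z \<notin> disc" for z
      using that by (simp add: F_def)
    show "summable (\<lambda>n. (norm (vtaylor_coeff F n))\<^sup>2)"
      using c by (simp add: coeff)
  qed
  with coeff show thesis
    by (intro that [of "Abs_hardy F"]) simp
qed

instance hardy :: (finite) complex_hilbert_space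
proof
  fix X :: "nat \<Rightarrow> 'a hardy"
  assume X: "Cauchy X"
  have "Cauchy (\<lambda>k. hcoeff (X k) n)" for n
  proof (rule metric_CauchyI)
    fix e :: real assume "e > 0"
    then obtain M where M: "\<And>k l. k \<ge> M \<Longrightarrow> l \<ge> M \<Longrightarrow> norm (X k - X l) < e"
      using CauchyD [OF X] by blast
    have "dist (hcoeff (X k) n) (hcoeff (X l) n) < e" if "k \<ge> M" "l \<ge> M" for k l
      using M [OF that] norm_hcoeff_le [of "X k - X l" n] by (simp add: hcoeff_minus dist_norm)
    then show "\<exists>M. \<forall>k\<ge>M. \<forall>l\<ge>M. dist (hcoeff (X k) n) (hcoeff (X l) n) < e"
      by blast
  qed
  then have "\<exists>c. (\<lambda>k. hcoeff (X k) n) \<longlonglongrightarrow> c" for n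
    by (simp add: Cauchy_convergent_iff convergent_def)
  then have "\<exists>c. \<forall>n. (\<lambda>k. hcoeff (X k) n) \<longlonglongrightarrow> c n"
    by (intro choice allI)
  then obtain c where c: "(\<lambda>k. hcoeff (X k) n) \<longlonglongrightarrow> c n" for n
    by blast
  have tail: "\<exists>M. \<forall>k\<ge>M. \<forall>m. (\<Sum>n<m. (norm (hcoeff (X k) n - c n))\<^sup>2) \<le> e\<^sup>2" if "e > 0" for e
  proof -
    obtain M where M: "\<And>k l. k \<ge> M \<Longrightarrow> l \<ge> M \<Longrightarrow> norm (X k - X l) < e"
      using CauchyD [OF X \<open>e > 0\<close>] by blast
    have "(\<Sum>n<m. (norm (hcoeff (X k) n - c n))\<^sup>2) \<le> e\<^sup>2" if "k \<ge> M" for k m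
    proof (rule tendsto_upperbound)
      show "(\<lambda>l. \<Sum>n<m. (norm (hcoeff (X k) n - hcoeff (X l) n))\<^sup>2)
          \<longlonglongrightarrow> (\<Sum>n<m. (norm (hcoeff (X k) n - c n))\<^sup>2)"
        by (intro tendsto_intros c)
      show "\<forall>\<^sub>F l in sequentially. (\<Sum>n<m. (norm (hcoeff (X k) n - hcoeff (X l) n))\<^sup>2) \<le> e\<^sup>2"
        using eventually_ge_at_top [of M]
      proof eventually_elim
        case (elim l)
        have "(\<Sum>n<m. (norm (hcoeff (X k) n - hcoeff (X l) n))\<^sup>2) \<le> (norm (X k - X l))\<^sup>2"
          using norm_hcoeff_sum_le [where m = m and F = "X k - X l"] by (simp add: hcoeff_minus)
        also have "\<dots> \<le> e\<^sup>2"
          using M [OF \<open>k \<ge> M\<close> elim] by (simp add: power_mono)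
        finally show ?case .
      qed
    qed simp
    then show ?thesis by blast
  qed
  have "summable (\<lambda>n. (norm (c n))\<^sup>2)"
  proof -
    obtain k where k: "\<And>m. (\<Sum>n<m. (norm (hcoeff (X k) n - c n))\<^sup>2) \<le> 1"
      using tail [of 1] by auto
    have "summable (\<lambda>n. (norm (hcoeff (X k) n - c n))\<^sup>2)"
      using k by (intro summableI_nonneg_bounded [where x = 1]) auto
    then have "summable (\<lambda>n. 2 * (norm (hcoeff (X k) n))\<^sup>2 + 2 * (norm (hcoeff (X k) n - c n))\<^sup>2)"
      by (intro summable_add summable_mult hardy_summable)
    then show ?thesis
    proof (rule summable_comparison_test')
      show "norm ((norm (c n))\<^sup>2)
          \<le> 2 * (norm (hcoeff (X k) n))\<^sup>2 + 2 * (norm (hcoeff (X k) n - c n))\<^sup>2" if "n \<ge> 0" for n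
        using norm_add_square_le [of "hcoeff (X k) n" "c n - hcoeff (X k) n"]
        by (simp add: norm_minus_commute)
    qed
  qed
  then obtain F where F: "\<And>n. hcoeff F n = c n"
    using hardy_with_coeffs by blast
  have "X \<longlonglongrightarrow> F"
  proof (rule LIMSEQ_I)
    fix r :: real assume "r > 0"
    obtain M where M: "\<And>k m. k \<ge> M \<Longrightarrow> (\<Sum>n<m. (norm (hcoeff (X k) n - c n))\<^sup>2) \<le> (r/2)\<^sup>2"
      using tail [of "r/2"] \<open>r > 0\<close> by auto
    have "norm (X k - F) < r" if "k \<ge> M" for k
    proof -
      have "(norm (X k - F))\<^sup>2 = (\<Sum>n. (norm (hcoeff (X k - F) n))\<^sup>2)"
        by (simp only: power2_norm_eq_inner [of "X k - F"] inner_hardy_self)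
      also have "\<dots> \<le> (r/2)\<^sup>2"
        using M [OF that] by (intro suminf_le_const hardy_summable) (simp add: hcoeff_minus F)
      finally have "norm (X k - F) \<le> r/2"
        by (rule power2_le_imp_le) (use \<open>r > 0\<close> in simp)
      then show ?thesis using \<open>r > 0\<close> by simp
    qed
    then show "\<exists>M. \<forall>k\<ge>M. norm (X k - F) < r" by blast
  qed
  then show "convergent X"
    by (auto simp: convergent_def)
qed


section \<open>Multiplication operators and rational pure inner functions\<close>

definition mult_op :: "(complex \<Rightarrow> complex ^ 'd ^ 'd) \<Rightarrow> 'd::finite hardy \<Rightarrow> 'd hardy"
  where "mult_op \<Phi> F = Abs_hardy (\<lambda>z. if z \<in> disc then \<Phi> z *v hardy_fun F z else 0)"

text \<open>\<open>M\<^sub>z \<otimes> I\<close>: multiplication by the scalar matrix \<open>z I\<close>.\<close>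

definition shift_op :: "'d::finite hardy \<Rightarrow> 'd hardy"
  where "shift_op = mult_op mat"

definition Hinf_matrix :: "(complex \<Rightarrow> complex ^ 'd ^ 'd::finite) \<Rightarrow> bool"
  where "Hinf_matrix \<Phi> \<longleftrightarrow>
    (\<forall>i j. (\<lambda>z. \<Phi> z $ i $ j) holomorphic_on disc) \<and> bounded (\<Phi> ` disc)"

definition inner_function :: "(complex \<Rightarrow> complex ^ 'd ^ 'd::finite) \<Rightarrow> bool"
  where "inner_function \<Phi> \<longleftrightarrow> Hinf_matrix \<Phi> \<and> linear_isometry (mult_op \<Phi>)"

definition rational_entries :: "(complex \<Rightarrow> complex ^ 'd ^ 'd::finite) \<Rightarrow> bool"
  where "rational_entries \<Phi> \<longleftrightarrow>
    (\<forall>i j. \<exists>p q :: complex poly. \<forall>z\<in>disc. poly q z \<noteq> 0 \<and> \<Phi> z $ i $ j = poly p z / poly q z)"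

definition matrix_spectrum :: "complex ^ 'd ^ 'd::finite \<Rightarrow> complex set"
  where "matrix_spectrum A = {\<mu>. \<not> invertible (mat \<mu> - A)}"

definition rational_pure_inner :: "(complex \<Rightarrow> complex ^ 'd ^ 'd::finite) \<Rightarrow> bool"
  where "rational_pure_inner \<Psi> \<longleftrightarrow>
    inner_function \<Psi> \<and> rational_entries \<Psi> \<and> (\<forall>z\<in>disc. matrix_spectrum (\<Psi> z) \<subseteq> disc)"


section \<open>Functional calculus and the annihilator\<close>

text \<open>Holomorphy in two variables is complex Frechet differentiability at every point.\<close>

definition Hinf_bidisc :: "(complex \<times> complex \<Rightarrow> complex) set"
  where "Hinf_bidisc =
    {f. (\<forall>p\<in>bidisc. \<exists>a b. (f has_derivative (\<lambda>(h, k). a * h + b * k)) (at p)) \<and> bounded (f ` bidisc)}"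

definition matrix_power :: "complex ^ 'd ^ 'd::finite \<Rightarrow> nat \<Rightarrow> complex ^ 'd ^ 'd"
  where "matrix_power A n = ((\<lambda>B. A ** B) ^^ n) (mat 1)"

text \<open>The holomorphic function \<open>g(A)\<close> for \<open>g\<close> holomorphic on the disc and \<open>\<sigma>(A)\<close> contained in the
  disc: the power series of \<open>g\<close> at 0 evaluated at \<open>A\<close>.\<close>

definition matrix_fun :: "(complex \<Rightarrow> complex) \<Rightarrow> complex ^ 'd ^ 'd::finite \<Rightarrow> complex ^ 'd ^ 'd"
  where "matrix_fun g A = (\<Sum>n. \<chi> i j. taylor_coeff g n * matrix_power A n $ i $ j)"

text \<open>\<open>f(M\<^sub>z \<otimes> I, M\<^sub>\<Psi>)\<close>.\<close>

definition model_calc ::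
  "(complex \<Rightarrow> complex ^ 'd ^ 'd) \<Rightarrow> (complex \<times> complex \<Rightarrow> complex) \<Rightarrow> 'd::finite hardy \<Rightarrow> 'd hardy"
  where "model_calc \<Psi> f = mult_op (\<lambda>z. matrix_fun (\<lambda>w. f (z, w)) (\<Psi> z))"

text \<open>\<open>f(T\<^sub>1, T\<^sub>2) = J\<^sup>* f(M\<^sub>z \<otimes> I, M\<^sub>\<Psi>) J\<close>; the pair \<open>(T\<^sub>1, T\<^sub>2)\<close> enters through \<open>J\<close> and \<open>\<Psi>\<close>.\<close>

definition pair_calc ::
  "('h::complex_hilbert_space \<Rightarrow> 'd::finite hardy) \<Rightarrow> (complex \<Rightarrow> complex ^ 'd ^ 'd) \<Rightarrow>
    (complex \<times> complex \<Rightarrow> complex) \<Rightarrow> 'h \<Rightarrow> 'h"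
  where "pair_calc J \<Psi> f = (\<lambda>h. cadj J (model_calc \<Psi> f (J h)))"

definition Ann ::
  "('h::complex_hilbert_space \<Rightarrow> 'd::finite hardy) \<Rightarrow> (complex \<Rightarrow> complex ^ 'd ^ 'd) \<Rightarrow>
    (complex \<times> complex \<Rightarrow> complex) set"
  where "Ann J \<Psi> = {f \<in> Hinf_bidisc. pair_calc J \<Psi> f = (\<lambda>h. 0)}"

definition zero_set :: "(complex \<times> complex \<Rightarrow> complex) set \<Rightarrow> (complex \<times> complex) set"
  where "zero_set F = {p \<in> bidisc. \<forall>f\<in>F. f p = 0}"


section \<open>The constrained isometric co-extension\<close>

definition K_space ::
  "('h::complex_hilbert_space \<Rightarrow> 'd::finite hardy) \<Rightarrow> (complex \<Rightarrow> complex ^ 'd ^ 'd) \<Rightarrow> 'd hardy set"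
  where "K_space J \<Psi> = (\<Inter>f\<in>Ann J \<Psi>. {F. cadj (model_calc \<Psi> f) F = 0})"

definition S1 ::
  "('h::complex_hilbert_space \<Rightarrow> 'd::finite hardy) \<Rightarrow> (complex \<Rightarrow> complex ^ 'd ^ 'd) \<Rightarrow>
    'd hardy \<Rightarrow> 'd hardy"
  where "S1 J \<Psi> = compression (K_space J \<Psi>) shift_op"

definition S2 ::
  "('h::complex_hilbert_space \<Rightarrow> 'd::finite hardy) \<Rightarrow> (complex \<Rightarrow> complex ^ 'd ^ 'd) \<Rightarrow>
    'd hardy \<Rightarrow> 'd hardy"
  where "S2 J \<Psi> = compression (K_space J \<Psi>) (mult_op \<Psi>)"

definition Omega ::
  "('h::complex_hilbert_space \<Rightarrow> 'd::finite hardy) \<Rightarrow> (complex \<Rightarrow> complex ^ 'd ^ 'd) \<Rightarrow>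
    (complex \<times> complex) set"
  where "Omega J \<Psi> =
    {(l, m). joint_eigenvalue (K_space J \<Psi>)
      (cadj_on (K_space J \<Psi>) (S1 J \<Psi>)) (cadj_on (K_space J \<Psi>) (S2 J \<Psi>)) (cnj l) (cnj m)}"

end

theory Submission
  imports Defs
begin

text \<open>
  Let \<open>v\<close> be a joint eigenvector of the adjoints of \<open>M\<^sub>z \<otimes> I\<close> and \<open>M\<^sub>\<Psi>\<close> for the conjugates of \<open>l\<close> and \<open>m\<close>. The
  first eigenvalue equation says that \<open>v\<close> is a kernel vector \<open>k\<^sub>l \<otimes> x\<close> with \<open>l\<close> in the disc
  (\<open>shift_eigenvector\<close>). The second then says that \<open>x\<close> is a left eigenvector of the matrix \<open>\<Psi>(l)\<close> for the
  eigenvalue \<open>m\<close>. On such a vector the adjoint of \<open>f(M\<^sub>z \<otimes> I, M\<^sub>\<Psi>)\<close> is multiplication by the conjugate of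
  \<open>f(l, m)\<close> (\<open>cinner_model_calc_szego_kernel\<close>), so \<open>v\<close> lies in the constrained space exactly when all
  annihilating functions vanish at \<open>(l, m)\<close>. As the constrained space is co-invariant, the adjoints of
  the compressions are the restrictions of the adjoints (\<open>S1_S2_cadj\<close>). Hence \<open>(l, m)\<close> belongs to
  \<open>Omega\<close> if and only if it belongs to the zero set of the annihilator and \<open>m\<close> is an eigenvalue of \<open>\<Psi>(l)\<close>.

  The last condition is automatic on the zero set. By the Cayley-Hamilton theorem the bounded holomorphic
  function \<open>det (w - \<Psi>(z))\<close> belongs to the annihilator (\<open>char_function_in_Ann\<close>), and its zeros are the
  points \<open>(z, w)\<close> for which \<open>w\<close> is an eigenvalue of \<open>\<Psi>(z)\<close>.

  For this argument the operators \<open>f(M\<^sub>z \<otimes> I, M\<^sub>\<Psi>)\<close> have to be bounded operators with adjoints, so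
  \<open>z \<mapsto> f(z, \<Psi>(z))\<close> has to be bounded and holomorphic on the disc (\<open>Hinf_matrix_matrix_fun\<close>). An inner
  function takes contractive values (\<open>inner_function_contractive\<close>), and a contractive matrix with
  spectrum in the disc has geometrically decaying powers (\<open>power_decayingI\<close>), so the series of
  \<open>f(z, \<Psi>(z))\<close> converges locally uniformly in \<open>z\<close>. The bound is the von Neumann inequality
  (\<open>von_neumann_inequality\<close>), proved by integration against the positive Poisson kernel of the matrix.
\<close>

section \<open>Projections, representing vectors and adjoints in Hilbert space\<close>

lemma cinner_add_right: "cinner x (y + z) = cinner x y + cinner x z"
  by (metis cinner_add_left cinner_commute complex_cnj_add)

lemma cinner_scaleC_right: "cinner x (c *\<^sub>C y) = cnj c * cinner x y"
  by (metis cinner_commute cinner_scaleC_left complex_cnj_mult)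

lemma cinner_diff_left: "cinner (x - y) z = cinner x z - cinner y z"
  using cinner_add_left [of "x - y" y z] by simp

lemma cinner_diff_right: "cinner x (y - z) = cinner x y - cinner x z"
  using cinner_add_right [of x "y - z" z] by simp

lemma cinner_zero_left [simp]: "cinner 0 x = 0"
  using cinner_diff_left [of 0 0 x] by simp

lemma cinner_zero_right [simp]: "cinner x 0 = 0"
  using cinner_diff_right [of x 0 0] by simp

lemma cinner_self_eq_0: "cinner x x = 0 \<Longrightarrow> x = 0"
  by (metis Re_cinner inner_eq_zero_iff zero_complex.simps(1))

lemma norm_scaleC: "norm (c *\<^sub>C x) = cmod c * norm x"
proof -
  have "cinner (c *\<^sub>C x) (c *\<^sub>C x) = complex_of_real ((cmod c)\<^sup>2) * cinner x x"
    unfolding complex_norm_square by (simp only: cinner_scaleC_left cinner_scaleC_right mult_ac)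
  then have "inner (c *\<^sub>C x) (c *\<^sub>C x) = (cmod c)\<^sup>2 * inner x x"
    by (simp flip: Re_cinner)
  then have "(norm (c *\<^sub>C x))\<^sup>2 = (cmod c * norm x)\<^sup>2"
    by (simp add: power2_norm_eq_inner power_mult_distrib)
  then show ?thesis
    by (rule power2_eq_imp_eq) auto
qed

lemma phase_exists: "\<exists>c. cmod c = 1 \<and> c * z = complex_of_real (cmod z)"
proof (cases "z = 0")
  case False
  then show ?thesis
    by (intro exI [of _ "cmod z / z"]) (simp add: norm_divide)
qed (auto intro: exI [of _ 1])

lemma norm_cinner_le: "cmod (cinner x y) \<le> norm x * norm y"
proof -
  obtain c where c: "cmod c = 1" "c * cinner x y = complex_of_real (cmod (cinner x y))"
    using phase_exists by blast
  have "cmod (cinner x y) = Re (cinner (c *\<^sub>C x) y)"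
    by (simp add: cinner_scaleC_left c)
  also have "\<dots> \<le> norm (c *\<^sub>C x) * norm y"
    unfolding Re_cinner by (rule norm_cauchy_schwarz)
  finally show ?thesis
    by (simp add: norm_scaleC c)
qed

text \<open>The inner product is definite on \<open>U\<close>, so at most one vector of \<open>U\<close> satisfies the adjoint relation.
  Adjoints on explicitly known vectors can therefore be read off without an existence argument.\<close>

lemma cadj_on_eqI:
  assumes U: "complex_vector.subspace U" and x: "x \<in> U" "\<And>u. u \<in> U \<Longrightarrow> cinner (T u) y = cinner u x"
  shows "cadj_on U T y = x"
  unfolding cadj_on_def
proof (rule the_equality)
  show "x' = x" if "x' \<in> U \<and> (\<forall>u\<in>U. cinner (T u) y = cinner u x')" for x'
  proof -
    have "x' - x \<in> U"
      using that x U by (simp add: complex_vector.subspace_diff)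
    then have "cinner (x' - x) (x' - x) = 0"
      using that x by (metis cinner_diff_right right_minus_eq)
    then show ?thesis
      using cinner_self_eq_0 by fastforce
  qed
qed (use x in auto)

lemma cadj_eqI: "(\<And>u. cinner (T u) y = cinner u x) \<Longrightarrow> cadj T y = x"
  by (rule cadj_on_eqI) auto

text \<open>First variation of the distance: comparing \<open>p\<close> with \<open>p + s h\<close> for real \<open>s\<close> kills the real part of the
  inner product, and the choice \<open>h = \<i> k\<close> kills the imaginary part.\<close>

lemma closest_point_orthogonal:
  fixes x p :: "'a::complex_inner"
  assumes K: "complex_vector.subspace K" and p: "p \<in> K"
    and min: "\<And>k. k \<in> K \<Longrightarrow> norm (x - p) \<le> norm (x - k)"
    and k: "k \<in> K"
  shows "cinner (x - p) k = 0"
proof -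
  have real: "inner (x - p) h = 0" if h: "h \<in> K" for h
  proof -
    let ?a = "inner (x - p) h" and ?b = "inner h h"
    have ineq: "2 * s * ?a \<le> s\<^sup>2 * ?b" for s :: real
    proof -
      have "p + s *\<^sub>R h \<in> K"
        using K p h by (metis complex_vector.subspace_add complex_vector.subspace_scale scaleC_of_real)
      then have "(norm (x - p))\<^sup>2 \<le> (norm ((x - p) - s *\<^sub>R h))\<^sup>2"
        using min by (simp add: diff_diff_eq power_mono)
      also have "\<dots> = (norm (x - p))\<^sup>2 - 2 * s * ?a + s\<^sup>2 * ?b"
        unfolding power2_norm_eq_inner inner_diff_left [of "x - p"] inner_diff_right [of _ "x - p"]
        by (simp add: inner_commute power2_eq_square algebra_simps)
      finally show ?thesis
        by simp
    qed
    show ?thesis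
    proof (cases "?b = 0")
      case False
      then have b: "?b > 0"
        by (metis inner_ge_zero less_eq_real_def)
      \<comment> \<open>The value of \<open>s\<close> at which \<open>p + s h\<close> is closest to \<open>x\<close>.\<close>
      have "2 * (?a / ?b) * ?a \<le> (?a / ?b)\<^sup>2 * ?b"
        by (rule ineq)
      then have "2 * (?a * ?a) / ?b \<le> (?a * ?a) / ?b"
        using b by (simp add: power2_eq_square)
      then have "?a * ?a \<le> 0"
        using b by (simp add: divide_le_cancel)
      then show ?thesis
        by (metis mult_le_0_iff order_antisym_conv order_refl zero_le_square mult_eq_0_iff)
    qed simp
  qed
  have "\<i> *\<^sub>C k \<in> K"
    using K k by (rule complex_vector.subspace_scale)
  then have "Re (cinner (x - p) (\<i> *\<^sub>C k)) = 0"
    using real by (simp add: Re_cinner)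
  then have "Im (cinner (x - p) k) = 0"
    by (simp add: cinner_scaleC_right)
  moreover have "Re (cinner (x - p) k) = 0"
    using real [OF k] by (simp add: Re_cinner)
  ultimately show ?thesis
    by (simp add: complex_eq_iff)
qed

text \<open>By the parallelogram law a sequence in \<open>K\<close> that minimises the distance to \<open>x\<close> is a Cauchy sequence.\<close>

lemma orthogonal_projection_exists:
  fixes x :: "'a::complex_hilbert_space"
  assumes K: "complex_vector.subspace K" and cl: "closed K"
  shows "\<exists>p\<in>K. \<forall>k\<in>K. cinner (x - p) k = 0"
proof -
  have ne: "K \<noteq> {}"
    using complex_vector.subspace_0 [OF K] by auto
  define d where "d = infdist x K"
  have d0: "d \<ge> 0"
    by (simp add: d_def infdist_nonneg)
  have d_le: "d \<le> norm (x - k)" if "k \<in> K" for k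
    using that unfolding d_def by (metis dist_norm infdist_le)
  have "\<exists>k\<in>K. (norm (x - k))\<^sup>2 < d\<^sup>2 + 1 / Suc n" for n
  proof -
    have "d < sqrt (d\<^sup>2 + 1 / Suc n)"
      by (rule real_less_rsqrt) simp
    then have "infdist x K < sqrt (d\<^sup>2 + 1 / Suc n)"
      by (simp add: d_def)
    then obtain k where "k \<in> K" "dist x k < sqrt (d\<^sup>2 + 1 / Suc n)"
      using ne by (force simp: infdist_def cInf_less_iff)
    then have "(norm (x - k))\<^sup>2 < (sqrt (d\<^sup>2 + 1 / Suc n))\<^sup>2"
      by (intro power_strict_mono) (auto simp: dist_norm)
    then show ?thesis
      using \<open>k \<in> K\<close> by (auto simp: add_nonneg_nonneg)
  qed
  then obtain k where k: "\<And>n. k n \<in> K" "\<And>n. (norm (x - k n))\<^sup>2 < d\<^sup>2 + 1 / Suc n"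
    by metis
  have near: "(norm (k m - k n))\<^sup>2 \<le> 2 / Suc m + 2 / Suc n" for m n
  proof -
    have "(1/2 :: real) *\<^sub>R (k m + k n) \<in> K"
      using K k(1) by (metis complex_vector.subspace_add complex_vector.subspace_scale scaleC_of_real)
    from d_le [OF this] have "d\<^sup>2 \<le> (norm (x - (1/2) *\<^sub>R (k m + k n)))\<^sup>2"
      using d0 by (simp add: power_mono)
    moreover have "(norm (k m - k n))\<^sup>2 + 4 * (norm (x - (1/2) *\<^sub>R (k m + k n)))\<^sup>2
        = 2 * (norm (x - k m))\<^sup>2 + 2 * (norm (x - k n))\<^sup>2"
      by (simp add: power2_norm_eq_inner inner_diff_left inner_diff_right inner_add_left
          inner_add_right inner_commute algebra_simps)
    ultimately show ?thesis
      using k(2) [of m] k(2) [of n] by simp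
  qed
  have "Cauchy k"
  proof (rule CauchyI)
    fix e :: real assume e: "e > 0"
    obtain M where M: "1 / Suc M < e\<^sup>2 / 4"
      using e by (metis nat_approx_posE zero_less_divide_iff zero_less_numeral zero_less_power)
    have "norm (k m - k n) < e" if "m \<ge> M" "n \<ge> M" for m n
    proof -
      have "1 / Suc m \<le> 1 / Suc M" "1 / Suc n \<le> 1 / Suc M"
        using that by (auto simp: frac_le)
      then have "(norm (k m - k n))\<^sup>2 < e\<^sup>2"
        using near [of m n] M by simp
      then show ?thesis
        using e by (simp add: power_less_imp_less_base)
    qed
    then show "\<exists>M. \<forall>m\<ge>M. \<forall>n\<ge>M. norm (k m - k n) < e"
      by blast
  qed
  then obtain p where p: "k \<longlonglongrightarrow> p"
    by (auto simp: Cauchy_convergent_iff convergent_def)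
  have pK: "p \<in> K"
    using cl k(1) p by (metis closed_sequentially)
  have "(norm (x - p))\<^sup>2 \<le> d\<^sup>2"
  proof (rule LIMSEQ_le)
    show "(\<lambda>n. (norm (x - k n))\<^sup>2) \<longlonglongrightarrow> (norm (x - p))\<^sup>2"
      by (intro tendsto_intros p)
    show "(\<lambda>n. d\<^sup>2 + 1 / Suc n) \<longlonglongrightarrow> d\<^sup>2"
      using tendsto_add [OF tendsto_const LIMSEQ_Suc [OF lim_1_over_n], of "d\<^sup>2"] by simp
  qed (use k(2) less_imp_le in blast)
  then have "norm (x - p) \<le> d"
    using d0 by (rule power2_le_imp_le)
  then have "norm (x - p) \<le> norm (x - h)" if "h \<in> K" for h
    using d_le [OF that] by simp
  then show ?thesis
    using closest_point_orthogonal [OF K pK] pK by blast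
qed

lemma orth_proj:
  fixes K :: "'a::complex_hilbert_space set"
  assumes K: "complex_vector.subspace K" and cl: "closed K"
  shows "orth_proj K x \<in> K" and "k \<in> K \<Longrightarrow> cinner (x - orth_proj K x) k = 0"
proof -
  have "\<exists>!p. p \<in> K \<and> (\<forall>k\<in>K. cinner (x - p) k = 0)"
  proof (rule ex_ex1I)
    show "\<exists>p. p \<in> K \<and> (\<forall>k\<in>K. cinner (x - p) k = 0)"
      using orthogonal_projection_exists [OF K cl] by blast
    fix p q assume p: "p \<in> K \<and> (\<forall>k\<in>K. cinner (x - p) k = 0)"
      and q: "q \<in> K \<and> (\<forall>k\<in>K. cinner (x - q) k = 0)"
    then have "p - q \<in> K"
      using K by (simp add: complex_vector.subspace_diff)
    then have "cinner (x - p) (p - q) = 0" "cinner (x - q) (p - q) = 0"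
      using p q by blast+
    then have "cinner (p - q) (p - q) = 0"
      by (simp add: cinner_diff_left)
    then show "p = q"
      using cinner_self_eq_0 by fastforce
  qed
  from theI' [OF this] show "orth_proj K x \<in> K" "k \<in> K \<Longrightarrow> cinner (x - orth_proj K x) k = 0"
    unfolding orth_proj_def by auto
qed

lemma closed_orthogonal: "closed {x. \<forall>y\<in>Y. cinner x y = 0}"
proof -
  have "continuous_on UNIV (\<lambda>x. cinner x y)" for y :: 'a
  proof -
    have "cinner x y = complex_of_real (inner x y) + \<i> * complex_of_real (inner x (\<i> *\<^sub>C y))" for x
      by (simp add: complex_eq_iff Re_cinner [symmetric] cinner_scaleC_right)
    then show ?thesis
      by (simp add: continuous_intros)
  qed
  then have "closed {x. cinner x y = 0}" for y :: 'a
    by (intro closed_Collect_eq) (auto intro: continuous_intros)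
  then have "closed (\<Inter>y\<in>Y. {x. cinner x y = 0})"
    by blast
  moreover have "(\<Inter>y\<in>Y. {x. cinner x y = 0}) = {x. \<forall>y\<in>Y. cinner x y = 0}"
    by auto
  ultimately show ?thesis by simp
qed

text \<open>The kernel of a nonzero bounded functional is a proper closed subspace; the representing vector is a
  multiple of any nonzero vector \<open>b\<close> orthogonal to it.\<close>

lemma Riesz_representation:
  fixes \<phi> :: "'a::complex_hilbert_space \<Rightarrow> complex"
  assumes add: "\<And>x y. \<phi> (x + y) = \<phi> x + \<phi> y" and scale: "\<And>c x. \<phi> (c *\<^sub>C x) = c * \<phi> x"
    and bound: "\<And>x. cmod (\<phi> x) \<le> B * norm x"
  obtains y where "\<And>x. \<phi> x = cinner x y"
proof (cases "\<forall>x. \<phi> x = 0")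
  case False
  then obtain a where a: "\<phi> a \<noteq> 0"
    by blast
  have diff: "\<phi> (x - y) = \<phi> x - \<phi> y" for x y
    using add [of "x - y" y] by simp
  define K where "K = {x. \<phi> x = 0}"
  have K: "complex_vector.subspace K"
    unfolding complex_vector.subspace_def K_def
    using diff [of 0 0] by (auto simp: add scale)
  have "continuous_on UNIV \<phi>"
  proof (rule continuous_onI)
    fix x :: 'a and e :: real assume e: "e > 0"
    have "dist (\<phi> x') (\<phi> x) \<le> e" if "dist x' x < e / (\<bar>B\<bar> + 1)" for x'
    proof -
      have "cmod (\<phi> (x' - x)) \<le> (\<bar>B\<bar> + 1) * norm (x' - x)"
        by (rule order_trans [OF bound]) (simp add: mult_right_mono)
      also have "\<dots> \<le> e"
        using that by (simp add: dist_norm field_simps)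
      finally show ?thesis
        by (simp add: dist_norm diff)
    qed
    then show "\<exists>d>0. \<forall>x'\<in>UNIV. dist x' x < d \<longrightarrow> dist (\<phi> x') (\<phi> x) \<le> e"
      using e by (intro exI [of _ "e / (\<bar>B\<bar> + 1)"]) simp
  qed
  then have "closed K"
    unfolding K_def by (intro closed_Collect_eq) (auto intro: continuous_intros)
  then obtain p where p: "p \<in> K" "\<And>k. k \<in> K \<Longrightarrow> cinner (a - p) k = 0"
    using orthogonal_projection_exists [OF K] by metis
  define b where "b = a - p"
  have b: "\<phi> b \<noteq> 0"
    using a p(1) by (simp add: b_def diff K_def)
  have bb: "cinner b b \<noteq> 0"
    using b cinner_self_eq_0 [of b] diff [of 0 0] by auto
  have "\<phi> x = cinner x (cnj (\<phi> b / cinner b b) *\<^sub>C b)" for x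
  proof -
    have "x - (\<phi> x / \<phi> b) *\<^sub>C b \<in> K"
      using b by (simp add: K_def diff scale)
    then have "cinner b (x - (\<phi> x / \<phi> b) *\<^sub>C b) = 0"
      unfolding b_def by (rule p(2))
    then have "cinner (x - (\<phi> x / \<phi> b) *\<^sub>C b) b = 0"
      by (metis cinner_commute complex_cnj_zero)
    then show ?thesis
      using b bb by (simp add: cinner_diff_left cinner_scaleC_left cinner_scaleC_right field_simps)
  qed
  then show ?thesis
    by (rule that)
qed (use that [of 0] in simp)

lemma cinner_cadj:
  fixes T :: "'a::complex_hilbert_space \<Rightarrow> 'b::complex_inner"
  assumes lin: "clinear T" and bound: "\<And>x. norm (T x) \<le> B * norm x"
  shows "cinner (T x) y = cinner x (cadj T y)"
proof -
  interpret T: Vector_Spaces.linear scaleC scaleC T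
    by (rule lin)
  have "\<exists>z. \<forall>x. cinner (T x) y = cinner x z"
  proof (rule Riesz_representation [where \<phi> = "\<lambda>x. cinner (T x) y" and B = "B * norm y"])
    show "cmod (cinner (T x) y) \<le> B * norm y * norm x" for x
      using norm_cinner_le [of "T x" y] mult_right_mono [OF bound [of x], of "norm y"]
      by (simp add: mult_ac)
  qed (auto simp: T.add T.scale cinner_add_left cinner_scaleC_left)
  then obtain z where z: "\<And>x. cinner (T x) y = cinner x z"
    by blast
  then show ?thesis
    by (metis cadj_eqI)
qed


section \<open>Fourier coefficients on circles\<close>

text \<open>The unit circle with normalised arc length: integrals over \<open>{0..1}\<close> are averages over the circle.\<close>

definition circ :: "real \<Rightarrow> complex"
  where "circ t = exp (2 * of_real pi * \<i> * of_real t)"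

lemma norm_circ [simp]: "cmod (circ t) = 1"
  by (simp add: circ_def norm_exp_eq_Re)

lemma circ_mult_cnj [simp]: "circ t * cnj (circ t) = 1" "cnj (circ t) * circ t = 1"
  using complex_norm_square [of "circ t"] by (simp_all add: mult.commute)

lemma circ_nonzero [simp]: "circ t \<noteq> 0"
  using norm_circ [of t] by force

lemma continuous_on_circ [continuous_intros]: "continuous_on S circ"
  unfolding circ_def by (intro continuous_intros)

lemma of_real_mult_circ_in_disc:
  assumes "0 < r" "r < 1"
  shows "of_real r * circ t \<in> disc"
  using assms by (simp add: norm_mult)

lemma continuous_on_circle:
  assumes "h holomorphic_on disc" "0 < r" "r < 1"
  shows "continuous_on S (\<lambda>t. h (of_real r * circ t))"
proof -
  have "continuous_on disc h"
    using assms(1) by (rule holomorphic_on_imp_continuous_on)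
  then show ?thesis
    by (rule continuous_on_compose2)
      (use of_real_mult_circ_in_disc [OF assms(2,3)] in \<open>auto intro!: continuous_intros\<close>)
qed

text \<open>Cauchy's formula for the derivatives at 0, read as a formula for Fourier coefficients.\<close>

lemma has_integral_circle_coefficient:
  assumes h: "h holomorphic_on disc" and r: "0 < r" "r < 1"
  shows "((\<lambda>t. h (of_real r * circ t) * cnj (circ t) ^ n) has_integral taylor_coeff h n * of_real r ^ n) {0..1}"
proof -
  define c where "c = (2 * of_real pi * \<i> / of_real r ^ n :: complex)"
  have c: "c \<noteq> 0"
    using r by (simp add: c_def)
  have sub: "cball 0 r \<subseteq> disc"
    using r by auto
  have "((\<lambda>u. h u / (u - 0) ^ Suc n) has_contour_integral (2 * pi * \<i> / fact n * (deriv ^^ n) h 0))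
      (circlepath 0 r)"
  proof (rule Cauchy_has_contour_integral_higher_derivative_circlepath)
    show "continuous_on (cball 0 r) h"
      using holomorphic_on_imp_continuous_on [OF h] sub by (rule continuous_on_subset)
    show "h holomorphic_on ball 0 r"
      using h by (rule holomorphic_on_subset) (use sub in auto)
  qed (use r in auto)
  then have "((\<lambda>t. h (circlepath 0 r t) / (circlepath 0 r t) ^ Suc n
        * (2 * pi * \<i> * r * exp (2 * of_real pi * \<i> * of_real t)))
      has_integral (2 * pi * \<i> / fact n * (deriv ^^ n) h 0)) {0..1}"
    by (simp add: has_contour_integral vector_derivative_circlepath)
  also have "(\<lambda>t. h (circlepath 0 r t) / (circlepath 0 r t) ^ Suc n
        * (2 * pi * \<i> * r * exp (2 * of_real pi * \<i> * of_real t)))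
      = (\<lambda>t. c * (h (of_real r * circ t) * cnj (circ t) ^ n))"
  proof
    fix t
    have inv: "cnj (circ t) = 1 / circ t"
      using circ_mult_cnj(1) [of t] circ_nonzero [of t] by (simp add: field_simps)
    have path: "circlepath 0 r t = of_real r * circ t"
      by (simp add: circlepath circ_def)
    show "h (circlepath 0 r t) / (circlepath 0 r t) ^ Suc n
        * (2 * pi * \<i> * r * exp (2 * of_real pi * \<i> * of_real t))
        = c * (h (of_real r * circ t) * cnj (circ t) ^ n)"
      unfolding path inv c_def circ_def [symmetric]
      using r circ_nonzero [of t] by (simp add: field_simps power_mult_distrib power_divide)
  qed
  also have "2 * pi * \<i> / fact n * (deriv ^^ n) h 0 = c * (taylor_coeff h n * of_real r ^ n)"
    using r by (simp add: c_def taylor_coeff_def)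
  finally show ?thesis
    using c by (simp add: has_integral_mult_right_iff)
qed

lemma taylor_coeff_0 [simp]: "taylor_coeff h 0 = h 0"
  by (simp add: taylor_coeff_def)

text \<open>The mean value property of \<open>h(z) z\<^sup>n\<close>.\<close>

lemma has_integral_circle_positive_frequency:
  assumes h: "h holomorphic_on disc" and r: "0 < r" "r < 1"
  shows "((\<lambda>t. h (of_real r * circ t) * circ t ^ n) has_integral (if n = 0 then h 0 else 0)) {0..1}"
proof -
  have "(\<lambda>z. h z * z ^ n) holomorphic_on disc"
    using h by (intro holomorphic_intros)
  from has_integral_circle_coefficient [OF this r, of 0]
  have "((\<lambda>t. of_real r ^ n * (h (of_real r * circ t) * circ t ^ n)) has_integral h 0 * 0 ^ n) {0..1}"
    by (simp add: power_mult_distrib mult_ac)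
  from has_integral_mult_right [OF this, of "1 / of_real r ^ n"]
  have "((\<lambda>t. h (of_real r * circ t) * circ t ^ n) has_integral 1 / of_real r ^ n * (h 0 * 0 ^ n)) {0..1}"
    using r by simp
  moreover have "1 / of_real r ^ n * (h 0 * 0 ^ n) = (if n = 0 then h 0 else 0)"
    by simp
  ultimately show ?thesis
    by simp
qed

lemma has_integral_suminf:
  fixes g :: "nat \<Rightarrow> real \<Rightarrow> complex"
  assumes cont: "\<And>n. continuous_on {0..1} (g n)" and bound: "\<And>n t. t \<in> {0..1} \<Longrightarrow> cmod (g n t) \<le> M n"
    and M: "summable M" and int: "\<And>n. (g n has_integral I n) {0..1}"
  shows "((\<lambda>t. \<Sum>n. g n t) has_integral (\<Sum>n. I n)) {0..1}" and "summable I"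
proof -
  have "uniform_limit {0..1} (\<lambda>n t. \<Sum>i<n. g i t) (\<lambda>t. \<Sum>i. g i t) sequentially"
    using bound M by (rule Weierstrass_m_test)
  then obtain I' J where I': "\<And>n. ((\<lambda>t. \<Sum>i<n. g i t) has_integral I' n) {0..1}"
    and J: "((\<lambda>t. \<Sum>i. g i t) has_integral J) {0..1}" "I' \<longlonglongrightarrow> J"
    by (rule uniform_limit_integral) (auto intro: continuous_on_sum cont)
  have "I' = (\<lambda>n. \<Sum>i<n. I i)"
    by (intro ext has_integral_unique [OF I'] has_integral_sum int finite_lessThan)
  then have "I sums J"
    using J(2) by (simp add: sums_def)
  then show "((\<lambda>t. \<Sum>n. g n t) has_integral (\<Sum>n. I n)) {0..1}" "summable I"
    using J(1) by (auto simp: sums_iff)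
qed

text \<open>An analytic function only sees the matching negative frequencies of the series it is integrated
  against, and only the constant term of a series of positive frequencies. Absolute convergence of
  the coefficients permits integration term by term.\<close>

lemma has_integral_circle_pairing:
  assumes h: "h holomorphic_on disc" and r: "0 < r" "r < 1" and b: "summable (\<lambda>n. cmod (b n))"
  shows "((\<lambda>t. h (of_real r * circ t) * (\<Sum>n. b n * cnj (circ t) ^ n))
      has_integral (\<Sum>n. taylor_coeff h n * of_real r ^ n * b n)) {0..1}"
    and "summable (\<lambda>n. taylor_coeff h n * of_real r ^ n * b n)"
    and "((\<lambda>t. h (of_real r * circ t) * (\<Sum>n. b n * circ t ^ n)) has_integral h 0 * b 0) {0..1}"
proof -
  let ?h = "\<lambda>t. h (of_real r * circ t)"
  have cont: "continuous_on {0..1} ?h"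
    by (rule continuous_on_circle [OF h r])
  have "bounded (?h ` {0..1})"
    using compact_continuous_image [OF cont] by (simp add: compact_imp_bounded)
  then have "\<exists>B. \<forall>t\<in>{0..1}. cmod (?h t) \<le> B"
    by (simp add: bounded_iff)
  then obtain B where B: "\<And>t. t \<in> {0..1} \<Longrightarrow> cmod (?h t) \<le> B"
    by blast
  have M: "summable (\<lambda>n. B * cmod (b n))"
    using b by (rule summable_mult)
  have sum1: "summable (\<lambda>n. b n * cnj (circ t) ^ n)" and sum2: "summable (\<lambda>n. b n * circ t ^ n)" for t
    by (rule summable_norm_cancel, use b in \<open>simp add: norm_mult norm_power\<close>)+
  have "((\<lambda>t. b n * (?h t * cnj (circ t) ^ n)) has_integral b n * (taylor_coeff h n * of_real r ^ n)) {0..1}" for n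
    by (intro has_integral_mult_right has_integral_circle_coefficient h r)
  then have int1: "((\<lambda>t. ?h t * (b n * cnj (circ t) ^ n)) has_integral taylor_coeff h n * of_real r ^ n * b n) {0..1}" for n
    by (simp add: mult_ac)
  have freq: "((\<lambda>t. b n * (?h t * circ t ^ n)) has_integral b n * (if n = 0 then h 0 else 0)) {0..1}" for n
    by (intro has_integral_mult_right has_integral_circle_positive_frequency h r)
  have int2: "((\<lambda>t. ?h t * (b n * circ t ^ n)) has_integral (if n = 0 then h 0 * b 0 else 0)) {0..1}" for n
    using freq [of n] by (cases "n = 0") (simp_all add: mult_ac)
  have bound1: "cmod (?h t * (b n * cnj (circ t) ^ n)) \<le> B * cmod (b n)"
    and bound2: "cmod (?h t * (b n * circ t ^ n)) \<le> B * cmod (b n)" if "t \<in> {0..1}" for n t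
    using B [OF that] by (simp_all add: norm_mult norm_power mult_right_mono)
  have cont1: "continuous_on {0..1} (\<lambda>t. ?h t * (b n * cnj (circ t) ^ n))"
    and cont2: "continuous_on {0..1} (\<lambda>t. ?h t * (b n * circ t ^ n))" for n
    by (intro continuous_intros cont)+
  show "((\<lambda>t. ?h t * (\<Sum>n. b n * cnj (circ t) ^ n))
      has_integral (\<Sum>n. taylor_coeff h n * of_real r ^ n * b n)) {0..1}"
    using has_integral_suminf(1) [OF cont1 bound1 M int1] by (simp add: suminf_mult sum1)
  show "summable (\<lambda>n. taylor_coeff h n * of_real r ^ n * b n)"
    by (rule has_integral_suminf(2) [OF cont1 bound1 M int1])
  have "(\<Sum>n. if n = 0 then h 0 * b 0 else 0) = h 0 * b 0"
    using suminf_finite [of "{0}" "\<lambda>n. if n = 0 then h 0 * b 0 else 0"] by simp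
  then show "((\<lambda>t. ?h t * (\<Sum>n. b n * circ t ^ n)) has_integral h 0 * b 0) {0..1}"
    using has_integral_suminf(1) [OF cont2 bound2 M int2] by (simp add: suminf_mult sum2)
qed

lemma taylor_sums:
  assumes "h holomorphic_on disc" "z \<in> disc"
  shows "(\<lambda>n. taylor_coeff h n * z ^ n) sums h z"
  using holomorphic_power_series [OF assms] by (simp add: taylor_coeff_def)

lemma summable_norm_taylor:
  assumes "h holomorphic_on disc" "z \<in> disc"
  shows "summable (\<lambda>n. cmod (taylor_coeff h n * z ^ n))"
proof -
  define s where "s = (1 + cmod z) / 2"
  have s: "cmod z < s" "s < 1" "0 < s"
    using assms(2) norm_ge_zero [of z] by (auto simp: s_def intro: add_pos_nonneg)
  then have "of_real s \<in> disc"
    by simp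
  then have "summable (\<lambda>n. taylor_coeff h n * of_real s ^ n)"
    using taylor_sums [OF assms(1)] by (blast intro: sums_summable)
  then show ?thesis
    by (rule powser_insidea) (use s in simp)
qed

text \<open>The pairing of \<open>h\<close> on the circle of radius \<open>r\<close> with its own complex conjugate.\<close>

lemma parseval_circle:
  assumes h: "h holomorphic_on disc" and r: "0 < r" "r < 1"
  shows "((\<lambda>t. (cmod (h (of_real r * circ t)))\<^sup>2) has_integral (\<Sum>n. (cmod (taylor_coeff h n))\<^sup>2 * (r\<^sup>2) ^ n)) {0..1}"
    and "summable (\<lambda>n. (cmod (taylor_coeff h n))\<^sup>2 * (r\<^sup>2) ^ n)"
proof -
  define b where "b n = cnj (taylor_coeff h n * of_real r ^ n)" for n
  have b: "summable (\<lambda>n. cmod (b n))"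
    using summable_norm_taylor [OF h, of "of_real r"] r by (simp add: b_def norm_mult norm_power)
  have cnj_h: "(\<Sum>n. b n * cnj (circ t) ^ n) = cnj (h (of_real r * circ t))" for t
  proof -
    have "(\<lambda>n. taylor_coeff h n * (of_real r * circ t) ^ n) sums h (of_real r * circ t)"
      by (rule taylor_sums [OF h of_real_mult_circ_in_disc [OF r]])
    then have "(\<lambda>n. cnj (taylor_coeff h n * (of_real r * circ t) ^ n)) sums cnj (h (of_real r * circ t))"
      by (simp only: sums_cnj)
    then have "(\<lambda>n. b n * cnj (circ t) ^ n) sums cnj (h (of_real r * circ t))"
      by (simp add: b_def power_mult_distrib mult.assoc)
    then show ?thesis
      by (simp add: sums_iff)
  qed
  have coeff: "Re (taylor_coeff h n * of_real r ^ n * b n) = (cmod (taylor_coeff h n))\<^sup>2 * (r\<^sup>2) ^ n" for n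
  proof -
    have "taylor_coeff h n * of_real r ^ n * b n = of_real ((cmod (taylor_coeff h n * of_real r ^ n))\<^sup>2)"
      by (simp only: b_def complex_norm_square)
    then show ?thesis
      using r by (simp add: norm_mult norm_power power_mult_distrib flip: power_mult) (simp add: mult.commute)
  qed
  have at_point: "Re (h (of_real r * circ t) * cnj (h (of_real r * circ t))) = (cmod (h (of_real r * circ t)))\<^sup>2" for t
    by (simp only: complex_norm_square [symmetric] Re_complex_of_real)
  note pair = has_integral_circle_pairing(1,2) [OF h r b]
  show "summable (\<lambda>n. (cmod (taylor_coeff h n))\<^sup>2 * (r\<^sup>2) ^ n)"
    using summable_Re [OF pair(2)] by (simp only: coeff)
  show "((\<lambda>t. (cmod (h (of_real r * circ t)))\<^sup>2) has_integral (\<Sum>n. (cmod (taylor_coeff h n))\<^sup>2 * (r\<^sup>2) ^ n)) {0..1}"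
    using has_integral_linear [OF pair(1) bounded_linear_Re]
    by (simp only: o_def cnj_h at_point Re_suminf [OF pair(2)] coeff)
qed

lemma norm_vec_square: "(norm (x :: complex ^ 'd::finite))\<^sup>2 = (\<Sum>i\<in>UNIV. (cmod (x $ i))\<^sup>2)"
  by (simp add: norm_vec_def L2_set_def sum_nonneg)

lemma parseval_circle_vector:
  fixes F :: "complex \<Rightarrow> complex ^ 'd::finite"
  assumes F: "\<And>i. (\<lambda>z. F z $ i) holomorphic_on disc" and r: "0 < r" "r < 1"
  shows "((\<lambda>t. (norm (F (of_real r * circ t)))\<^sup>2) has_integral (\<Sum>n. (norm (vtaylor_coeff F n))\<^sup>2 * (r\<^sup>2) ^ n)) {0..1}"
    and "summable (\<lambda>n. (norm (vtaylor_coeff F n))\<^sup>2 * (r\<^sup>2) ^ n)"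
proof -
  note P = parseval_circle [OF F r]
  have coeff: "(norm (vtaylor_coeff F n))\<^sup>2 * (r\<^sup>2) ^ n
      = (\<Sum>i\<in>UNIV. (cmod (taylor_coeff (\<lambda>z. F z $ i) n))\<^sup>2 * (r\<^sup>2) ^ n)" for n
    by (simp add: norm_vec_square vtaylor_coeff_def sum_distrib_right)
  show "summable (\<lambda>n. (norm (vtaylor_coeff F n))\<^sup>2 * (r\<^sup>2) ^ n)"
    unfolding coeff by (intro summable_sum P(2))
  show "((\<lambda>t. (norm (F (of_real r * circ t)))\<^sup>2) has_integral (\<Sum>n. (norm (vtaylor_coeff F n))\<^sup>2 * (r\<^sup>2) ^ n)) {0..1}"
    unfolding coeff suminf_sum [OF P(2)] norm_vec_square [of "F _"]
    by (intro has_integral_sum P(1)) simp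
qed

text \<open>The square sum of the Taylor coefficients is the limit of the mean squares over circles of radius
  \<open>r < 1\<close>, so a pointwise bound on the disc passes to it. This is why a bounded function multiplies
  the Hardy space into itself.\<close>

lemma taylor_square_sum_mono:
  fixes F G :: "complex \<Rightarrow> complex ^ 'd::finite"
  assumes F: "\<And>i. (\<lambda>z. F z $ i) holomorphic_on disc" and G: "\<And>i. (\<lambda>z. G z $ i) holomorphic_on disc"
    and le: "\<And>z. z \<in> disc \<Longrightarrow> norm (G z) \<le> B * norm (F z)"
    and sum: "summable (\<lambda>n. (norm (vtaylor_coeff F n))\<^sup>2)"
  shows "summable (\<lambda>n. (norm (vtaylor_coeff G n))\<^sup>2)"
    and "(\<Sum>n. (norm (vtaylor_coeff G n))\<^sup>2) \<le> B\<^sup>2 * (\<Sum>n. (norm (vtaylor_coeff F n))\<^sup>2)"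
proof -
  let ?R = "B\<^sup>2 * (\<Sum>n. (norm (vtaylor_coeff F n))\<^sup>2)"
  have partial: "(\<Sum>n<N. (norm (vtaylor_coeff G n))\<^sup>2 * (r\<^sup>2) ^ n) \<le> ?R" if r: "0 < r" "r < 1" for r N
  proof -
    note PF = parseval_circle_vector [OF F r] and PG = parseval_circle_vector [OF G r]
    have "(\<Sum>n<N. (norm (vtaylor_coeff G n))\<^sup>2 * (r\<^sup>2) ^ n) \<le> (\<Sum>n. (norm (vtaylor_coeff G n))\<^sup>2 * (r\<^sup>2) ^ n)"
      by (rule sum_le_suminf [OF PG(2)]) auto
    also have "\<dots> \<le> B\<^sup>2 * (\<Sum>n. (norm (vtaylor_coeff F n))\<^sup>2 * (r\<^sup>2) ^ n)"
    proof (rule has_integral_le [OF PG(1) has_integral_mult_right [OF PF(1)]])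
      show "(norm (G (of_real r * circ t)))\<^sup>2 \<le> B\<^sup>2 * (norm (F (of_real r * circ t)))\<^sup>2" for t
        using power_mono [OF le [OF of_real_mult_circ_in_disc [OF r]], of t 2] by (simp add: power_mult_distrib)
    qed
    also have "\<dots> \<le> ?R"
    proof (intro mult_left_mono suminf_le PF(2) sum)
      show "(norm (vtaylor_coeff F n))\<^sup>2 * (r\<^sup>2) ^ n \<le> (norm (vtaylor_coeff F n))\<^sup>2" for n
        using r by (intro mult_left_le power_le_one) (auto simp: power_le_one)
    qed simp
    finally show ?thesis .
  qed
  have "(\<Sum>n<N. (norm (vtaylor_coeff G n))\<^sup>2) \<le> ?R" for N
  proof (rule tendsto_upperbound)
    show "((\<lambda>r. \<Sum>n<N. (norm (vtaylor_coeff G n))\<^sup>2 * (r\<^sup>2) ^ n)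
        \<longlongrightarrow> (\<Sum>n<N. (norm (vtaylor_coeff G n))\<^sup>2)) (at_left (1 :: real))"
      by (rule tendsto_eq_intros refl | simp)+
    show "\<forall>\<^sub>F r in at_left (1 :: real). (\<Sum>n<N. (norm (vtaylor_coeff G n))\<^sup>2 * (r\<^sup>2) ^ n) \<le> ?R"
      using eventually_at_left_real [of 0 1] by (simp add: eventually_mono partial)
  qed simp
  then show "summable (\<lambda>n. (norm (vtaylor_coeff G n))\<^sup>2)"
    by (intro summableI_nonneg_bounded) auto
  then show "(\<Sum>n. (norm (vtaylor_coeff G n))\<^sup>2) \<le> ?R"
    by (rule suminf_le_const) fact
qed


section \<open>Multiplication operators and kernel vectors on the Hardy space\<close>

lemma hardy_fun_sums:
  assumes "z \<in> disc"
  shows "(\<lambda>n. hcoeff F n $ i * z ^ n) sums (hardy_fun F z $ i)"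
  using taylor_sums [OF hardy_holomorphic assms] by (simp add: vtaylor_coeff_def)

lemma hardy_norm_square: "(norm F)\<^sup>2 = (\<Sum>n. (norm (hcoeff F n))\<^sup>2)"
  by (simp only: power2_norm_eq_inner [of F] inner_hardy_self)

lemma matrix_vector_mult_holomorphic:
  assumes "\<And>i j. (\<lambda>z. \<Phi> z $ i $ j) holomorphic_on S" "\<And>i. (\<lambda>z. F z $ i) holomorphic_on S"
  shows "(\<lambda>z. (\<Phi> z *v F z) $ i) holomorphic_on S"
  unfolding matrix_vector_mult_def using assms by (auto intro!: holomorphic_intros)

lemma norm_vec_le_sum: "norm (x :: complex ^ 'd::finite) \<le> (\<Sum>i\<in>UNIV. cmod (x $ i))"
  unfolding norm_vec_def by (rule L2_set_le_sum) simp

lemma norm_matrix_vector_mult_le: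
  fixes A :: "complex ^ 'd ^ 'd::finite"
  assumes "\<And>i j. cmod (A $ i $ j) \<le> e"
  shows "norm (A *v y) \<le> (real CARD('d))\<^sup>2 * e * norm y"
proof -
  have e: "e \<ge> 0"
    using assms norm_ge_zero order_trans by blast
  have "norm (A *v y) \<le> (\<Sum>i\<in>UNIV. cmod (\<Sum>j\<in>UNIV. A $ i $ j * y $ j))"
    using norm_vec_le_sum [of "A *v y"] by (simp add: matrix_vector_mult_def)
  also have "\<dots> \<le> (\<Sum>i\<in>UNIV. \<Sum>j\<in>UNIV. cmod (A $ i $ j) * cmod (y $ j))"
    by (intro sum_mono order_trans [OF norm_sum]) (simp add: norm_mult)
  also have "\<dots> \<le> (\<Sum>i\<in>(UNIV :: 'd set). \<Sum>j\<in>(UNIV :: 'd set). e * norm y)"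
    using assms e by (intro sum_mono mult_mono Finite_Cartesian_Product.norm_nth_le) auto
  finally show ?thesis
    by (simp add: power2_eq_square mult_ac)
qed

lemma norm_matrix_entry_le: "cmod (A $ i $ j) \<le> norm (A :: complex ^ 'd ^ 'd::finite)"
  using Finite_Cartesian_Product.norm_nth_le [of "A $ i" j] Finite_Cartesian_Product.norm_nth_le [of A i]
  by linarith

lemma Hinf_matrix_bound:
  fixes \<Phi> :: "complex \<Rightarrow> complex ^ 'd ^ 'd::finite"
  assumes "Hinf_matrix \<Phi>"
  obtains B where "\<And>z y. z \<in> disc \<Longrightarrow> norm (\<Phi> z *v y) \<le> B * norm y"
proof -
  obtain C where "\<forall>x\<in>\<Phi> ` disc. norm x \<le> C"
    using assms unfolding Hinf_matrix_def bounded_iff by blast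
  then have "norm (\<Phi> z *v y) \<le> ((real CARD('d))\<^sup>2 * C) * norm y" if "z \<in> disc" for z y
    using that by (intro norm_matrix_vector_mult_le order_trans [OF norm_matrix_entry_le]) auto
  then show ?thesis
    by (rule that)
qed

text \<open>The operator is defined through \<open>Abs_hardy\<close>, which says nothing about its argument until the product
  is known to have square-summable coefficients; the equation for the values rests on the norm bound.\<close>

lemma mult_op_bounded:
  fixes \<Phi> :: "complex \<Rightarrow> complex ^ 'd ^ 'd::finite"
  assumes \<Phi>: "Hinf_matrix \<Phi>" and B: "\<And>z y. z \<in> disc \<Longrightarrow> norm (\<Phi> z *v y) \<le> B * norm y"
  shows "hardy_fun (mult_op \<Phi> F) = (\<lambda>z. if z \<in> disc then \<Phi> z *v hardy_fun F z else 0)"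
    and "norm (mult_op \<Phi> F) \<le> \<bar>B\<bar> * norm F"
proof -
  define G where "G = (\<lambda>z. if z \<in> disc then \<Phi> z *v hardy_fun F z else 0)"
  have hol: "(\<lambda>z. G z $ i) holomorphic_on disc" for i
  proof -
    have "(\<lambda>z. (\<Phi> z *v hardy_fun F z) $ i) holomorphic_on disc"
      using \<Phi> by (intro matrix_vector_mult_holomorphic hardy_holomorphic) (simp add: Hinf_matrix_def)
    then show ?thesis
      by (rule holomorphic_transform) (simp add: G_def)
  qed
  have le: "norm (G z) \<le> B * norm (hardy_fun F z)" if "z \<in> disc" for z
    using B [OF that] that by (simp add: G_def)
  note mono = taylor_square_sum_mono [OF hardy_holomorphic hol le hardy_summable]
  have G: "hardy_fun (mult_op \<Phi> F) = G"
    unfolding mult_op_def G_def [symmetric]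
    by (rule Abs_hardy_inverse) (use hol mono(1) in \<open>auto simp: G_def\<close>)
  then show "hardy_fun (mult_op \<Phi> F) = (\<lambda>z. if z \<in> disc then \<Phi> z *v hardy_fun F z else 0)"
    by (simp add: G_def)
  have "(norm (mult_op \<Phi> F))\<^sup>2 \<le> (\<bar>B\<bar> * norm F)\<^sup>2"
    using mono(2) unfolding power_mult_distrib hardy_norm_square G by simp
  then show "norm (mult_op \<Phi> F) \<le> \<bar>B\<bar> * norm F"
    by (rule power2_le_imp_le) simp
qed

lemma hardy_fun_mult_op:
  assumes "Hinf_matrix \<Phi>"
  shows "hardy_fun (mult_op \<Phi> F) = (\<lambda>z. if z \<in> disc then \<Phi> z *v hardy_fun F z else 0)"
proof -
  obtain B where "\<And>z y. z \<in> disc \<Longrightarrow> norm (\<Phi> z *v y) \<le> B * norm y"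
    using Hinf_matrix_bound [OF assms] by blast
  from mult_op_bounded(1) [OF assms this] show ?thesis
    by simp
qed
lemma hardy_ext: "(\<And>z. z \<in> disc \<Longrightarrow> hardy_fun F z = hardy_fun G z) \<Longrightarrow> F = G"
  by (metis ext hardy_fun_inject hardy_off_disc)

lemma clinear_mult_op:
  assumes "Hinf_matrix \<Phi>"
  shows "clinear (mult_op \<Phi>)"
proof unfold_locales
  show "mult_op \<Phi> (F + G) = mult_op \<Phi> F + mult_op \<Phi> G" for F G
    by (rule hardy_ext) (simp add: hardy_fun_mult_op [OF assms] plus_hardy.rep_eq matrix_vector_right_distrib)
  show "mult_op \<Phi> (c *\<^sub>C F) = c *\<^sub>C mult_op \<Phi> F" for c F
    by (rule hardy_ext) (simp add: hardy_fun_mult_op [OF assms] scaleC_hardy.rep_eq vector_scalar_commute)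
qed

lemma cinner_mult_op_cadj:
  assumes "Hinf_matrix \<Phi>"
  shows "cinner (mult_op \<Phi> F) G = cinner F (cadj (mult_op \<Phi>) G)"
proof -
  obtain B where "\<And>z y. z \<in> disc \<Longrightarrow> norm (\<Phi> z *v y) \<le> B * norm y"
    using Hinf_matrix_bound [OF assms] by blast
  then show ?thesis
    by (intro cinner_cadj [where B = "\<bar>B\<bar>"] clinear_mult_op mult_op_bounded(2) assms)
qed

lemma vcinner_add_right: "vcinner x (y + z) = vcinner x y + vcinner x z"
  by (simp add: vcinner_def distrib_left sum.distrib)

lemma vcinner_diff_right: "vcinner x (y - z) = vcinner x y - vcinner x z"
  using vcinner_add_right [of x "y - z" z] by simp

lemma vcinner_diff_left: "vcinner (x - y) z = vcinner x z - vcinner y z"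
  using vcinner_add_left [of "x - y" y z] by simp

lemma vcinner_scale_right: "vcinner x (c *s y) = cnj c * vcinner x y"
  by (simp add: vcinner_def sum_distrib_left mult_ac)

lemma vcinner_self_of_real: "vcinner x x = complex_of_real ((norm x)\<^sup>2)"
proof -
  have "vcinner x x \<in> \<real>"
    using vcinner_commute [of x x] by (metis Reals_cnj_iff)
  then show ?thesis
    using vcinner_self [of x] by (metis of_real_Re)
qed

lemma szego_kernel_exists:
  assumes "l \<in> disc"
  shows "\<exists>K :: 'd::finite hardy. \<forall>n. hcoeff K n = cnj l ^ n *s x"
proof -
  have "summable (\<lambda>n. (norm (cnj l ^ n *s x))\<^sup>2)"
  proof -
    have "summable (\<lambda>n. (norm x)\<^sup>2 * ((cmod l)\<^sup>2) ^ n)"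
      using assms by (intro summable_mult summable_geometric) (simp add: power_less_one_iff)
    then show ?thesis
      by (simp add: norm_vector_scalar_mult norm_power power_mult_distrib mult_ac flip: power_mult)
  qed
  then show ?thesis
    using hardy_with_coeffs by metis
qed

text \<open>The vector \<open>k\<^sub>l \<otimes> x\<close> that represents evaluation at \<open>l\<close> followed by the inner product with \<open>x\<close>. It is
  specified by its Taylor coefficients, by which eigenvectors of the backward shift are recognised.\<close>

definition szego_kernel :: "complex \<Rightarrow> complex ^ 'd \<Rightarrow> 'd::finite hardy"
  where "szego_kernel l x = (SOME K. \<forall>n. hcoeff K n = cnj l ^ n *s x)"

lemma hcoeff_szego_kernel: "l \<in> disc \<Longrightarrow> hcoeff (szego_kernel l x) n = cnj l ^ n *s x"
  using someI_ex [OF szego_kernel_exists] unfolding szego_kernel_def by blast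

lemma cinner_szego_kernel:
  assumes "l \<in> disc"
  shows "cinner F (szego_kernel l x) = vcinner (hardy_fun F l) x"
proof -
  have "(\<lambda>n. \<Sum>i\<in>UNIV. hcoeff F n $ i * l ^ n * cnj (x $ i)) sums (\<Sum>i\<in>UNIV. hardy_fun F l $ i * cnj (x $ i))"
    by (intro sums_sum sums_mult2 hardy_fun_sums assms)
  then have "(\<lambda>n. vcinner (hcoeff F n) (cnj l ^ n *s x)) sums vcinner (hardy_fun F l) x"
    by (simp add: vcinner_def mult_ac)
  then show ?thesis
    by (simp add: cinner_hardy_def hcoeff_szego_kernel [OF assms] sums_iff)
qed

lemma hardy_fun_szego_kernel:
  assumes "l \<in> disc" "z \<in> disc"
  shows "hardy_fun (szego_kernel l x) z = (1 / (1 - cnj l * z)) *s x"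
proof -
  have "cmod (cnj l * z) < 1"
    using assms mult_strict_mono' [of "cmod l" 1 "cmod z" 1] by (simp add: norm_mult)
  then have "(\<lambda>n. (cnj l * z) ^ n * x $ i) sums (1 / (1 - cnj l * z) * x $ i)" for i
    by (intro sums_mult2 geometric_sums)
  then have "(\<lambda>n. hcoeff (szego_kernel l x) n $ i * z ^ n) sums (1 / (1 - cnj l * z) * x $ i)" for i
    by (simp add: hcoeff_szego_kernel [OF assms(1)] power_mult_distrib mult_ac)
  then show ?thesis
    using hardy_fun_sums [OF assms(2)] by (auto simp: vec_eq_iff intro: sums_unique2)
qed

lemma szego_kernel_eq_0D:
  assumes "l \<in> disc" "szego_kernel l x = 0"
  shows "x = 0"
  using hcoeff_szego_kernel [OF assms(1), of x 0] assms(2) by (simp add: hcoeff_zero)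

text \<open>The kernel vectors at \<open>z\<close> satisfy \<open>\<langle>M k\<^sub>z \<otimes> y, k\<^sub>z \<otimes> x\<rangle> = \<langle>\<Phi>(z) y, x\<rangle> \<parallel>k\<^sub>z\<parallel>\<^sup>2\<close>, so the norm of the operator bounds
  the norm of each value of the symbol. The inequality comes from \<open>x = \<Phi>(z) y\<close>.\<close>

lemma inner_function_contractive:
  assumes \<Phi>: "Hinf_matrix \<Phi>" and iso: "linear_isometry (mult_op \<Phi>)" and z: "z \<in> disc"
  shows "norm (\<Phi> z *v y) \<le> norm y"
proof -
  define x where "x = \<Phi> z *v y"
  define k where "k = 1 / (1 - (cmod z)\<^sup>2)"
  have k: "k > 0"
    using z by (simp add: k_def power_less_one_iff)
  have at_point: "hardy_fun (szego_kernel z w) z = of_real k *s w" for w :: "complex ^ 'a"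
  proof -
    have "cnj z * z = of_real ((cmod z)\<^sup>2)"
      by (simp only: complex_norm_square mult.commute)
    then show ?thesis
      using z by (simp add: hardy_fun_szego_kernel k_def)
  qed
  have norm_kernel: "norm (szego_kernel z w) = sqrt k * norm w" for w :: "complex ^ 'a"
  proof -
    have "cinner (szego_kernel z w) (szego_kernel z w) = of_real (k * (norm w)\<^sup>2)"
      by (simp add: cinner_szego_kernel [OF z] at_point vcinner_scale_left vcinner_self_of_real)
    then have "inner (szego_kernel z w) (szego_kernel z w) = k * (norm w)\<^sup>2"
      by (simp flip: Re_cinner)
    then have "(norm (szego_kernel z w))\<^sup>2 = (sqrt k * norm w)\<^sup>2"
      using k unfolding power2_norm_eq_inner [of "szego_kernel z w"] power_mult_distrib by simp
    then show ?thesis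
      by (rule power2_eq_imp_eq) (use k in auto)
  qed
  have "cinner (mult_op \<Phi> (szego_kernel z y)) (szego_kernel z x) = of_real (k * (norm x)\<^sup>2)"
    using z by (simp add: cinner_szego_kernel hardy_fun_mult_op [OF \<Phi>] at_point vector_scalar_commute
        vcinner_scale_left vcinner_self_of_real flip: x_def)
  then have "k * (norm x)\<^sup>2 \<le> norm (mult_op \<Phi> (szego_kernel z y)) * norm (szego_kernel z x)"
    using norm_cinner_le [of "mult_op \<Phi> (szego_kernel z y)" "szego_kernel z x"] k
    by (simp add: norm_mult norm_power)
  also have "\<dots> = k * (norm y * norm x)"
    using iso k by (simp add: linear_isometry_def norm_kernel)
  finally have "norm x * norm x \<le> norm y * norm x"
    using k by (simp add: power2_eq_square)
  then show ?thesis
    unfolding x_def [symmetric] by (cases "x = 0") auto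
qed


section \<open>Decay of the powers of a contractive matrix\<close>

lemma matrix_power_0 [simp]: "matrix_power A 0 = mat 1"
  by (simp add: matrix_power_def)

lemma matrix_power_Suc [simp]: "matrix_power A (Suc n) = A ** matrix_power A n"
  by (simp add: matrix_power_def)

lemma matrix_power_add: "matrix_power A (m + n) = matrix_power A m ** matrix_power A n"
  by (induction m) (simp_all add: matrix_mul_assoc)

lemma matrix_power_Suc2: "matrix_power A (Suc n) = matrix_power A n ** A"
  using matrix_power_add [of A n 1] by simp

lemma norm_matrix_power_mult_le:
  assumes "\<And>y. norm (A *v y) \<le> norm y"
  shows "norm (matrix_power A n *v y) \<le> norm (y :: complex ^ 'd::finite)"
proof (induction n)
  case (Suc n)
  then show ?case
    using assms [of "matrix_power A n *v y"] by (simp flip: matrix_vector_mul_assoc)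
qed simp

lemma matrix_mult_axis: "(A *v axis j 1) $ i = (A :: complex ^ 'd ^ 'd::finite) $ i $ j"
  by (simp add: matrix_vector_mult_def axis_def if_distrib cong: if_cong)

lemma norm_axis_1_complex: "norm (axis j 1 :: complex ^ 'd::finite) = 1"
proof -
  have "(cmod (axis j 1 $ i))\<^sup>2 = (if i = j then 1 else 0)" for i :: 'd
    by (simp add: axis_def)
  then have "(norm (axis j 1 :: complex ^ 'd))\<^sup>2 = 1"
    by (simp add: norm_vec_square)
  then show ?thesis
    using norm_ge_zero [of "axis j 1 :: complex ^ 'd"] by (auto simp: power2_eq_1_iff)
qed

lemma norm_matrix_entry_le_bound:
  assumes "\<And>y. norm (A *v y) \<le> c * norm y"
  shows "cmod ((A :: complex ^ 'd ^ 'd::finite) $ i $ j) \<le> c"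
  using assms [of "axis j 1"] Finite_Cartesian_Product.norm_nth_le [of "A *v axis j 1" i]
  by (simp add: matrix_mult_axis norm_axis_1_complex)

text \<open>The spectral radius of \<open>A\<close> is less than 1, in the form that makes power series in \<open>A\<close> converge.\<close>

definition power_decaying :: "complex ^ 'd ^ 'd::finite \<Rightarrow> bool"
  where "power_decaying A \<longleftrightarrow> (\<exists>C \<rho>. 0 < \<rho> \<and> \<rho> < 1 \<and> (\<forall>n i j. cmod (matrix_power A n $ i $ j) \<le> C * \<rho> ^ n))"

lemma half_power_div_le:
  assumes "N > 0"
  shows "(1/2 :: real) ^ (n div N) \<le> 2 * ((1/2) powr (1 / N)) ^ n"
proof -
  have "real n \<le> real N * (real (n div N) + 1)"
  proof -
    have "n < N * (n div N + 1)"
      using assms by (metis Suc_eq_plus1 dividend_less_times_div mult_Suc_right add.commute)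
    then have "real n \<le> real (N * (n div N + 1))"
      by linarith
    then show ?thesis by (simp add: algebra_simps)
  qed
  then have "real n / real N \<le> real (n div N) + 1"
    using assms by (simp add: field_simps)
  then have "(1/2 :: real) powr (real (n div N) + 1) \<le> (1/2) powr (real n / real N)"
    by (intro powr_mono') auto
  also have "\<dots> = ((1/2) powr (1 / N)) ^ n"
    by (simp add: powr_powr flip: powr_realpow)
  also have "(1/2 :: real) powr (real (n div N) + 1) = (1/2) ^ (n div N) / 2"
    by (simp add: powr_add powr_realpow)
  finally show ?thesis by simp
qed

text \<open>One power of norm at most 1/2 already forces geometric decay, at a rate that depends on the exponent
  \<open>N\<close> only. The same rate therefore serves all matrices near a given one.\<close>

lemma contraction_power_decay:
  fixes A :: "complex ^ 'd ^ 'd::finite"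
  assumes contr: "\<And>y. norm (A *v y) \<le> norm y" and N: "N > 0"
    and half: "\<And>y. norm (matrix_power A N *v y) \<le> 1/2 * norm y"
  shows "cmod (matrix_power A n $ i $ j) \<le> 2 * ((1/2) powr (1 / N)) ^ n"
proof -
  have iter: "norm (matrix_power A (N * q) *v y) \<le> (1/2) ^ q * norm y" for q y
  proof (induction q)
    case (Suc q)
    have "matrix_power A (N * Suc q) *v y = matrix_power A N *v (matrix_power A (N * q) *v y)"
      by (simp add: matrix_power_add matrix_vector_mul_assoc)
    then show ?case
      using half [of "matrix_power A (N * q) *v y"] Suc by simp
  qed simp
  have "norm (matrix_power A n *v y) \<le> (1/2) ^ (n div N) * norm y" for y
  proof -
    have "matrix_power A n *v y = matrix_power A (N * (n div N)) *v (matrix_power A (n mod N) *v y)"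
      by (simp add: matrix_vector_mul_assoc flip: matrix_power_add)
    also have "norm \<dots> \<le> (1/2) ^ (n div N) * norm (matrix_power A (n mod N) *v y)"
      by (rule iter)
    also have "\<dots> \<le> (1/2) ^ (n div N) * norm y"
      by (intro mult_left_mono norm_matrix_power_mult_le contr) simp
    finally show ?thesis .
  qed
  then have "cmod (matrix_power A n $ i $ j) \<le> (1/2) ^ (n div N)"
    by (rule norm_matrix_entry_le_bound)
  then show ?thesis
    using half_power_div_le [OF N, of n] by linarith
qed

lemma half_powr_bounds: "N > 0 \<Longrightarrow> 0 < (1/2 :: real) powr (1 / real N)" "N > 0 \<Longrightarrow> (1/2 :: real) powr (1 / real N) < 1"
  using powr_less_mono2 [of "1 / real N" "1/2" 1] by auto

lemma det_holomorphic:
  fixes \<Phi> :: "complex \<Rightarrow> complex ^ 'd ^ 'd::finite"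
  assumes "\<And>i j. (\<lambda>z. \<Phi> z $ i $ j) holomorphic_on S"
  shows "(\<lambda>z. det (\<Phi> z)) holomorphic_on S"
  unfolding det_def by (intro holomorphic_intros assms)

lemma det_0_kernel:
  fixes A :: "complex ^ 'd ^ 'd::finite"
  assumes "det A = 0"
  obtains x where "x \<noteq> 0" "A *v x = 0"
  using assms invertible_det_nz [of A] by (auto simp: invertible_left_inverse matrix_left_invertible_ker)

text \<open>The coefficients of a linear relation between the rows, conjugated, form the vector \<open>x\<close>.\<close>

lemma det_0_left_kernel:
  fixes A :: "complex ^ 'd ^ 'd::finite"
  assumes "det A = 0"
  obtains x where "x \<noteq> 0" "\<And>y. vcinner (A *v y) x = 0"
proof -
  obtain c i where c: "(\<Sum>i\<in>UNIV. c i *s row i A) = 0" "c i \<noteq> 0"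
    using assms invertible_det_nz [of A]
    by (auto simp: invertible_right_inverse matrix_right_invertible_independent_rows)
  have comb: "(\<Sum>i\<in>UNIV. c i * A $ i $ j) = 0" for j
    using arg_cong [OF c(1), of "\<lambda>v. v $ j"] by (simp add: row_def)
  have "vcinner (A *v y) (\<chi> i. cnj (c i)) = 0" for y
  proof -
    have "vcinner (A *v y) (\<chi> i. cnj (c i)) = (\<Sum>i\<in>UNIV. \<Sum>j\<in>UNIV. (c i * A $ i $ j) * y $ j)"
      by (simp add: vcinner_def matrix_vector_mult_def sum_distrib_left sum_distrib_right mult_ac)
    also have "\<dots> = (\<Sum>j\<in>UNIV. (\<Sum>i\<in>UNIV. c i * A $ i $ j) * y $ j)"
      by (subst sum.swap) (simp add: sum_distrib_right)
    finally show ?thesis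
      by (simp add: comb)
  qed
  moreover have "(\<chi> i. cnj (c i)) \<noteq> 0"
    using c(2) by (auto simp: vec_eq_iff)
  ultimately show ?thesis
    using that by blast
qed

lemma mat_vector_mult: "mat c *v x = c *s (x :: complex ^ 'd::finite)"
  by (simp add: vec_eq_iff matrix_vector_mult_def mat_def if_distrib if_distribR cong: if_cong)

lemma mat_mult_entry: "(mat c ** A) $ i $ j = c * (A :: complex ^ 'd ^ 'd::finite) $ i $ j"
  by (simp add: matrix_matrix_mult_def mat_def if_distrib if_distribR cong: if_cong)

lemma mult_mat_entry: "(A ** mat c) $ i $ j = c * (A :: complex ^ 'd ^ 'd::finite) $ i $ j"
  by (simp add: matrix_matrix_mult_def mat_def if_distrib if_distribR mult.commute cong: if_cong)

lemma matrix_mult_diff_left: "(A - B) ** C = A ** C - B ** (C :: complex ^ 'd ^ 'd::finite)"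
  by (simp add: vec_eq_iff matrix_matrix_mult_def left_diff_distrib sum_subtractf)

lemma matrix_mult_diff_right: "A ** (B - C) = A ** B - A ** (C :: complex ^ 'd ^ 'd::finite)"
  by (simp add: vec_eq_iff matrix_matrix_mult_def right_diff_distrib sum_subtractf)

lemma ball_superset_of_open_superset_cball:
  assumes "open U" "cball 0 1 \<subseteq> (U :: complex set)"
  obtains R where "R > 1" "ball 0 R \<subseteq> U"
proof -
  obtain \<epsilon> where \<epsilon>: "\<epsilon> > 0" "(\<Union>x\<in>cball 0 1. ball x \<epsilon>) \<subseteq> U"
    using compact_subset_open_imp_ball_epsilon_subset [OF compact_cball assms] by blast
  have "w \<in> U" if "w \<in> ball 0 (1 + \<epsilon>)" for w
  proof (cases "cmod w \<le> 1")
    case False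
    have w: "w \<noteq> 0"
      using False by auto
    have diff: "w - w / cmod w = of_real (cmod w - 1) * (w / cmod w)"
      using False by (auto simp: left_diff_distrib diff_divide_distrib)
    have "cmod (w - w / cmod w) = cmod w - 1"
      unfolding diff norm_mult norm_divide norm_of_real using False w by simp
    then have "w \<in> ball (w / cmod w) \<epsilon>"
      using that by (simp add: dist_norm norm_minus_commute)
    moreover have "w / cmod w \<in> cball 0 1"
      using False by (simp add: norm_divide)
    ultimately show ?thesis
      using \<epsilon>(2) by blast
  qed (use assms(2) in auto)
  then show ?thesis
    using \<epsilon>(1) by (intro that [of "1 + \<epsilon>"]) auto
qed

text \<open>The entries of \<open>\<Sum>n. s\<^sup>n A\<^sup>n\<close> solve the linear system with matrix \<open>1 - s A\<close>, hence by Cramer's rule they are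
  quotients with denominator \<open>det (1 - s A)\<close>. As the spectrum lies in the open disc, the denominator has
  no zero on the closed unit disc, so the power series converges on a larger disc. At \<open>s = 1\<close> its terms
  are the entries of \<open>A\<^sup>n\<close>.\<close>

lemma matrix_power_tendsto_0:
  fixes A :: "complex ^ 'd ^ 'd::finite"
  assumes contr: "\<And>y. norm (A *v y) \<le> norm y" and spec: "matrix_spectrum A \<subseteq> disc"
  shows "(\<lambda>n. matrix_power A n $ i $ j) \<longlonglongrightarrow> 0"
proof -
  define M where "M s = mat 1 - (\<chi> i k. s * A $ i $ k)" for s
  have M_mult: "M s *v x = x - s *s (A *v x)" for s x
    unfolding M_def matrix_vector_mult_diff_rdistrib matrix_vector_mul_lid
    by (simp add: vec_eq_iff matrix_vector_mult_def sum_distrib_left mult.assoc)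
  have M_hol: "(\<lambda>s. M s $ i $ k) holomorphic_on S" for i k S
    by (simp add: M_def) (intro holomorphic_intros)
  define num where "num s = det (\<chi> k l. if l = i then axis j 1 $ k else M s $ k $ l)" for s
  have num_hol: "num holomorphic_on S" for S
  proof -
    have "(\<lambda>s. if l = i then axis j 1 $ k else M s $ k $ l) holomorphic_on S" for k l
      using M_hol by (cases "l = i") simp_all
    then show ?thesis
      unfolding num_def by (intro det_holomorphic) simp
  qed
  define U where "U = {s. det (M s) \<noteq> 0}"
  have "continuous_on UNIV (\<lambda>s. det (M s))"
    by (intro holomorphic_on_imp_continuous_on det_holomorphic M_hol)
  then have "open U"
    unfolding U_def by (intro open_Collect_neq) auto
  have "det (M s) \<noteq> 0" if s: "cmod s \<le> 1" for s
  proof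
    assume "det (M s) = 0"
    then obtain x where x: "x \<noteq> 0" "x = s *s (A *v x)"
      using det_0_kernel [of "M s"] by (metis M_mult right_minus_eq)
    then have s0: "s \<noteq> 0"
      by auto
    have "(1 / s) *s x = (1 / s) *s (s *s (A *v x))"
      using x(2) by simp
    also have "\<dots> = A *v x"
      using s0 by (simp add: vector_smult_assoc)
    finally have "(mat (1 / s) - A) *v x = 0"
      by (simp add: matrix_vector_mult_diff_rdistrib mat_vector_mult)
    then have "\<not> invertible (mat (1 / s) - A)"
      using x(1) by (auto simp: invertible_left_inverse matrix_left_invertible_ker)
    then have "1 / s \<in> disc"
      using spec by (auto simp: matrix_spectrum_def)
    then show False
      using s s0 by (simp add: norm_divide field_simps)
  qed
  then have "cball 0 1 \<subseteq> U"
    by (auto simp: U_def)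
  then obtain R where R: "R > 1" "ball 0 R \<subseteq> U"
    using ball_superset_of_open_superset_cball [OF \<open>open U\<close>] by blast
  define g where "g s = num s / det (M s)" for s
  have g_hol: "g holomorphic_on ball 0 R"
    unfolding g_def using R(2) by (intro holomorphic_intros num_hol det_holomorphic M_hol) (auto simp: U_def)
  have g_sums: "(\<lambda>n. matrix_power A n $ i $ j * s ^ n) sums g s" if s: "s \<in> disc" for s
  proof -
    define a where "a n k = matrix_power A n $ k $ j" for n k
    have a_le: "cmod (a n k) \<le> 1" for n k
      unfolding a_def using norm_matrix_power_mult_le [OF contr]
      by (intro norm_matrix_entry_le_bound) simp
    define X where "X = (\<chi> k. \<Sum>n. a n k * s ^ n)"
    have sums: "(\<lambda>n. a n k * s ^ n) sums X $ k" for k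
    proof -
      have "summable (\<lambda>n. a n k * s ^ n)"
      proof (rule summable_comparison_test')
        show "summable (\<lambda>n. cmod s ^ n)"
          using s by (intro summable_geometric) simp
        show "norm (a n k * s ^ n) \<le> cmod s ^ n" for n
          using a_le [of n k] by (simp add: norm_mult norm_power mult_left_le_one_le)
      qed
      then show ?thesis
        by (simp add: X_def summable_sums)
    qed
    have "X $ k = axis j 1 $ k + s * (A *v X) $ k" for k
    proof -
      have "(\<lambda>n. a (Suc n) k * s ^ Suc n) sums (s * (\<Sum>l\<in>UNIV. A $ k $ l * X $ l))"
      proof -
        have "(\<lambda>n. s * (\<Sum>l\<in>UNIV. A $ k $ l * (a n l * s ^ n))) sums (s * (\<Sum>l\<in>UNIV. A $ k $ l * X $ l))"
          by (intro sums_mult sums_sum sums)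
        then show ?thesis
          by (simp add: a_def matrix_matrix_mult_def sum_distrib_left sum_distrib_right mult_ac)
      qed
      then have "(\<lambda>n. a n k * s ^ n) sums (s * (\<Sum>l\<in>UNIV. A $ k $ l * X $ l) + a 0 k * s ^ 0)"
        by (rule sums_Suc)
      then have "X $ k = s * (\<Sum>l\<in>UNIV. A $ k $ l * X $ l) + a 0 k"
        using sums_unique2 [OF sums] by simp
      moreover have "a 0 k = axis j 1 $ k"
        by (simp add: a_def mat_def axis_def)
      ultimately show ?thesis
        by (simp add: matrix_vector_mult_def)
    qed
    then have "M s *v X = axis j 1"
      by (simp add: M_mult vec_eq_iff)
    moreover have "det (M s) \<noteq> 0"
      using s subsetD [OF \<open>cball 0 1 \<subseteq> U\<close>, of s] by (simp add: U_def)
    ultimately have "X $ i = g s"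
      by (simp add: cramer g_def num_def)
    then show ?thesis
      using sums [of i] by (simp add: a_def)
  qed
  have "(\<lambda>n. (deriv ^^ n) g 0 / fact n * (1 - 0) ^ n) sums g 1"
    by (rule holomorphic_power_series [OF g_hol]) (use R(1) in simp)
  then have "(\<lambda>n. taylor_coeff g n) sums g 1"
    by (simp add: taylor_coeff_def)
  moreover have "taylor_coeff g n = matrix_power A n $ i $ j" for n
    using g_sums by (rule taylor_coeff_eqI)
  ultimately show ?thesis
    by (simp add: summable_LIMSEQ_zero sums_summable)
qed

lemma norm_half_of_small_entries:
  fixes A :: "complex ^ 'd ^ 'd::finite"
  assumes "\<And>i j. cmod (A $ i $ j) \<le> 1 / (2 * (real CARD('d))\<^sup>2)"
  shows "norm (A *v y) \<le> 1/2 * norm y"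
  using norm_matrix_vector_mult_le [OF assms, of y] by simp

lemma small_matrix_power_exists:
  fixes A :: "complex ^ 'd ^ 'd::finite"
  assumes "\<And>y. norm (A *v y) \<le> norm y" and "matrix_spectrum A \<subseteq> disc" and e: "e > 0"
  obtains N where "N > 0" "\<And>i j. cmod (matrix_power A N $ i $ j) < e"
proof -
  have "\<forall>\<^sub>F n in sequentially. \<forall>i j. cmod (matrix_power A n $ i $ j) < e"
    using matrix_power_tendsto_0 [OF assms(1,2)] e
    by (simp add: eventually_all_finite tendsto_iff)
  then have "\<forall>\<^sub>F n in sequentially. n > 0 \<and> (\<forall>i j. cmod (matrix_power A n $ i $ j) < e)"
    using eventually_gt_at_top [of 0] by eventually_elim simp
  then obtain N where "N > 0 \<and> (\<forall>i j. cmod (matrix_power A N $ i $ j) < e)"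
    by (auto simp: eventually_sequentially)
  then show ?thesis
    using that by blast
qed

lemma power_decayingI:
  fixes A :: "complex ^ 'd ^ 'd::finite"
  assumes contr: "\<And>y. norm (A *v y) \<le> norm y" and spec: "matrix_spectrum A \<subseteq> disc"
  shows "power_decaying A"
proof -
  obtain N where N: "N > 0" "\<And>i j. cmod (matrix_power A N $ i $ j) < 1 / (2 * (real CARD('d))\<^sup>2)"
    using small_matrix_power_exists [OF contr spec, of "1 / (2 * (real CARD('d))\<^sup>2)"] by auto
  have "norm (matrix_power A N *v y) \<le> 1/2 * norm y" for y
    using N(2) by (intro norm_half_of_small_entries less_imp_le)
  then have "\<forall>n i j. cmod (matrix_power A n $ i $ j) \<le> 2 * ((1/2) powr (1 / N)) ^ n"
    using contraction_power_decay [OF contr N(1)] by blast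
  then show ?thesis
    unfolding power_decaying_def using half_powr_bounds [OF N(1)] by blast
qed


section \<open>The functional calculus of a matrix\<close>

text \<open>Cauchy's estimate on the circles of radius \<open>r < 1\<close>, with \<open>r\<close> tending to 1.\<close>

lemma norm_taylor_coeff_le:
  assumes g: "g holomorphic_on disc" and M: "\<And>w. w \<in> disc \<Longrightarrow> cmod (g w) \<le> M"
  shows "cmod (taylor_coeff g n) \<le> M"
proof (rule tendsto_upperbound)
  show "((\<lambda>r. cmod (taylor_coeff g n) * r ^ n) \<longlongrightarrow> cmod (taylor_coeff g n)) (at_left (1 :: real))"
    by (rule tendsto_eq_intros refl | simp)+
  have "cmod (taylor_coeff g n) * r ^ n \<le> M" if r: "r \<in> {0<..<1}" for r :: real
  proof -
    have r': "0 < r" "r < 1"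
      using r by auto
    have "M \<ge> 0"
      using order_trans [OF norm_ge_zero M [of 0]] by simp
    have "cmod (taylor_coeff g n * of_real r ^ n) \<le> M * measure lborel (cbox 0 (1 :: real))"
    proof (rule has_integral_bound [OF \<open>M \<ge> 0\<close>])
      show "((\<lambda>t. g (of_real r * circ t) * cnj (circ t) ^ n) has_integral taylor_coeff g n * of_real r ^ n) (cbox 0 1)"
        using has_integral_circle_coefficient [OF g r'] by simp
      show "cmod (g (of_real r * circ t) * cnj (circ t) ^ n) \<le> M" for t
        using M [OF of_real_mult_circ_in_disc [OF r']] by (simp add: norm_mult norm_power)
    qed
    then show ?thesis
      using r' by (simp add: norm_mult norm_power)
  qed
  then show "\<forall>\<^sub>F r in at_left (1 :: real). cmod (taylor_coeff g n) * r ^ n \<le> M"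
    using eventually_at_left_real [of 0 1] by (simp add: eventually_mono)
qed simp

lemma matrix_fun_sums:
  fixes A :: "complex ^ 'd ^ 'd::finite"
  assumes g: "g holomorphic_on disc" and M: "\<And>w. w \<in> disc \<Longrightarrow> cmod (g w) \<le> M" and A: "power_decaying A"
  shows "summable (\<lambda>n. cmod (taylor_coeff g n * matrix_power A n $ i $ j))"
    and "(\<lambda>n. taylor_coeff g n * matrix_power A n $ i $ j) sums (matrix_fun g A $ i $ j)"
proof -
  obtain C \<rho> where \<rho>: "0 < \<rho>" "\<rho> < 1" and decay: "\<And>n i j. cmod (matrix_power A n $ i $ j) \<le> C * \<rho> ^ n"
    using A by (auto simp: power_decaying_def)
  have abs: "summable (\<lambda>n. cmod (taylor_coeff g n * matrix_power A n $ i $ j))" for i j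
  proof (rule summable_comparison_test')
    show "summable (\<lambda>n. M * (C * \<rho> ^ n))"
      using \<rho> by (intro summable_mult summable_geometric) simp
    show "norm (cmod (taylor_coeff g n * matrix_power A n $ i $ j)) \<le> M * (C * \<rho> ^ n)" for n
      using norm_taylor_coeff_le [OF g M] by (simp add: norm_mult) (intro mult_mono' decay; simp)
  qed
  then show "summable (\<lambda>n. cmod (taylor_coeff g n * matrix_power A n $ i $ j))" .
  define S where "S = (\<chi> i j. \<Sum>n. taylor_coeff g n * matrix_power A n $ i $ j)"
  have entry: "(\<lambda>n. taylor_coeff g n * matrix_power A n $ i $ j) sums (S $ i $ j)" for i j
    using summable_norm_cancel [OF abs] by (simp add: S_def summable_sums)
  have "(\<lambda>n. \<chi> i j. taylor_coeff g n * matrix_power A n $ i $ j) sums S"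
    unfolding sums_def
  proof (intro vec_tendstoI)
    show "(\<lambda>N. (\<Sum>n<N. \<chi> i j. taylor_coeff g n * matrix_power A n $ i $ j) $ i $ j) \<longlonglongrightarrow> S $ i $ j" for i j
      using entry [of i j] by (simp add: sums_def)
  qed
  then have "matrix_fun g A = S"
    by (simp add: matrix_fun_def sums_iff)
  then show "(\<lambda>n. taylor_coeff g n * matrix_power A n $ i $ j) sums (matrix_fun g A $ i $ j)"
    using entry by simp
qed

lemma vcinner_matrix_mult: "vcinner (A *v x) y = (\<Sum>i\<in>UNIV. \<Sum>j\<in>UNIV. A $ i $ j * (x $ j * cnj (y $ i)))"
  by (simp add: vcinner_def matrix_vector_mult_def sum_distrib_right mult.assoc)

lemma matrix_fun_vcinner_sums:
  fixes A :: "complex ^ 'd ^ 'd::finite"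
  assumes g: "g holomorphic_on disc" and M: "\<And>w. w \<in> disc \<Longrightarrow> cmod (g w) \<le> M" and A: "power_decaying A"
  shows "(\<lambda>n. taylor_coeff g n * vcinner (matrix_power A n *v x) y) sums vcinner (matrix_fun g A *v x) y"
proof -
  have "(\<lambda>n. \<Sum>i\<in>UNIV. \<Sum>j\<in>UNIV. taylor_coeff g n * matrix_power A n $ i $ j * (x $ j * cnj (y $ i)))
      sums vcinner (matrix_fun g A *v x) y"
    unfolding vcinner_matrix_mult by (intro sums_sum sums_mult2 matrix_fun_sums(2) [OF g M A])
  then show ?thesis
    by (simp add: vcinner_matrix_mult sum_distrib_left mult.assoc)
qed

text \<open>The hypothesis says that \<open>y\<close> is an eigenvector of the adjoint of \<open>A\<close> for the conjugate of \<open>m\<close>, so each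
  power of \<open>A\<close> contributes the same power of \<open>m\<close>.\<close>

lemma matrix_fun_left_eigenvector:
  fixes A :: "complex ^ 'd ^ 'd::finite"
  assumes g: "g holomorphic_on disc" and M: "\<And>w. w \<in> disc \<Longrightarrow> cmod (g w) \<le> M" and A: "power_decaying A"
    and m: "m \<in> disc" and eig: "\<And>x. vcinner (A *v x) y = m * vcinner x y"
  shows "vcinner (matrix_fun g A *v x) y = g m * vcinner x y"
proof -
  have "vcinner (matrix_power A n *v x) y = m ^ n * vcinner x y" for n
    by (induction n) (simp_all add: eig mult.assoc flip: matrix_vector_mul_assoc)
  then have "(\<lambda>n. taylor_coeff g n * m ^ n * vcinner x y) sums vcinner (matrix_fun g A *v x) y"
    using matrix_fun_vcinner_sums [OF g M A, of x y] by (simp add: mult.assoc)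
  moreover have "(\<lambda>n. taylor_coeff g n * m ^ n * vcinner x y) sums (g m * vcinner x y)"
    by (intro sums_mult2 taylor_sums g m)
  ultimately show ?thesis
    by (rule sums_unique2)
qed

lemma matrix_fun_commutes:
  fixes A :: "complex ^ 'd ^ 'd::finite"
  assumes g: "g holomorphic_on disc" and M: "\<And>w. w \<in> disc \<Longrightarrow> cmod (g w) \<le> M" and A: "power_decaying A"
  shows "A ** matrix_fun g A = matrix_fun g A ** A"
proof -
  have "(A ** matrix_fun g A) $ i $ j = (matrix_fun g A ** A) $ i $ j" for i j
  proof -
    note S = matrix_fun_sums(2) [OF g M A]
    have "(\<lambda>n. \<Sum>k\<in>UNIV. A $ i $ k * (taylor_coeff g n * matrix_power A n $ k $ j)) sums (A ** matrix_fun g A) $ i $ j"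
      unfolding matrix_matrix_mult_def by (simp, intro sums_sum sums_mult S)
    moreover have "(\<lambda>n. \<Sum>k\<in>UNIV. taylor_coeff g n * matrix_power A n $ i $ k * A $ k $ j) sums (matrix_fun g A ** A) $ i $ j"
      unfolding matrix_matrix_mult_def by (simp, intro sums_sum sums_mult2 S)
    moreover have "(\<Sum>k\<in>UNIV. A $ i $ k * (taylor_coeff g n * matrix_power A n $ k $ j))
        = (\<Sum>k\<in>UNIV. taylor_coeff g n * matrix_power A n $ i $ k * A $ k $ j)" for n
    proof -
      have "taylor_coeff g n * (A ** matrix_power A n) $ i $ j = taylor_coeff g n * (matrix_power A n ** A) $ i $ j"
        using matrix_power_Suc [of A n] matrix_power_Suc2 [of A n] by simp
      then show ?thesis
        by (simp add: matrix_matrix_mult_def sum_distrib_left mult_ac)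
    qed
    ultimately show ?thesis
      by (simp add: sums_unique2)
  qed
  then show ?thesis
    by (simp add: vec_eq_iff)
qed

lemma taylor_coeff_shift_sums:
  assumes "b holomorphic_on disc" "w \<in> disc"
  shows "(\<lambda>n. (case n of 0 \<Rightarrow> 0 | Suc m \<Rightarrow> taylor_coeff b m) * w ^ n) sums (w * b w)"
proof -
  let ?c = "\<lambda>n. (case n of 0 \<Rightarrow> 0 | Suc m \<Rightarrow> taylor_coeff b m) * w ^ n"
  have "(\<lambda>n. w * (taylor_coeff b n * w ^ n)) sums (w * b w)"
    by (intro sums_mult taylor_sums assms)
  then have "(\<lambda>n. ?c (Suc n)) sums (w * b w)"
    by (simp add: mult_ac)
  then have "?c sums (w * b w + ?c 0)"
    by (rule sums_Suc)
  then show ?thesis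
    by simp
qed

text \<open>A remainder theorem. Let \<open>g\<^sub>n\<close> and \<open>b\<^sub>n\<close> be the Taylor coefficients of \<open>g\<close> and \<open>B\<close>. Comparison in
  \<open>B(w) (w - A) = g(w)\<close> gives \<open>g\<^sub>0 = - b\<^sub>0 A\<close> and \<open>g\<^sub>n = b\<^sub>m - b\<^sub>n A\<close> for \<open>n = m + 1\<close>. Hence the partial sums of \<open>g(A)\<close>
  telescope to \<open>- b\<^sub>N A\<^sup>N A\<close>, which tends to 0 as the \<open>b\<^sub>N\<close> are bounded and the powers of \<open>A\<close> decay.\<close>

lemma matrix_fun_factor:
  fixes A :: "complex ^ 'd ^ 'd::finite"
  assumes g: "g holomorphic_on disc" and M: "\<And>w. w \<in> disc \<Longrightarrow> cmod (g w) \<le> M" and A: "power_decaying A"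
    and B: "\<And>i j. (\<lambda>w. B w $ i $ j) holomorphic_on disc"
    and B_le: "\<And>w i j. w \<in> disc \<Longrightarrow> cmod (B w $ i $ j) \<le> L"
    and factor: "\<And>w. w \<in> disc \<Longrightarrow> B w ** (mat w - A) = mat (g w)"
  shows "matrix_fun g A = 0"
proof -
  define b where "b n = (\<chi> i j. taylor_coeff (\<lambda>w. B w $ i $ j) n)" for n
  define c where "c n = (case n of 0 \<Rightarrow> 0 | Suc m \<Rightarrow> b m) - b n ** A" for n
  have c: "c n $ i $ j = (if i = j then taylor_coeff g n else 0)" for n i j
  proof -
    have "(\<lambda>n. c n $ i $ j * w ^ n) sums (if i = j then g w else 0)" if w: "w \<in> disc" for w
    proof -
      have "(\<lambda>n. (case n of 0 \<Rightarrow> 0 | Suc m \<Rightarrow> b m $ i $ j) * w ^ n) sums (w * B w $ i $ j)"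
        using taylor_coeff_shift_sums [OF B [of i j] w] unfolding b_def vec_lambda_beta .
      moreover have "(\<lambda>n. \<Sum>k\<in>UNIV. b n $ i $ k * w ^ n * A $ k $ j) sums (\<Sum>k\<in>UNIV. B w $ i $ k * A $ k $ j)"
        unfolding b_def by (simp, intro sums_sum sums_mult2 taylor_sums B w)
      ultimately have "(\<lambda>n. (case n of 0 \<Rightarrow> 0 | Suc m \<Rightarrow> b m $ i $ j) * w ^ n
          - (\<Sum>k\<in>UNIV. b n $ i $ k * w ^ n * A $ k $ j)) sums (w * B w $ i $ j - (\<Sum>k\<in>UNIV. B w $ i $ k * A $ k $ j))"
        by (rule sums_diff)
      moreover have "(case n of 0 \<Rightarrow> 0 | Suc m \<Rightarrow> b m $ i $ j) * w ^ n
          - (\<Sum>k\<in>UNIV. b n $ i $ k * w ^ n * A $ k $ j) = c n $ i $ j * w ^ n" for n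
        by (cases n) (simp_all add: c_def matrix_matrix_mult_def left_diff_distrib right_diff_distrib sum_distrib_left sum_distrib_right mult_ac)
      moreover have "w * B w $ i $ j - (\<Sum>k\<in>UNIV. B w $ i $ k * A $ k $ j) = (if i = j then g w else 0)"
        using arg_cong [OF factor [OF w], of "\<lambda>X. X $ i $ j"]
        unfolding matrix_mult_diff_right vector_minus_component mult_mat_entry
        by (simp add: matrix_matrix_mult_def mat_def)
      ultimately show ?thesis
        by simp
    qed
    then have "c n $ i $ j = taylor_coeff (\<lambda>w. if i = j then g w else 0) n"
      by (intro taylor_coeff_eqI [symmetric])
    also have "\<dots> = (if i = j then taylor_coeff g n else 0)"
      by (simp add: taylor_coeff_def)
    finally show ?thesis .
  qed
  have telescope: "(\<Sum>n<Suc N. c n ** matrix_power A n) = - (b N ** matrix_power A (Suc N))" for N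
  proof (induction N)
    case 0
    then show ?case by (simp add: c_def matrix_mul_rid)
  next
    case (Suc N)
    have "c (Suc N) ** matrix_power A (Suc N) = b N ** matrix_power A (Suc N) - b (Suc N) ** (A ** matrix_power A (Suc N))"
      by (simp add: c_def matrix_mul_assoc matrix_mult_diff_left)
    then show ?case
      using Suc by simp
  qed
  have "matrix_fun g A $ i $ j = 0" for i j
  proof -
    obtain C \<rho> where \<rho>: "0 < \<rho>" "\<rho> < 1" and decay: "\<And>n i j. cmod (matrix_power A n $ i $ j) \<le> C * \<rho> ^ n"
      using A by (auto simp: power_decaying_def)
    have b_le: "cmod (b n $ i $ k) \<le> L" for n i k
      unfolding b_def vec_lambda_beta by (rule norm_taylor_coeff_le [OF B B_le])
    have "(\<lambda>N. \<Sum>n<Suc N. taylor_coeff g n * matrix_power A n $ i $ j) \<longlonglongrightarrow> matrix_fun g A $ i $ j"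
      using matrix_fun_sums(2) [OF g M A, of i j] unfolding sums_def by (rule LIMSEQ_Suc)
    moreover have "(\<Sum>n<Suc N. taylor_coeff g n * matrix_power A n $ i $ j) = - (b N ** matrix_power A (Suc N)) $ i $ j" for N
    proof -
      have "c n = mat (taylor_coeff g n)" for n
        by (simp add: vec_eq_iff c mat_def)
      then show ?thesis
        using arg_cong [OF telescope [of N], of "\<lambda>X. X $ i $ j"] by (simp add: mat_mult_entry del: matrix_power_Suc sum.lessThan_Suc)
    qed
    moreover have "(\<lambda>N. - (b N ** matrix_power A (Suc N)) $ i $ j) \<longlonglongrightarrow> 0"
    proof (rule Lim_null_comparison)
      show "\<forall>\<^sub>F N in sequentially. norm (- (b N ** matrix_power A (Suc N)) $ i $ j) \<le> real CARD('d) * (L * (C * \<rho> ^ Suc N))"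
      proof (rule always_eventually, rule allI)
        fix N
        have "norm ((b N ** matrix_power A (Suc N)) $ i $ j) \<le> (\<Sum>k\<in>(UNIV :: 'd set). L * (C * \<rho> ^ Suc N))"
          unfolding matrix_matrix_mult_def [of "b N"] vec_lambda_beta
          by (intro order_trans [OF norm_sum] sum_mono) (simp only: norm_mult, intro mult_mono' b_le decay norm_ge_zero)
        then show "norm (- (b N ** matrix_power A (Suc N)) $ i $ j) \<le> real CARD('d) * (L * (C * \<rho> ^ Suc N))"
          by simp
      qed
      have "(\<lambda>N. \<rho> ^ Suc N) \<longlonglongrightarrow> 0"
        using \<rho> by (intro LIMSEQ_Suc LIMSEQ_realpow_zero) auto
      then show "(\<lambda>N. real CARD('d) * (L * (C * \<rho> ^ Suc N))) \<longlonglongrightarrow> 0"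
        by (intro tendsto_mult_right_zero)
    qed
    ultimately show ?thesis
      by (simp add: LIMSEQ_unique)
  qed
  then show ?thesis
    by (simp add: vec_eq_iff)
qed

lemma det_column_linear:
  fixes M :: "complex ^ 'd ^ 'd::finite"
  shows "det (\<chi> i l. if l = k then y $ i else M $ i $ l)
    = (\<Sum>j\<in>UNIV. y $ j * det (\<chi> i l. if l = k then axis j 1 $ i else M $ i $ l))"
proof -
  have tr: "det (\<chi> i l. if l = k then v $ i else M $ i $ l) = det (\<chi> l. if l = k then v else column l M)" for v
    by (subst det_transpose [symmetric], rule arg_cong [of _ _ det])
      (simp add: vec_eq_iff transpose_def column_def)
  have "det (\<chi> l. if l = k then y else column l M)
      = det (\<chi> l. if l = k then (\<Sum>j\<in>UNIV. y $ j *s axis j 1) else column l M)"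
    by (simp only: basis_expansion)
  also have "\<dots> = (\<Sum>j\<in>UNIV. y $ j * det (\<chi> l. if l = k then axis j 1 else column l M))"
    by (simp only: det_linear_row_sum [OF finite] det_row_mul)
  finally show ?thesis
    by (simp only: tr)
qed

text \<open>The matrix on the left is the adjugate. The identity is Cramer's lemma for the vector \<open>M e\<^sub>j\<close>, which is
  the \<open>j\<close>-th column of \<open>M\<close>.\<close>

lemma adjugate_mult:
  fixes M :: "complex ^ 'd ^ 'd::finite"
  shows "(\<chi> k j. det (\<chi> i l. if l = k then axis j 1 $ i else M $ i $ l)) ** M = mat (det M)"
proof -
  have "(\<Sum>i\<in>UNIV. det (\<chi> i' l. if l = k then axis i 1 $ i' else M $ i' $ l) * M $ i $ j)
      = (if k = j then det M else 0)" for k j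
  proof -
    have "det (\<chi> i l. if l = k then (M *v axis j 1) $ i else M $ i $ l) = axis j 1 $ k * det M"
      by (rule cramer_lemma)
    then show ?thesis
      unfolding det_column_linear [where y = "M *v axis j 1"]
      unfolding matrix_mult_axis
      by (simp add: mult.commute axis_def)
  qed
  then show ?thesis
    by (simp add: vec_eq_iff matrix_matrix_mult_def mat_def)
qed

text \<open>The characteristic polynomial factors as the adjugate of \<open>w - A\<close> times \<open>w - A\<close>, and the entries of
  the adjugate are entire functions of \<open>w\<close>.\<close>

theorem cayley_hamilton_matrix_fun:
  fixes A :: "complex ^ 'd ^ 'd::finite"
  assumes A: "power_decaying A"
  shows "matrix_fun (\<lambda>w. det (mat w - A)) A = 0"
proof -
  have entry: "(\<lambda>w. (mat w - A) $ i $ j) holomorphic_on S" for i j S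
    by (cases "i = j") (simp_all add: mat_def holomorphic_on_diff)
  define B where "B w = (\<chi> k j. det (\<chi> i l. if l = k then axis j 1 $ i else (mat w - A) $ i $ l))" for w
  have B: "(\<lambda>w. B w $ k $ j) holomorphic_on S" for k j S
  proof -
    have "(\<lambda>w. if l = k then axis j 1 $ i else (mat w - A) $ i $ l) holomorphic_on S" for i l
      using entry by (cases "l = k") simp_all
    then show ?thesis
      unfolding B_def by (simp, intro det_holomorphic) simp
  qed
  have bounded: "\<exists>C. \<forall>w\<in>disc. cmod (h w) \<le> C" if "h holomorphic_on UNIV" for h
  proof -
    have "continuous_on (cball 0 1) h"
      using holomorphic_on_imp_continuous_on [OF that] by (rule continuous_on_subset) simp
    then have "compact (h ` cball 0 1)"
      by (simp add: compact_continuous_image)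
    then obtain C where "\<forall>x\<in>h ` cball 0 1. cmod x \<le> C"
      using compact_imp_bounded bounded_iff by blast
    then show ?thesis
      by (intro exI [of _ C]) auto
  qed
  have g: "(\<lambda>w. det (mat w - A)) holomorphic_on S" for S
    by (intro det_holomorphic entry)
  obtain C where C: "\<And>w. w \<in> disc \<Longrightarrow> cmod (det (mat w - A)) \<le> C"
    using bounded [OF g] by blast
  have "\<forall>k j. \<exists>L. \<forall>w\<in>disc. cmod (B w $ k $ j) \<le> L"
    using bounded [OF B] by blast
  then obtain L where L: "\<And>k j w. w \<in> disc \<Longrightarrow> cmod (B w $ k $ j) \<le> L k j"
    by metis
  have L_sum: "cmod (B w $ k $ j) \<le> (\<Sum>k\<in>UNIV. \<Sum>j\<in>UNIV. L k j)" if w: "w \<in> disc" for w k j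
  proof -
    have nn: "0 \<le> L k j" for k j
      using L [OF w, of k j] norm_ge_zero order_trans by blast
    have "cmod (B w $ k $ j) \<le> L k j"
      by (rule L [OF w])
    also have "\<dots> \<le> (\<Sum>j\<in>UNIV. L k j)"
      by (rule member_le_sum) (auto simp: nn)
    also have "\<dots> \<le> (\<Sum>k\<in>UNIV. \<Sum>j\<in>UNIV. L k j)"
      by (rule member_le_sum [of k UNIV "\<lambda>k. \<Sum>j\<in>UNIV. L k j"]) (auto intro: sum_nonneg nn)
    finally show ?thesis .
  qed
  show ?thesis
  proof (rule matrix_fun_factor [OF g C A B L_sum])
    show "B w ** (mat w - A) = mat (det (mat w - A))" for w
      unfolding B_def by (rule adjugate_mult)
  qed
qed


section \<open>The von Neumann inequality for matrices\<close>

text \<open>The sesquilinear form of \<open>1 - A\<^sup>* A\<close>, which is positive semidefinite when \<open>A\<close> is a contraction.\<close>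

definition defect_form :: "complex ^ 'd ^ 'd \<Rightarrow> complex ^ 'd \<Rightarrow> complex ^ 'd::finite \<Rightarrow> complex"
  where "defect_form A u v = vcinner u v - vcinner (A *v u) (A *v v)"

lemma Re_defect_form_self_nonneg:
  assumes "\<And>y. norm (A *v y) \<le> norm y"
  shows "0 \<le> Re (defect_form A u u)"
  using assms [of u] by (simp add: defect_form_def vcinner_self power_mono)

text \<open>Positivity of the form at \<open>c u - v\<close>, where \<open>c\<close> is the unimodular number that turns the mixed term into
  its absolute value.\<close>

lemma norm_defect_form_le:
  assumes contr: "\<And>y. norm (A *v y) \<le> norm y"
  shows "cmod (defect_form A u v) \<le> (Re (defect_form A u u) + Re (defect_form A v v)) / 2"
proof -
  obtain c where c: "cmod c = 1" "c * defect_form A u v = of_real (cmod (defect_form A u v))"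
    using phase_exists by blast
  have cc: "c * cnj c = 1"
    using complex_norm_square [of c] c(1) by simp
  have expand: "defect_form A (c *s u - v) (c *s u - v)
      = (c * cnj c) * defect_form A u u - c * defect_form A u v - cnj (c * defect_form A u v) + defect_form A v v"
    using vcinner_commute [of v u] vcinner_commute [of "A *v v" "A *v u"]
    by (simp add: defect_form_def matrix_vector_mult_diff_distrib vector_scalar_commute
        vcinner_diff_left vcinner_diff_right vcinner_scale_left vcinner_scale_right algebra_simps)
  have "0 \<le> Re (defect_form A (c *s u - v) (c *s u - v))"
    by (rule Re_defect_form_self_nonneg [OF contr])
  then show ?thesis
    unfolding expand by (simp only: cc c(2)) simp
qed

text \<open>The vector \<open>(1 - \<zeta>\<^sup>* A)\<^sup>-\<^sup>1 x\<close> at the point \<open>\<zeta> = circ t\<close>, where \<open>\<zeta>\<^sup>*\<close> is the conjugate of \<open>\<zeta>\<close>. The defect form of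
  two such vectors is the operator-valued Poisson kernel of \<open>A\<close>.\<close>

definition poisson_vector :: "complex ^ 'd ^ 'd \<Rightarrow> complex ^ 'd \<Rightarrow> real \<Rightarrow> complex ^ 'd::finite"
  where "poisson_vector A x t = (\<chi> i. \<Sum>n. (matrix_power A n *v x) $ i * cnj (circ t) ^ n)"

lemma summable_norm_matrix_power_mult:
  fixes A :: "complex ^ 'd ^ 'd::finite"
  assumes A: "power_decaying A"
  shows "summable (\<lambda>n. norm (matrix_power A n *v x))"
proof -
  obtain C \<rho> where \<rho>: "0 < \<rho>" "\<rho> < 1" and decay: "\<And>n i j. cmod (matrix_power A n $ i $ j) \<le> C * \<rho> ^ n"
    using A by (auto simp: power_decaying_def)
  show ?thesis
  proof (rule summable_comparison_test')
    show "summable (\<lambda>n. (real CARD('d))\<^sup>2 * (C * \<rho> ^ n) * norm x)"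
      using \<rho> by (intro summable_mult summable_mult2 summable_geometric) simp
    show "norm (norm (matrix_power A n *v x)) \<le> (real CARD('d))\<^sup>2 * (C * \<rho> ^ n) * norm x" for n
      using norm_matrix_vector_mult_le [OF decay] by simp
  qed
qed

lemma norm_vcinner_le_mult: "cmod (vcinner x y) \<le> real CARD('d) * norm x * norm (y :: complex ^ 'd::finite)"
proof -
  have "cmod (vcinner x y) \<le> (\<Sum>i\<in>(UNIV :: 'd set). norm x * norm y)"
    unfolding vcinner_def by (intro order_trans [OF norm_sum] sum_mono)
      (simp add: norm_mult mult_mono' Finite_Cartesian_Product.norm_nth_le)
  then show ?thesis by simp
qed

lemma poisson_vector_sums:
  fixes A :: "complex ^ 'd ^ 'd::finite"
  assumes A: "power_decaying A"
  shows "(\<lambda>n. vcinner (matrix_power A n *v x) y * cnj (circ t) ^ n) sums vcinner (poisson_vector A x t) y"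
    and "(\<lambda>n. vcinner y (matrix_power A n *v x) * circ t ^ n) sums vcinner y (poisson_vector A x t)"
    and "A *v poisson_vector A x t = circ t *s (poisson_vector A x t - x)"
proof -
  have entry: "(\<lambda>n. (matrix_power A n *v x) $ i * cnj (circ t) ^ n) sums (poisson_vector A x t $ i)" for i
  proof -
    have "summable (\<lambda>n. (matrix_power A n *v x) $ i * cnj (circ t) ^ n)"
      by (rule summable_comparison_test' [OF summable_norm_matrix_power_mult [OF A, of x]])
        (simp add: norm_mult norm_power Finite_Cartesian_Product.norm_nth_le)
    then show ?thesis
      by (simp add: poisson_vector_def summable_sums)
  qed
  have left: "(\<lambda>n. vcinner (matrix_power A n *v x) y * cnj (circ t) ^ n) sums vcinner (poisson_vector A x t) y" for y
  proof -
    have "(\<lambda>n. \<Sum>i\<in>UNIV. (matrix_power A n *v x) $ i * cnj (circ t) ^ n * cnj (y $ i)) sums vcinner (poisson_vector A x t) y"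
      unfolding vcinner_def by (intro sums_sum sums_mult2 entry)
    then show ?thesis
      by (simp add: vcinner_def sum_distrib_left sum_distrib_right mult_ac)
  qed
  then show "(\<lambda>n. vcinner (matrix_power A n *v x) y * cnj (circ t) ^ n) sums vcinner (poisson_vector A x t) y" .
  have "(\<lambda>n. cnj (vcinner (matrix_power A n *v x) y * cnj (circ t) ^ n)) sums cnj (vcinner (poisson_vector A x t) y)"
    using left by (simp only: sums_cnj)
  then show "(\<lambda>n. vcinner y (matrix_power A n *v x) * circ t ^ n) sums vcinner y (poisson_vector A x t)"
    by (simp add: vcinner_commute [of y])
  have "(A *v poisson_vector A x t) $ k = circ t * (poisson_vector A x t $ k - x $ k)" for k
  proof -
    have "(\<lambda>n. \<Sum>l\<in>UNIV. A $ k $ l * ((matrix_power A n *v x) $ l * cnj (circ t) ^ n)) sums (A *v poisson_vector A x t) $ k"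
      unfolding matrix_vector_mult_def [of A] by (simp, intro sums_sum sums_mult entry)
    moreover have "(\<Sum>l\<in>UNIV. A $ k $ l * ((matrix_power A n *v x) $ l * cnj (circ t) ^ n))
        = (matrix_power A (Suc n) *v x) $ k * cnj (circ t) ^ n" for n
    proof -
      have "(matrix_power A (Suc n) *v x) $ k = (A *v (matrix_power A n *v x)) $ k"
        by (simp add: matrix_vector_mul_assoc)
      also have "\<dots> = (\<Sum>l\<in>UNIV. A $ k $ l * (matrix_power A n *v x) $ l)"
        unfolding matrix_vector_mult_def [of A] by simp
      finally show ?thesis
        by (simp add: sum_distrib_right mult.assoc del: matrix_power_Suc)
    qed
    ultimately have "(\<lambda>n. (matrix_power A (Suc n) *v x) $ k * cnj (circ t) ^ n) sums (A *v poisson_vector A x t) $ k"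
      by (simp del: matrix_power_Suc)
    then have "(\<lambda>n. cnj (circ t) * ((matrix_power A (Suc n) *v x) $ k * cnj (circ t) ^ n)) sums (cnj (circ t) * (A *v poisson_vector A x t) $ k)"
      by (rule sums_mult)
    then have "(\<lambda>n. (matrix_power A (Suc n) *v x) $ k * cnj (circ t) ^ Suc n) sums (cnj (circ t) * (A *v poisson_vector A x t) $ k)"
      by (simp add: mult_ac del: matrix_power_Suc)
    then have "(\<lambda>n. (matrix_power A n *v x) $ k * cnj (circ t) ^ n) sums (cnj (circ t) * (A *v poisson_vector A x t) $ k + (matrix_power A 0 *v x) $ k * cnj (circ t) ^ 0)"
      by (rule sums_Suc)
    then have "poisson_vector A x t $ k = cnj (circ t) * (A *v poisson_vector A x t) $ k + x $ k"
      using sums_unique2 [OF entry] by simp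
    then have "circ t * (poisson_vector A x t $ k - x $ k) = circ t * cnj (circ t) * (A *v poisson_vector A x t) $ k"
      by (simp add: mult.assoc)
    then show ?thesis by simp
  qed
  then show "A *v poisson_vector A x t = circ t *s (poisson_vector A x t - x)"
    by (simp add: vec_eq_iff right_diff_distrib)
qed

text \<open>The vector \<open>u = (1 - \<zeta>\<^sup>* A)\<^sup>-\<^sup>1 x\<close> satisfies \<open>A u = \<zeta> (u - x)\<close>, and the factor \<open>\<zeta>\<close> has modulus 1; so the
  quadratic terms of the defect form cancel.\<close>

lemma defect_form_poisson:
  fixes A :: "complex ^ 'd ^ 'd::finite"
  assumes A: "power_decaying A"
  shows "defect_form A (poisson_vector A x t) (poisson_vector A y t)
    = vcinner (poisson_vector A x t) y + vcinner x (poisson_vector A y t) - vcinner x y"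
proof -
  have "vcinner (A *v poisson_vector A x t) (A *v poisson_vector A y t)
      = (circ t * cnj (circ t)) * vcinner (poisson_vector A x t - x) (poisson_vector A y t - y)"
    unfolding poisson_vector_sums(3) [OF A] vcinner_scale_left vcinner_scale_right by (simp add: mult_ac)
  then show ?thesis
    by (simp add: defect_form_def vcinner_diff_left vcinner_diff_right)
qed

text \<open>The Poisson kernel reproduces analytic functions: its negative frequencies give the power series in
  \<open>A\<close>, while the contribution \<open>h(0) \<langle>x, y\<rangle>\<close> of the positive frequencies cancels against the constant that
  is counted twice.\<close>

lemma has_integral_poisson:
  fixes A :: "complex ^ 'd ^ 'd::finite"
  assumes A: "power_decaying A" and h: "h holomorphic_on disc" and r: "0 < r" "r < 1"
  shows "((\<lambda>t. h (of_real r * circ t) * defect_form A (poisson_vector A x t) (poisson_vector A y t))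
    has_integral (\<Sum>n. taylor_coeff h n * of_real r ^ n * vcinner (matrix_power A n *v x) y)) {0..1}"
proof -
  have b1: "summable (\<lambda>n. cmod (vcinner (matrix_power A n *v x) y))"
  proof (rule summable_comparison_test')
    show "summable (\<lambda>n. real CARD('d) * norm (matrix_power A n *v x) * norm y)"
      by (intro summable_mult summable_mult2 summable_norm_matrix_power_mult A)
  qed (simp add: norm_vcinner_le_mult)
  have b2: "summable (\<lambda>n. cmod (vcinner x (matrix_power A n *v y)))"
  proof (rule summable_comparison_test')
    show "summable (\<lambda>n. real CARD('d) * norm x * norm (matrix_power A n *v y))"
      by (intro summable_mult summable_norm_matrix_power_mult A)
  qed (simp add: norm_vcinner_le_mult)
  have u1: "(\<Sum>n. vcinner (matrix_power A n *v x) y * cnj (circ t) ^ n) = vcinner (poisson_vector A x t) y" for t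
    using poisson_vector_sums(1) [OF A] by (simp add: sums_iff)
  have u2: "(\<Sum>n. vcinner x (matrix_power A n *v y) * circ t ^ n) = vcinner x (poisson_vector A y t)" for t
    using poisson_vector_sums(2) [OF A] by (simp add: sums_iff)
  note I1 = has_integral_circle_pairing(1) [OF h r b1, unfolded u1]
  note I2 = has_integral_circle_pairing(3) [OF h r b2, unfolded u2]
  have I3: "((\<lambda>t. h (of_real r * circ t) * vcinner x y) has_integral h 0 * vcinner x y) {0..1}"
    using has_integral_mult_left [OF has_integral_circle_coefficient [OF h r, of 0]] by simp
  have "((\<lambda>t. h (of_real r * circ t) * vcinner (poisson_vector A x t) y + h (of_real r * circ t) * vcinner x (poisson_vector A y t)
        - h (of_real r * circ t) * vcinner x y) has_integral
      ((\<Sum>n. taylor_coeff h n * of_real r ^ n * vcinner (matrix_power A n *v x) y)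
        + h 0 * vcinner x (matrix_power A 0 *v y) - h 0 * vcinner x y)) {0..1}"
    by (intro has_integral_diff has_integral_add I1 I2 I3)
  then show ?thesis
    by (simp add: defect_form_poisson [OF A] algebra_simps)
qed

lemma taylor_coeff_const: "taylor_coeff (\<lambda>_. c) n = (if n = 0 then c else 0)"
  by (simp add: taylor_coeff_def)

lemma has_integral_poisson_1:
  fixes A :: "complex ^ 'd ^ 'd::finite"
  assumes A: "power_decaying A"
  shows "((\<lambda>t. Re (defect_form A (poisson_vector A x t) (poisson_vector A x t))) has_integral (norm x)\<^sup>2) {0..1}"
proof -
  have "(\<Sum>n. taylor_coeff (\<lambda>_. 1) n * of_real (1/2) ^ n * vcinner (matrix_power A n *v x) x) = vcinner x x"
    by (subst suminf_finite [of "{0}"]) (auto simp: taylor_coeff_const)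
  then have "((\<lambda>t. defect_form A (poisson_vector A x t) (poisson_vector A x t)) has_integral vcinner x x) {0..1}"
    using has_integral_poisson [OF A, of "\<lambda>_. 1" "1/2" x x] by simp
  from has_integral_linear [OF this bounded_linear_Re] show ?thesis
    by (simp add: o_def vcinner_self)
qed

text \<open>An absolutely convergent power series is continuous up to the point 1 of its circle of convergence.\<close>

lemma suminf_abel_bound:
  fixes a :: "nat \<Rightarrow> complex"
  assumes a: "summable (\<lambda>n. cmod (a n))" and bound: "\<And>r. 0 < r \<Longrightarrow> r < 1 \<Longrightarrow> cmod (\<Sum>n. a n * of_real r ^ n) \<le> K"
  shows "cmod (\<Sum>n. a n) \<le> K"
proof (rule tendsto_upperbound)
  have "uniform_limit {0..1} (\<lambda>N r. \<Sum>n<N. a n * of_real r ^ n) (\<lambda>r :: real. \<Sum>n. a n * of_real r ^ n) sequentially"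
    by (rule Weierstrass_m_test [OF _ a]) (auto simp: norm_mult norm_power mult_left_le power_le_one)
  then have "continuous_on {0..1} (\<lambda>r :: real. \<Sum>n. a n * of_real r ^ n)"
    by (rule uniform_limit_theorem [rotated]) (auto intro!: always_eventually continuous_intros)
  then have "((\<lambda>r :: real. \<Sum>n. a n * of_real r ^ n) \<longlongrightarrow> (\<Sum>n. a n * of_real 1 ^ n)) (at 1 within {0..1})"
    unfolding continuous_on_def by (rule bspec) simp
  then show "((\<lambda>r :: real. cmod (\<Sum>n. a n * of_real r ^ n)) \<longlongrightarrow> cmod (\<Sum>n. a n)) (at_left 1)"
    by (intro tendsto_norm) (simp add: at_within_Icc_at_left)
  show "\<forall>\<^sub>F r in at_left (1 :: real). cmod (\<Sum>n. a n * of_real r ^ n) \<le> K"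
    using eventually_at_left_real [of 0 1] by (simp add: eventually_mono bound)
qed simp

text \<open>The Poisson kernel of a contraction is a positive form of total mass \<open>\<parallel>x\<parallel>\<^sup>2\<close>, so averaging \<open>g\<close> against it
  costs no more than the supremum of \<open>g\<close>. The bound does not deteriorate when eigenvalues of \<open>A\<close> approach
  the unit circle, as happens for \<open>A = \<Psi>(z)\<close> when \<open>z\<close> approaches the boundary; an estimate through the
  resolvent would.\<close>

theorem von_neumann_inequality:
  fixes A :: "complex ^ 'd ^ 'd::finite"
  assumes contr: "\<And>y. norm (A *v y) \<le> norm y" and A: "power_decaying A"
    and g: "g holomorphic_on disc" and M: "\<And>w. w \<in> disc \<Longrightarrow> cmod (g w) \<le> M"
  shows "norm (matrix_fun g A *v x) \<le> M * norm x"
proof -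
  have M0: "M \<ge> 0"
    using order_trans [OF norm_ge_zero M [of 0]] by simp
  have form_le: "cmod (vcinner (matrix_fun g A *v x) y) \<le> M * (((norm x)\<^sup>2 + (norm y)\<^sup>2) / 2)" for x y
  proof -
    let ?a = "\<lambda>n. taylor_coeff g n * vcinner (matrix_power A n *v x) y"
    have "summable (\<lambda>n. cmod (?a n))"
    proof (rule summable_comparison_test')
      show "summable (\<lambda>n. M * (real CARD('d) * norm (matrix_power A n *v x) * norm y))"
        by (intro summable_mult summable_mult2 summable_norm_matrix_power_mult A)
      show "norm (cmod (?a n)) \<le> M * (real CARD('d) * norm (matrix_power A n *v x) * norm y)" for n
        using norm_taylor_coeff_le [OF g M] by (simp add: norm_mult) (intro mult_mono' norm_vcinner_le_mult; simp)
    qed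
    then have "cmod (\<Sum>n. ?a n) \<le> M * (((norm x)\<^sup>2 + (norm y)\<^sup>2) / 2)"
    proof (rule suminf_abel_bound)
      fix r :: real assume r: "0 < r" "r < 1"
      let ?F = "\<lambda>x y t. defect_form A (poisson_vector A x t) (poisson_vector A y t)"
      note I = has_integral_poisson [OF A g r, of x y]
      have J: "((\<lambda>t. M * ((Re (?F x x t) + Re (?F y y t)) / 2)) has_integral M * (((norm x)\<^sup>2 + (norm y)\<^sup>2) / 2)) {0..1}"
        by (intro has_integral_mult_right has_integral_divide has_integral_add has_integral_poisson_1 A)
      have "cmod (integral {0..1} (\<lambda>t. g (of_real r * circ t) * ?F x y t))
          \<le> integral {0..1} (\<lambda>t. M * ((Re (?F x x t) + Re (?F y y t)) / 2))"
      proof (rule Henstock_Kurzweil_Integration.integral_norm_bound_integral)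
        show "cmod (g (of_real r * circ t) * ?F x y t) \<le> M * ((Re (?F x x t) + Re (?F y y t)) / 2)" for t
          unfolding norm_mult
          by (intro mult_mono M of_real_mult_circ_in_disc r norm_defect_form_le contr M0) auto
      qed (use I J in \<open>auto simp: has_integral_integrable\<close>)
      then show "cmod (\<Sum>n. ?a n * of_real r ^ n) \<le> M * (((norm x)\<^sup>2 + (norm y)\<^sup>2) / 2)"
        unfolding integral_unique [OF I] integral_unique [OF J] by (simp add: mult_ac)
    qed
    then show ?thesis
      using matrix_fun_vcinner_sums [OF g M A, of x y] by (simp add: sums_iff)
  qed
  define v where "v = matrix_fun g A *v x"
  show ?thesis
  proof (cases "v = 0")
    case False
    have "x \<noteq> 0"
      using False by (auto simp: v_def)
    \<comment> \<open>The arithmetic mean in the form bound loses nothing for vectors of equal norm.\<close>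
    define y where "y = of_real (norm x / norm v) *s v"
    have norm_y: "norm y = norm x"
      using False by (simp add: y_def norm_vector_scalar_mult norm_divide)
    have "vcinner v y = of_real (norm x * norm v)"
      using False by (simp add: y_def vcinner_scale_right vcinner_self_of_real power2_eq_square)
    then have "norm x * norm v \<le> M * (norm x * norm x)"
      using form_le [of x y] by (simp add: norm_y norm_mult power2_eq_square flip: v_def)
    then show ?thesis
      using \<open>x \<noteq> 0\<close> by (simp add: mult_ac flip: v_def)
  qed (use M0 in \<open>simp flip: v_def\<close>)
qed


section \<open>Substituting a matrix function into the second variable\<close>

lemma Hinf_bidisc_bound:
  assumes "f \<in> Hinf_bidisc"
  obtains M where "\<And>z w. z \<in> disc \<Longrightarrow> w \<in> disc \<Longrightarrow> cmod (f (z, w)) \<le> M"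
proof -
  obtain M where "\<forall>x\<in>f ` bidisc. cmod x \<le> M"
    using assms unfolding Hinf_bidisc_def bounded_iff by blast
  then show ?thesis
    by (intro that [of M]) auto
qed

lemma Hinf_bidisc_holomorphic_slices:
  assumes f: "f \<in> Hinf_bidisc" and "c \<in> disc"
  shows "(\<lambda>w. f (c, w)) holomorphic_on disc" and "(\<lambda>z. f (z, c)) holomorphic_on disc"
proof -
  have deriv: "\<exists>a b. (f has_derivative (\<lambda>(h, k). a * h + b * k)) (at p)" if "p \<in> bidisc" for p
    using f that unfolding Hinf_bidisc_def by blast
  show "(\<lambda>w. f (c, w)) holomorphic_on disc"
  proof (rule holomorphic_onI)
    fix w assume w: "w \<in> disc"
    then obtain a b where ab: "(f has_derivative (\<lambda>(h, k). a * h + b * k)) (at (c, w))"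
      using deriv [of "(c, w)"] assms(2) by auto
    have "((\<lambda>w. (c, w)) has_derivative (\<lambda>k. (0, k))) (at w)"
      by (intro derivative_intros)
    from has_derivative_compose [OF this ab] have "((\<lambda>w. f (c, w)) has_derivative (\<lambda>k. b * k)) (at w)"
      by simp
    then show "(\<lambda>w. f (c, w)) field_differentiable at w within disc"
      unfolding field_differentiable_def has_field_derivative_def by (blast intro: has_derivative_at_withinI)
  qed
  show "(\<lambda>z. f (z, c)) holomorphic_on disc"
  proof (rule holomorphic_onI)
    fix z assume z: "z \<in> disc"
    then obtain a b where ab: "(f has_derivative (\<lambda>(h, k). a * h + b * k)) (at (z, c))"
      using deriv [of "(z, c)"] assms(2) by auto
    have "((\<lambda>z. (z, c)) has_derivative (\<lambda>k. (k, 0))) (at z)"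
      by (intro derivative_intros)
    from has_derivative_compose [OF this ab] have "((\<lambda>z. f (z, c)) has_derivative (\<lambda>k. a * k)) (at z)"
      by simp
    then show "(\<lambda>z. f (z, c)) field_differentiable at z within disc"
      unfolding field_differentiable_def has_field_derivative_def by (blast intro: has_derivative_at_withinI)
  qed
qed

text \<open>The bound depends on \<open>g\<close> only through \<open>M\<close>. For \<open>g = f(z, \<cdot>)\<close> it is therefore uniform in \<open>z\<close>.\<close>

lemma taylor_remainder_quotient_le:
  assumes g: "g holomorphic_on disc" and M: "\<And>w. w \<in> disc \<Longrightarrow> cmod (g w) \<le> M"
    and h: "h \<noteq> 0" "cmod h \<le> 1/2"
  shows "cmod ((g h - (\<Sum>m<n. taylor_coeff g m * h ^ m)) / h ^ n - taylor_coeff g n) \<le> 2 * M * cmod h"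
proof -
  let ?q = "(g h - (\<Sum>m<n. taylor_coeff g m * h ^ m)) / h ^ n"
  have "h \<in> disc"
    using h(2) by simp
  then have "(\<lambda>m. taylor_coeff g (m + n) * h ^ (m + n)) sums (g h - (\<Sum>m<n. taylor_coeff g m * h ^ m))"
    by (intro sums_split_initial_segment taylor_sums g)
  then have "(\<lambda>m. taylor_coeff g (m + n) * h ^ (m + n) / h ^ n) sums ?q"
    by (rule sums_divide)
  then have "(\<lambda>m. taylor_coeff g (m + n) * h ^ m) sums ?q"
    using h(1) by (simp add: power_add)
  then have "(\<lambda>m. taylor_coeff g (Suc m + n) * h ^ Suc m) sums (?q - taylor_coeff g n)"
    using sums_Suc_iff [of "\<lambda>m. taylor_coeff g (m + n) * h ^ m" "?q - taylor_coeff g n"] by simp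
  moreover have "(\<lambda>m. M * cmod h * cmod h ^ m) sums (M * cmod h * (1 / (1 - cmod h)))"
    using h(2) by (intro sums_mult geometric_sums) simp
  moreover have "cmod (taylor_coeff g (Suc m + n) * h ^ Suc m) \<le> M * cmod h * cmod h ^ m" for m
    using norm_taylor_coeff_le [OF g M, of "Suc m + n"]
    by (simp add: norm_mult norm_power mult.assoc mult_right_mono)
  ultimately have "cmod (?q - taylor_coeff g n) \<le> M * cmod h * (1 / (1 - cmod h))"
    by (rule norm_sums_le)
  also have "\<dots> \<le> M * cmod h * 2"
  proof (rule mult_left_mono)
    show "1 / (1 - cmod h) \<le> 2"
      using h(2) by (simp add: field_simps)
    show "0 \<le> M * cmod h"
      using order_trans [OF norm_ge_zero M [of 0]] by simp
  qed
  finally show ?thesis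
    by (simp add: mult_ac)
qed

text \<open>By induction on \<open>n\<close>: if \<open>c\<^sub>m(z)\<close> is the \<open>m\<close>-th coefficient of \<open>f(z, \<cdot>)\<close>, then \<open>c\<^sub>n(z)\<close> is the limit of the quotients
  \<open>(f(z,h) - (\<Sum>m<n. c\<^sub>m(z) h\<^sup>m)) / h\<^sup>n\<close> as \<open>h\<close> tends to 0, uniformly in \<open>z\<close>.\<close>

lemma taylor_coeff_slice_holomorphic:
  assumes f: "f \<in> Hinf_bidisc"
  shows "(\<lambda>z. taylor_coeff (\<lambda>w. f (z, w)) n) holomorphic_on disc"
proof (induction n rule: less_induct)
  case (less n)
  obtain M where M: "\<And>z w. z \<in> disc \<Longrightarrow> w \<in> disc \<Longrightarrow> cmod (f (z, w)) \<le> M"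
    using Hinf_bidisc_bound [OF f] by blast
  \<comment> \<open>Any null sequence of nonzero points with \<open>\<bar>h\<bar> \<le> 1/2\<close> would do.\<close>
  define h where "h k = (1 / of_nat (Suc (Suc k)) :: complex)" for k
  have h: "h k \<noteq> 0" "cmod (h k) \<le> 1/2" for k
    by (auto simp: h_def norm_divide field_simps simp del: of_nat_Suc)
  have h_lim: "(\<lambda>k. 2 * M * cmod (h k)) \<longlonglongrightarrow> 0"
  proof -
    have "(\<lambda>k. 1 / real (Suc (Suc k))) \<longlonglongrightarrow> 0"
      by (intro LIMSEQ_Suc lim_1_over_n)
    then show ?thesis
      by (intro tendsto_mult_right_zero) (simp add: h_def norm_divide del: of_nat_Suc)
  qed
  define q where "q k z = (f (z, h k) - (\<Sum>m<n. taylor_coeff (\<lambda>w. f (z, w)) m * h k ^ m)) / h k ^ n" for k z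
  have unif: "uniform_limit disc q (\<lambda>z. taylor_coeff (\<lambda>w. f (z, w)) n) sequentially"
  proof (rule uniform_limitI)
    fix e :: real assume "e > 0"
    have "\<forall>\<^sub>F k in sequentially. 2 * M * cmod (h k) < e"
      using h_lim \<open>e > 0\<close> by (rule order_tendstoD)
    then show "\<forall>\<^sub>F k in sequentially. \<forall>z\<in>disc. dist (q k z) (taylor_coeff (\<lambda>w. f (z, w)) n) < e"
    proof eventually_elim
      case (elim k)
      show ?case
      proof
        fix z assume z: "z \<in> disc"
        have "dist (q k z) (taylor_coeff (\<lambda>w. f (z, w)) n) \<le> 2 * M * cmod (h k)"
          unfolding q_def dist_norm
          by (rule taylor_remainder_quotient_le [OF Hinf_bidisc_holomorphic_slices(1) [OF f z] M [OF z] h])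
        then show "dist (q k z) (taylor_coeff (\<lambda>w. f (z, w)) n) < e"
          using elim by linarith
      qed
    qed
  qed
  show ?case
  proof (rule holomorphic_uniform_sequence)
    show "q k holomorphic_on disc" for k
    proof -
      have "h k \<in> disc"
        using h(2) [of k] by simp
      then show ?thesis
        unfolding q_def using h(1)
        by (intro holomorphic_intros Hinf_bidisc_holomorphic_slices(2) [OF f] less.IH) auto
    qed
    fix z assume "z \<in> disc"
    then obtain d where "d > 0" "cball z d \<subseteq> disc"
      using open_contains_cball [of disc] open_ball by blast
    then show "\<exists>d>0. cball z d \<subseteq> disc \<and> uniform_limit (cball z d) q (\<lambda>z. taylor_coeff (\<lambda>w. f (z, w)) n) sequentially"
      using uniform_limit_on_subset [OF unif] by blast
  qed simp
qed

text \<open>The properties of \<open>\<Psi>\<close> that admit the substitution of its values into bounded holomorphic functions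
  on the disc, with a bounded holomorphic result.\<close>

definition stable_multiplier :: "(complex \<Rightarrow> complex ^ 'd ^ 'd::finite) \<Rightarrow> bool"
  where "stable_multiplier \<Psi> \<longleftrightarrow> Hinf_matrix \<Psi> \<and>
    (\<forall>z\<in>disc. (\<forall>y. norm (\<Psi> z *v y) \<le> norm y) \<and> matrix_spectrum (\<Psi> z) \<subseteq> disc)"

lemma stable_multiplierD:
  assumes "stable_multiplier \<Psi>"
  shows "Hinf_matrix \<Psi>" and "(\<lambda>z. \<Psi> z $ i $ j) holomorphic_on disc"
    and "z \<in> disc \<Longrightarrow> norm (\<Psi> z *v y) \<le> norm y"
    and "z \<in> disc \<Longrightarrow> matrix_spectrum (\<Psi> z) \<subseteq> disc"
    and "z \<in> disc \<Longrightarrow> power_decaying (\<Psi> z)"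
proof -
  show "Hinf_matrix \<Psi>" and "(\<lambda>z. \<Psi> z $ i $ j) holomorphic_on disc"
    and contr: "z \<in> disc \<Longrightarrow> norm (\<Psi> z *v y) \<le> norm y"
    and spec: "z \<in> disc \<Longrightarrow> matrix_spectrum (\<Psi> z) \<subseteq> disc" for y
    using assms by (auto simp: stable_multiplier_def Hinf_matrix_def)
  show "power_decaying (\<Psi> z)" if "z \<in> disc"
    by (rule power_decayingI [OF contr spec]) (rule that)+
qed

lemma rational_pure_inner_stable: "rational_pure_inner \<Psi> \<Longrightarrow> stable_multiplier \<Psi>"
  by (simp add: rational_pure_inner_def inner_function_def stable_multiplier_def inner_function_contractive)

lemma matrix_power_holomorphic:
  assumes "\<And>i j. (\<lambda>z. \<Psi> z $ i $ j) holomorphic_on S"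
  shows "(\<lambda>z. matrix_power (\<Psi> z) n $ i $ j) holomorphic_on S"
proof (induction n arbitrary: i j)
  case (Suc n)
  have "(\<lambda>z. \<Sum>k\<in>UNIV. \<Psi> z $ i $ k * matrix_power (\<Psi> z) n $ k $ j) holomorphic_on S"
    by (intro holomorphic_intros assms Suc)
  then show ?case
    by (simp add: matrix_matrix_mult_def)
qed simp

text \<open>A power of \<open>\<Psi>(z\<^sub>0)\<close> with small entries stays small for \<open>z\<close> near \<open>z\<^sub>0\<close>, so the powers of all these \<open>\<Psi>(z)\<close>
  decay at a common rate and the series for \<open>f(z, \<Psi>(z))\<close> converges locally uniformly.\<close>

lemma matrix_fun_slice_holomorphic:
  fixes \<Psi> :: "complex \<Rightarrow> complex ^ 'd ^ 'd::finite"
  assumes \<Psi>: "stable_multiplier \<Psi>" and f: "f \<in> Hinf_bidisc"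
  shows "(\<lambda>z. matrix_fun (\<lambda>w. f (z, w)) (\<Psi> z) $ i $ j) holomorphic_on disc"
proof -
  obtain M where M: "\<And>z w. z \<in> disc \<Longrightarrow> w \<in> disc \<Longrightarrow> cmod (f (z, w)) \<le> M"
    using Hinf_bidisc_bound [OF f] by blast
  note contr = stable_multiplierD(3) [OF \<Psi>] and power_hol = matrix_power_holomorphic [OF stable_multiplierD(2) [OF \<Psi>]]
    and slice = Hinf_bidisc_holomorphic_slices(1) [OF f]
  let ?t = "\<lambda>n z. taylor_coeff (\<lambda>w. f (z, w)) n * matrix_power (\<Psi> z) n $ i $ j"
  let ?e = "1 / (2 * (real CARD('d))\<^sup>2)"
  show ?thesis
  proof (rule holomorphic_uniform_sequence)
    show "(\<lambda>z. \<Sum>n<N. ?t n z) holomorphic_on disc" for N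
      by (intro holomorphic_intros taylor_coeff_slice_holomorphic f power_hol)
    fix z0 :: complex assume z0: "z0 \<in> disc"
    obtain N where N: "N > 0" "\<And>i j. cmod (matrix_power (\<Psi> z0) N $ i $ j) < ?e"
      using small_matrix_power_exists [OF contr [OF z0] stable_multiplierD(4) [OF \<Psi> z0], of ?e] by auto
    have "\<forall>\<^sub>F z in nhds z0. cmod (matrix_power (\<Psi> z) N $ i $ j) < ?e" for i j
    proof -
      have "isCont (\<lambda>z. matrix_power (\<Psi> z) N $ i $ j) z0"
        using holomorphic_on_imp_continuous_on [OF power_hol] z0 by (simp add: continuous_on_eq_continuous_at)
      then have "((\<lambda>z. cmod (matrix_power (\<Psi> z) N $ i $ j)) \<longlongrightarrow> cmod (matrix_power (\<Psi> z0) N $ i $ j)) (nhds z0)"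
        by (intro tendsto_norm) (simp add: isCont_def tendsto_at_iff_tendsto_nhds [of "\<lambda>z. matrix_power (\<Psi> z) N $ i $ j"])
      then show ?thesis
        using N(2) by (rule order_tendstoD)
    qed
    then have "\<forall>\<^sub>F z in nhds z0. \<forall>i j. cmod (matrix_power (\<Psi> z) N $ i $ j) < ?e"
      by (simp add: eventually_all_finite)
    moreover have "\<forall>\<^sub>F z in nhds z0. z \<in> disc"
      using z0 by (intro eventually_nhds_in_open) auto
    ultimately have "\<forall>\<^sub>F z in nhds z0. z \<in> disc \<and> (\<forall>i j. cmod (matrix_power (\<Psi> z) N $ i $ j) < ?e)"
      by eventually_elim simp
    then obtain d where d: "d > 0" "\<And>z. dist z z0 < d \<Longrightarrow> z \<in> disc \<and> (\<forall>i j. cmod (matrix_power (\<Psi> z) N $ i $ j) < ?e)"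
      unfolding eventually_nhds_metric by blast
    have near: "z \<in> disc" "\<And>i j. cmod (matrix_power (\<Psi> z) N $ i $ j) \<le> ?e" if "z \<in> cball z0 (d/2)" for z
      using d(2) [of z] that d(1) by (auto simp: dist_commute less_imp_le)
    let ?\<rho> = "(1/2 :: real) powr (1 / real N)"
    have "uniform_limit (cball z0 (d/2)) (\<lambda>N z. \<Sum>n<N. ?t n z) (\<lambda>z. \<Sum>n. ?t n z) sequentially"
    proof (rule Weierstrass_m_test)
      show "summable (\<lambda>n. M * (2 * ?\<rho> ^ n))"
        using half_powr_bounds [OF N(1)] by (intro summable_mult summable_geometric) simp
      fix n z assume z: "z \<in> cball z0 (d/2)"
      have "cmod (matrix_power (\<Psi> z) n $ i $ j) \<le> 2 * ?\<rho> ^ n"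
        using contr [OF near(1) [OF z]] N(1) norm_half_of_small_entries [OF near(2) [OF z]]
        by (rule contraction_power_decay)
      moreover have "cmod (taylor_coeff (\<lambda>w. f (z, w)) n) \<le> M"
        using near(1) [OF z] by (intro norm_taylor_coeff_le slice M)
      ultimately show "norm (?t n z) \<le> M * (2 * ?\<rho> ^ n)"
        unfolding norm_mult by (intro mult_mono') auto
    qed
    moreover have "(\<Sum>n. ?t n z) = matrix_fun (\<lambda>w. f (z, w)) (\<Psi> z) $ i $ j" if "z \<in> cball z0 (d/2)" for z
      using matrix_fun_sums(2) [OF slice M stable_multiplierD(5) [OF \<Psi>]] near(1) [OF that]
      by (simp add: sums_iff)
    ultimately have "uniform_limit (cball z0 (d/2)) (\<lambda>N z. \<Sum>n<N. ?t n z)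
        (\<lambda>z. matrix_fun (\<lambda>w. f (z, w)) (\<Psi> z) $ i $ j) sequentially"
      by (subst uniform_limit_cong [where g = "\<lambda>N z. \<Sum>n<N. ?t n z" and i = "\<lambda>z. \<Sum>n. ?t n z"]) auto
    then show "\<exists>d>0. cball z0 d \<subseteq> disc \<and> uniform_limit (cball z0 d) (\<lambda>N z. \<Sum>n<N. ?t n z)
        (\<lambda>z. matrix_fun (\<lambda>w. f (z, w)) (\<Psi> z) $ i $ j) sequentially"
      using d(1) near(1) by (intro exI [of _ "d/2"]) auto
  qed simp
qed

text \<open>Boundedness up to the boundary of the disc is where the von Neumann inequality is indispensable. It
  makes \<open>f(M\<^sub>z \<otimes> I, M\<^sub>\<Psi>)\<close> a bounded operator, which therefore has an adjoint.\<close>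

lemma Hinf_matrix_matrix_fun:
  fixes \<Psi> :: "complex \<Rightarrow> complex ^ 'd ^ 'd::finite"
  assumes \<Psi>: "stable_multiplier \<Psi>" and f: "f \<in> Hinf_bidisc"
  shows "Hinf_matrix (\<lambda>z. matrix_fun (\<lambda>w. f (z, w)) (\<Psi> z))"
proof -
  obtain M where M: "\<And>z w. z \<in> disc \<Longrightarrow> w \<in> disc \<Longrightarrow> cmod (f (z, w)) \<le> M"
    using Hinf_bidisc_bound [OF f] by blast
  have entry: "cmod (matrix_fun (\<lambda>w. f (z, w)) (\<Psi> z) $ i $ j) \<le> M" if z: "z \<in> disc" for z i j
    by (rule norm_matrix_entry_le_bound, rule von_neumann_inequality)
      (use stable_multiplierD [OF \<Psi>] Hinf_bidisc_holomorphic_slices(1) [OF f] M z in auto)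
  have "norm (matrix_fun (\<lambda>w. f (z, w)) (\<Psi> z)) \<le> real CARD('d) * (real CARD('d) * M)" if z: "z \<in> disc" for z
  proof -
    have "norm (matrix_fun (\<lambda>w. f (z, w)) (\<Psi> z)) \<le> (\<Sum>i\<in>UNIV. norm (matrix_fun (\<lambda>w. f (z, w)) (\<Psi> z) $ i))"
      unfolding norm_vec_def [of "matrix_fun _ _"] by (rule L2_set_le_sum) simp
    also have "\<dots> \<le> (\<Sum>i\<in>(UNIV :: 'd set). \<Sum>j\<in>(UNIV :: 'd set). M)"
      by (intro sum_mono order_trans [OF norm_vec_le_sum] entry z)
    finally show ?thesis by simp
  qed
  then have "bounded ((\<lambda>z. matrix_fun (\<lambda>w. f (z, w)) (\<Psi> z)) ` disc)"
    unfolding bounded_iff by blast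
  then show ?thesis
    using matrix_fun_slice_holomorphic [OF \<Psi> f] by (simp add: Hinf_matrix_def)
qed


section \<open>The characteristic function of the multiplier\<close>

text \<open>Differentiability in the sense of \<open>Hinf_bidisc\<close> at a single point; sums and products preserve it,
  hence so do determinants.\<close>

definition complex_differentiable2 :: "(complex \<times> complex \<Rightarrow> complex) \<Rightarrow> complex \<times> complex \<Rightarrow> bool"
  where "complex_differentiable2 f p \<longleftrightarrow> (\<exists>a b. (f has_derivative (\<lambda>(h, k). a * h + b * k)) (at p))"

lemma complex_differentiable2_const: "complex_differentiable2 (\<lambda>_. c) p"
  unfolding complex_differentiable2_def by (rule exI [of _ 0], rule exI [of _ 0]) (simp add: case_prod_unfold)

lemma complex_differentiable2_snd: "complex_differentiable2 snd p"
  unfolding complex_differentiable2_def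
  by (rule exI [of _ 0], rule exI [of _ 1]) (auto simp: case_prod_unfold intro!: derivative_eq_intros)

lemma complex_differentiable2_fst:
  assumes "g holomorphic_on disc" "fst p \<in> disc"
  shows "complex_differentiable2 (\<lambda>p. g (fst p)) p"
proof -
  have "(g has_field_derivative deriv g (fst p)) (at (fst p))"
    using assms by (intro holomorphic_derivI [of _ disc]) auto
  then have "(g has_derivative (\<lambda>h. deriv g (fst p) * h)) (at (fst p))"
    by (simp add: has_field_derivative_def)
  then have "((\<lambda>p. g (fst p)) has_derivative (\<lambda>h. deriv g (fst p) * fst h)) (at p)"
    by (rule has_derivative_compose [OF has_derivative_fst [OF has_derivative_ident]])
  then show ?thesis
    unfolding complex_differentiable2_def
    by (intro exI [of _ "deriv g (fst p)"] exI [of _ 0]) (simp add: case_prod_unfold)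
qed

lemma complex_differentiable2_diff:
  assumes "complex_differentiable2 f p" "complex_differentiable2 g p"
  shows "complex_differentiable2 (\<lambda>p. f p - g p) p"
proof -
  obtain a b a' b' where "(f has_derivative (\<lambda>(h, k). a * h + b * k)) (at p)" "(g has_derivative (\<lambda>(h, k). a' * h + b' * k)) (at p)"
    using assms by (auto simp: complex_differentiable2_def)
  from has_derivative_diff [OF this] show ?thesis
    unfolding complex_differentiable2_def
    by (intro exI [of _ "a - a'"] exI [of _ "b - b'"]) (simp add: case_prod_unfold algebra_simps)
qed

lemma complex_differentiable2_add:
  assumes "complex_differentiable2 f p" "complex_differentiable2 g p"
  shows "complex_differentiable2 (\<lambda>p. f p + g p) p"
  using complex_differentiable2_diff [OF assms(1) complex_differentiable2_diff [OF complex_differentiable2_const [of 0] assms(2)]]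
  by simp

lemma complex_differentiable2_mult:
  assumes "complex_differentiable2 f p" "complex_differentiable2 g p"
  shows "complex_differentiable2 (\<lambda>p. f p * g p) p"
proof -
  obtain a b a' b' where "(f has_derivative (\<lambda>(h, k). a * h + b * k)) (at p)" "(g has_derivative (\<lambda>(h, k). a' * h + b' * k)) (at p)"
    using assms by (auto simp: complex_differentiable2_def)
  from has_derivative_mult [OF this] show ?thesis
    unfolding complex_differentiable2_def
    by (intro exI [of _ "f p * a' + a * g p"] exI [of _ "f p * b' + b * g p"]) (simp add: case_prod_unfold algebra_simps)
qed

lemma complex_differentiable2_sum:
  "(\<And>i. i \<in> I \<Longrightarrow> complex_differentiable2 (f i) p) \<Longrightarrow> complex_differentiable2 (\<lambda>p. \<Sum>i\<in>I. f i p) p"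
  by (induction I rule: infinite_finite_induct) (simp_all add: complex_differentiable2_const complex_differentiable2_add)

lemma complex_differentiable2_prod:
  "(\<And>i. i \<in> I \<Longrightarrow> complex_differentiable2 (f i) p) \<Longrightarrow> complex_differentiable2 (\<lambda>p. \<Prod>i\<in>I. f i p) p"
  by (induction I rule: infinite_finite_induct) (simp_all add: complex_differentiable2_const complex_differentiable2_mult)

definition char_function :: "(complex \<Rightarrow> complex ^ 'd ^ 'd::finite) \<Rightarrow> complex \<times> complex \<Rightarrow> complex"
  where "char_function \<Psi> = (\<lambda>(z, w). det (mat w - \<Psi> z))"

lemma char_function_Hinf:
  fixes \<Psi> :: "complex \<Rightarrow> complex ^ 'd ^ 'd::finite"
  assumes \<Psi>: "stable_multiplier \<Psi>"
  shows "char_function \<Psi> \<in> Hinf_bidisc"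
proof -
  have "complex_differentiable2 (char_function \<Psi>) p" if "p \<in> bidisc" for p
  proof -
    have "complex_differentiable2 (\<lambda>p. (mat (snd p) - \<Psi> (fst p)) $ i $ j) p" for i j
    proof -
      have "complex_differentiable2 (\<lambda>p. if i = j then snd p else 0) p"
        by (cases "i = j") (simp_all add: complex_differentiable2_const complex_differentiable2_snd)
      moreover have "complex_differentiable2 (\<lambda>p. \<Psi> (fst p) $ i $ j) p"
        using that by (intro complex_differentiable2_fst stable_multiplierD(2) [OF \<Psi>]) auto
      ultimately have "complex_differentiable2 (\<lambda>p. (if i = j then snd p else 0) - \<Psi> (fst p) $ i $ j) p"
        by (rule complex_differentiable2_diff)
      then show ?thesis
        by (simp add: mat_def)
    qed
    then have "complex_differentiable2 (\<lambda>p. det (mat (snd p) - \<Psi> (fst p))) p"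
      unfolding det_def
      by (intro complex_differentiable2_sum complex_differentiable2_mult complex_differentiable2_prod
          complex_differentiable2_const)
    then show ?thesis
      by (simp add: char_function_def case_prod_unfold)
  qed
  moreover have "bounded (char_function \<Psi> ` bidisc)"
  proof -
    have "cmod (det (mat w - \<Psi> z)) \<le> (\<Sum>p\<in>{p. p permutes (UNIV :: 'd set)}. 2 ^ CARD('d))"
      if z: "z \<in> disc" and w: "w \<in> disc" for z w
    proof -
      have entry: "cmod ((mat w - \<Psi> z) $ i $ j) \<le> 2" for i j
      proof -
        have "cmod (\<Psi> z $ i $ j) \<le> 1"
          using stable_multiplierD(3) [OF \<Psi> z] by (intro norm_matrix_entry_le_bound) simp
        moreover have "cmod (mat w $ i $ j) \<le> 1"
          using w by (simp add: mat_def)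
        ultimately show ?thesis
          using norm_triangle_ineq4 [of "mat w $ i $ j" "\<Psi> z $ i $ j"] by simp
      qed
      show ?thesis
        unfolding det_def
      proof (intro order_trans [OF norm_sum] sum_mono)
        fix p :: "'d \<Rightarrow> 'd"
        have "cmod (\<Prod>i\<in>UNIV. (mat w - \<Psi> z) $ i $ p i) \<le> (\<Prod>i\<in>(UNIV :: 'd set). 2)"
          unfolding prod_norm [symmetric] by (intro prod_mono) (simp add: entry del: vector_minus_component)
        then show "cmod (of_int (sign p) * (\<Prod>i\<in>UNIV. (mat w - \<Psi> z) $ i $ p i)) \<le> 2 ^ CARD('d)"
          by (simp add: norm_mult sign_def del: vector_minus_component)
      qed
    qed
    then show ?thesis
      unfolding bounded_iff char_function_def by (intro exI) auto
  qed
  ultimately show ?thesis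
    by (simp add: Hinf_bidisc_def complex_differentiable2_def)
qed

text \<open>By the Cayley-Hamilton theorem in each fibre, the function \<open>det (w - \<Psi>(z))\<close> of the pair \<open>(M\<^sub>z \<otimes> I, M\<^sub>\<Psi>)\<close>
  vanishes.\<close>

lemma char_function_in_Ann:
  fixes \<Psi> :: "complex \<Rightarrow> complex ^ 'd ^ 'd::finite"
  assumes \<Psi>: "stable_multiplier \<Psi>"
  shows "char_function \<Psi> \<in> Ann J \<Psi>"
proof -
  have "model_calc \<Psi> (char_function \<Psi>) F = 0" for F
  proof -
    have "matrix_fun (\<lambda>w. char_function \<Psi> (z, w)) (\<Psi> z) = 0" if "z \<in> disc" for z
      using cayley_hamilton_matrix_fun [OF stable_multiplierD(5) [OF \<Psi> that]] by (simp add: char_function_def)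
    then have "(\<lambda>z. if z \<in> disc then matrix_fun (\<lambda>w. char_function \<Psi> (z, w)) (\<Psi> z) *v hardy_fun F z else 0) = (\<lambda>_. 0)"
      by (auto simp: fun_eq_iff)
    then show ?thesis
      by (simp only: model_calc_def mult_op_def zero_hardy_def)
  qed
  moreover have "cadj J 0 = 0"
    by (rule cadj_eqI) simp
  ultimately have "pair_calc J \<Psi> (char_function \<Psi>) = (\<lambda>h. 0)"
    by (simp add: pair_calc_def)
  then show ?thesis
    using char_function_Hinf [OF \<Psi>] by (simp add: Ann_def)
qed


section \<open>The constrained space and its compressions\<close>

lemma Ann_Hinf: "f \<in> Ann J \<Psi> \<Longrightarrow> f \<in> Hinf_bidisc"
  by (simp add: Ann_def)

text \<open>The kernels of the adjoints that define the space are the orthogonal complements of the ranges. The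
  existence of the adjoints matters here: a value 0 of \<open>cadj\<close> is informative only if the adjoint exists.\<close>

lemma K_space_iff:
  assumes \<Psi>: "stable_multiplier \<Psi>"
  shows "F \<in> K_space J \<Psi> \<longleftrightarrow> (\<forall>f\<in>Ann J \<Psi>. \<forall>u. cinner (model_calc \<Psi> f u) F = 0)"
proof -
  have "cadj (model_calc \<Psi> f) F = 0 \<longleftrightarrow> (\<forall>u. cinner (model_calc \<Psi> f u) F = 0)" if "f \<in> Ann J \<Psi>" for f
  proof -
    have "cinner (model_calc \<Psi> f u) F = cinner u (cadj (model_calc \<Psi> f) F)" for u
      unfolding model_calc_def by (intro cinner_mult_op_cadj Hinf_matrix_matrix_fun \<Psi> Ann_Hinf [OF that])
    then show ?thesis
      using cinner_self_eq_0 by auto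
  qed
  then show ?thesis
    by (auto simp: K_space_def)
qed

lemma K_space_closed_subspace:
  assumes \<Psi>: "stable_multiplier \<Psi>"
  shows "complex_vector.subspace (K_space J \<Psi>)" and "closed (K_space J \<Psi>)"
proof -
  show "complex_vector.subspace (K_space J \<Psi>)"
    unfolding complex_vector.subspace_def
    by (auto simp: K_space_iff [OF \<Psi>] cinner_add_right cinner_scaleC_right)
  have "K_space J \<Psi> = {F. \<forall>G\<in>{model_calc \<Psi> f u | f u. f \<in> Ann J \<Psi>}. cinner F G = 0}"
    by (auto simp: K_space_iff [OF \<Psi>]) (metis cinner_commute complex_cnj_zero)+
  then show "closed (K_space J \<Psi>)"
    by (simp only: closed_orthogonal)
qed

text \<open>On a subspace that is invariant under the adjoint of \<open>T\<close>, the adjoint of the compression is the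
  restriction of the adjoint.\<close>

lemma cadj_on_compression:
  fixes K :: "'a::complex_hilbert_space set"
  assumes K: "complex_vector.subspace K" "closed K"
    and v: "v \<in> K" "v' \<in> K" and adj: "\<And>u. cinner (T u) v = cinner u v'"
  shows "cadj_on K (compression K T) v = v'"
proof (rule cadj_on_eqI [OF K(1) v(2)])
  fix u
  have "cinner (T u - orth_proj K (T u)) v = 0"
    by (rule orth_proj(2) [OF K v(1)])
  then show "cinner (compression K T u) v = cinner u v'"
    by (simp add: compression_def cinner_diff_left adj)
qed

text \<open>The operator \<open>M\<^sub>\<Phi>\<close> commutes with every \<open>f(M\<^sub>z \<otimes> I, M\<^sub>\<Psi>)\<close>, so it maps the ranges of these operators into
  themselves, and its adjoint preserves the orthogonal complement of the ranges.\<close>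

lemma K_space_coinvariant:
  fixes \<Psi> \<Phi> :: "complex \<Rightarrow> complex ^ 'd ^ 'd::finite"
  assumes \<Psi>: "stable_multiplier \<Psi>" and \<Phi>: "Hinf_matrix \<Phi>"
    and comm: "\<And>f z. f \<in> Ann J \<Psi> \<Longrightarrow> z \<in> disc \<Longrightarrow>
      \<Phi> z ** matrix_fun (\<lambda>w. f (z, w)) (\<Psi> z) = matrix_fun (\<lambda>w. f (z, w)) (\<Psi> z) ** \<Phi> z"
    and F: "F \<in> K_space J \<Psi>"
  shows "cadj (mult_op \<Phi>) F \<in> K_space J \<Psi>"
  unfolding K_space_iff [OF \<Psi>]
proof (intro ballI allI)
  fix f u assume f: "f \<in> Ann J \<Psi>"
  have "mult_op \<Phi> (model_calc \<Psi> f u) = model_calc \<Psi> f (mult_op \<Phi> u)"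
    unfolding model_calc_def
    by (rule hardy_ext) (simp add: hardy_fun_mult_op \<Phi> Hinf_matrix_matrix_fun [OF \<Psi> Ann_Hinf [OF f]]
        matrix_vector_mul_assoc comm [OF f])
  then show "cinner (model_calc \<Psi> f u) (cadj (mult_op \<Phi>) F) = 0"
    using F f by (simp add: K_space_iff [OF \<Psi>] flip: cinner_mult_op_cadj [OF \<Phi>])
qed

lemma Hinf_matrix_mat: "Hinf_matrix (mat :: complex \<Rightarrow> complex ^ 'd ^ 'd::finite)"
proof -
  have "(\<lambda>z. (mat z :: complex ^ 'd ^ 'd) $ i $ j) holomorphic_on disc" for i j
    by (cases "i = j") (simp_all add: mat_def)
  moreover have "norm (mat z :: complex ^ 'd ^ 'd) \<le> real CARD('d) * real CARD('d)" if z: "z \<in> disc" for z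
  proof -
    have entry: "cmod ((mat z :: complex ^ 'd ^ 'd) $ i $ j) \<le> 1" for i j
      using z by (simp add: mat_def)
    have "norm (mat z :: complex ^ 'd ^ 'd) \<le> (\<Sum>i\<in>UNIV. norm ((mat z :: complex ^ 'd ^ 'd) $ i))"
      unfolding norm_vec_def [of "mat z :: complex ^ 'd ^ 'd"] by (rule L2_set_le_sum) simp
    also have "\<dots> \<le> (\<Sum>i\<in>(UNIV :: 'd set). \<Sum>j\<in>(UNIV :: 'd set). 1)"
      by (intro sum_mono order_trans [OF norm_vec_le_sum] entry)
    finally show ?thesis by simp
  qed
  then have "bounded ((mat :: complex \<Rightarrow> complex ^ 'd ^ 'd) ` disc)"
    unfolding bounded_iff by blast
  ultimately show ?thesis
    by (simp add: Hinf_matrix_def)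
qed

lemma S1_S2_cadj:
  fixes \<Psi> :: "complex \<Rightarrow> complex ^ 'd ^ 'd::finite"
  assumes \<Psi>: "stable_multiplier \<Psi>" and v: "v \<in> K_space J \<Psi>"
  shows "cadj_on (K_space J \<Psi>) (S1 J \<Psi>) v = cadj shift_op v"
    and "cadj_on (K_space J \<Psi>) (S2 J \<Psi>) v = cadj (mult_op \<Psi>) v"
proof -
  note K = K_space_closed_subspace [OF \<Psi>]
  have "cadj (mult_op mat) v \<in> K_space J \<Psi>"
  proof (rule K_space_coinvariant [OF \<Psi> Hinf_matrix_mat _ v])
    show "mat z ** matrix_fun (\<lambda>w. f (z, w)) (\<Psi> z) = matrix_fun (\<lambda>w. f (z, w)) (\<Psi> z) ** mat z" for f z
      by (simp add: vec_eq_iff mat_mult_entry mult_mat_entry)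
  qed
  then show "cadj_on (K_space J \<Psi>) (S1 J \<Psi>) v = cadj shift_op v"
    unfolding S1_def shift_op_def
    by (intro cadj_on_compression K v cinner_mult_op_cadj Hinf_matrix_mat)
  have "cadj (mult_op \<Psi>) v \<in> K_space J \<Psi>"
  proof (rule K_space_coinvariant [OF \<Psi> stable_multiplierD(1) [OF \<Psi>] _ v])
    fix f z assume f: "f \<in> Ann J \<Psi>" and z: "z \<in> disc"
    obtain M where "\<And>z w. z \<in> disc \<Longrightarrow> w \<in> disc \<Longrightarrow> cmod (f (z, w)) \<le> M"
      using Hinf_bidisc_bound [OF Ann_Hinf [OF f]] by blast
    then show "\<Psi> z ** matrix_fun (\<lambda>w. f (z, w)) (\<Psi> z) = matrix_fun (\<lambda>w. f (z, w)) (\<Psi> z) ** \<Psi> z"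
      using z by (intro matrix_fun_commutes Hinf_bidisc_holomorphic_slices(1) [OF Ann_Hinf [OF f]]
          stable_multiplierD(5) [OF \<Psi>])
  qed
  then show "cadj_on (K_space J \<Psi>) (S2 J \<Psi>) v = cadj (mult_op \<Psi>) v"
    unfolding S2_def
    by (intro cadj_on_compression K v cinner_mult_op_cadj stable_multiplierD(1) [OF \<Psi>])
qed


section \<open>Joint eigenvectors\<close>

lemma hcoeff_shift:
  "hcoeff (shift_op F) n = (case n of 0 \<Rightarrow> 0 | Suc m \<Rightarrow> hcoeff F m)"
proof -
  have "hcoeff (shift_op F) n $ i = (case n of 0 \<Rightarrow> 0 | Suc m \<Rightarrow> taylor_coeff (\<lambda>z. hardy_fun F z $ i) m)" for i
  proof -
    have "taylor_coeff (\<lambda>z. hardy_fun (shift_op F) z $ i) n = (case n of 0 \<Rightarrow> 0 | Suc m \<Rightarrow> taylor_coeff (\<lambda>z. hardy_fun F z $ i) m)"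
    proof (rule taylor_coeff_eqI)
      fix z assume z: "z \<in> disc"
      then have "hardy_fun (shift_op F) z $ i = z * hardy_fun F z $ i"
        by (simp add: shift_op_def hardy_fun_mult_op [OF Hinf_matrix_mat] mat_vector_mult)
      then show "(\<lambda>n. (case n of 0 \<Rightarrow> 0 | Suc m \<Rightarrow> taylor_coeff (\<lambda>z. hardy_fun F z $ i) m) * z ^ n)
          sums (hardy_fun (shift_op F) z $ i)"
        using taylor_coeff_shift_sums [OF hardy_holomorphic z] by simp
    qed
    then show ?thesis
      by (simp add: vtaylor_coeff_def)
  qed
  then show ?thesis
    by (cases n) (simp_all add: vec_eq_iff vtaylor_coeff_def)
qed

lemma vcinner_eqI: "(\<And>y. vcinner y u = vcinner y v) \<Longrightarrow> u = (v :: complex ^ 'd::finite)"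
proof -
  assume *: "\<And>y. vcinner y u = vcinner y v"
  have "vcinner (u - v) (u - v) = 0"
    using * by (simp add: vcinner_diff_right)
  then show "u = v"
    by (simp add: vcinner_self_of_real)
qed

text \<open>The adjoint of the shift deletes the constant coefficient. So the coefficients of an eigenvector form
  a geometric progression with ratio \<open>cnj l\<close>, and square summability forces \<open>l\<close> into the open disc.\<close>

lemma shift_eigenvector:
  fixes v :: "'d::finite hardy"
  assumes v: "v \<noteq> 0" and eig: "\<And>u. cinner (shift_op u) v = l * cinner u v"
  obtains x where "x \<noteq> 0" "l \<in> disc" "v = szego_kernel l x"
proof -
  have step: "hcoeff v (Suc n) = cnj l *s hcoeff v n" for n
  proof (rule vcinner_eqI)
    fix y :: "complex ^ 'd"
    have "summable (\<lambda>k. (norm (if k = n then y else 0))\<^sup>2)"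
      by (rule summable_finite [of "{n}"]) auto
    then obtain u where u: "\<And>k. hcoeff u k = (if k = n then y else 0)"
      by (rule hardy_with_coeffs) (rule that)
    have "cinner (shift_op u) v = vcinner y (hcoeff v (Suc n))"
      unfolding cinner_hardy_def
      by (subst suminf_finite [of "{Suc n}"]) (auto simp: hcoeff_shift u vcinner_def split: nat.split)
    moreover have "cinner u v = vcinner y (hcoeff v n)"
      unfolding cinner_hardy_def by (subst suminf_finite [of "{n}"]) (auto simp: u vcinner_def)
    ultimately show "vcinner y (hcoeff v (Suc n)) = vcinner y (cnj l *s hcoeff v n)"
      using eig [of u] by (simp add: vcinner_scale_right)
  qed
  define x where "x = hcoeff v 0"
  have coeff: "hcoeff v n = cnj l ^ n *s x" for n
    by (induction n) (simp_all add: step x_def vector_smult_assoc)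
  have "x \<noteq> 0"
    using v hardy_eqI [of v 0] by (auto simp: coeff hcoeff_zero)
  have "cmod l < 1"
  proof (rule ccontr)
    assume "\<not> cmod l < 1"
    have lim: "(\<lambda>n. (norm (hcoeff v n))\<^sup>2) \<longlonglongrightarrow> 0"
      by (rule summable_LIMSEQ_zero [OF hardy_summable])
    have "(norm x)\<^sup>2 \<le> (norm (hcoeff v n))\<^sup>2" for n
      using \<open>\<not> cmod l < 1\<close> mult_right_mono [of 1 "cmod l ^ n" "norm x"]
      by (intro power_mono) (simp_all add: coeff norm_vector_scalar_mult norm_power one_le_power)
    then have "(norm x)\<^sup>2 \<le> 0"
      by (intro LIMSEQ_le_const [OF lim]) blast
    then show False
      using \<open>x \<noteq> 0\<close> by simp
  qed
  then have l: "l \<in> disc"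
    by simp
  then have "v = szego_kernel l x"
    by (intro hardy_eqI) (simp add: coeff hcoeff_szego_kernel)
  then show ?thesis
    using that \<open>x \<noteq> 0\<close> l by blast
qed

lemma cinner_mult_op_szego_kernel:
  assumes "Hinf_matrix \<Phi>" "l \<in> disc"
  shows "cinner (mult_op \<Phi> u) (szego_kernel l x) = vcinner (\<Phi> l *v hardy_fun u l) x"
  using assms by (simp add: cinner_szego_kernel hardy_fun_mult_op)

text \<open>The adjoint of \<open>f(M\<^sub>z \<otimes> I, M\<^sub>\<Psi>)\<close> acts on a joint eigenvector as the conjugate of \<open>f(l, m)\<close>: the kernel
  evaluates \<open>f(z, \<Psi>(z))\<close> at \<open>z = l\<close>, and \<open>x\<close> is a left eigenvector of \<open>\<Psi>(l)\<close>.\<close>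

lemma cinner_model_calc_szego_kernel:
  assumes \<Psi>: "stable_multiplier \<Psi>" and f: "f \<in> Hinf_bidisc" and lm: "l \<in> disc" "m \<in> disc"
    and eig: "\<And>y. vcinner (\<Psi> l *v y) x = m * vcinner y x"
  shows "cinner (model_calc \<Psi> f u) (szego_kernel l x) = f (l, m) * cinner u (szego_kernel l x)"
proof -
  obtain M where "\<And>z w. z \<in> disc \<Longrightarrow> w \<in> disc \<Longrightarrow> cmod (f (z, w)) \<le> M"
    using Hinf_bidisc_bound [OF f] by blast
  then have "vcinner (matrix_fun (\<lambda>w. f (l, w)) (\<Psi> l) *v hardy_fun u l) x = f (l, m) * vcinner (hardy_fun u l) x"
    using lm by (intro matrix_fun_left_eigenvector Hinf_bidisc_holomorphic_slices(1) [OF f]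
        stable_multiplierD(5) [OF \<Psi>] eig)
  then show ?thesis
    unfolding model_calc_def
    using lm(1) by (simp add: cinner_szego_kernel hardy_fun_mult_op [OF Hinf_matrix_matrix_fun [OF \<Psi> f]])
qed

theorem theorem3p7:
  fixes T1 T2 :: "'h::complex_hilbert_space \<Rightarrow> 'h"
    and J :: "'h \<Rightarrow> 'd::finite hardy"
    and \<Psi> :: "complex \<Rightarrow> complex ^ 'd ^ 'd"
  assumes "contraction T1" and "contraction T2"
    and "T1 \<circ> T2 = T2 \<circ> T1"
    and "pure T1" and "pure T2"
    and "finite_defect T1" and "finite_defect T2"
    and "CARD('d) = cdim (defect_range T1)"
    and "linear_isometry J"
    and "J \<circ> cadj T1 = cadj shift_op \<circ> J"
    and "rational_pure_inner \<Psi>"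
    and "J \<circ> cadj T2 = cadj (mult_op \<Psi>) \<circ> J"
  shows "zero_set (Ann J \<Psi>) = Omega J \<Psi>"
proof -
  have \<Psi>: "stable_multiplier \<Psi>"
    using assms(11) by (rule rational_pure_inner_stable)
  note \<Psi>_Hinf = stable_multiplierD(1) [OF \<Psi>]
  have "(l, m) \<in> Omega J \<Psi>" if lm: "(l, m) \<in> zero_set (Ann J \<Psi>)" for l m
  proof -
    have l: "l \<in> disc" and m: "m \<in> disc" and zero: "\<And>f. f \<in> Ann J \<Psi> \<Longrightarrow> f (l, m) = 0"
      using lm by (auto simp: zero_set_def)
    have "det (mat m - \<Psi> l) = 0"
      using zero [OF char_function_in_Ann [OF \<Psi>]] by (simp add: char_function_def)
    then obtain x where x: "x \<noteq> 0" "\<And>y. vcinner ((mat m - \<Psi> l) *v y) x = 0"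
      using det_0_left_kernel by blast
    have eig: "vcinner (\<Psi> l *v y) x = m * vcinner y x" for y
      using x(2) [of y]
      by (simp add: matrix_vector_mult_diff_rdistrib mat_vector_mult vcinner_diff_left vcinner_scale_left)
    let ?v = "szego_kernel l x"
    have v: "?v \<in> K_space J \<Psi>" "?v \<noteq> 0"
      using szego_kernel_eq_0D [OF l, of x] x(1)
      by (auto simp: K_space_iff [OF \<Psi>] zero
          cinner_model_calc_szego_kernel [OF \<Psi> Ann_Hinf l m eig])
    have "cadj shift_op ?v = cnj l *\<^sub>C ?v"
      by (rule cadj_eqI) (use l in \<open>simp add: shift_op_def hardy_fun_mult_op [OF Hinf_matrix_mat]
          mat_vector_mult vcinner_scale_left cinner_scaleC_right cinner_szego_kernel\<close>)
    moreover have "cadj (mult_op \<Psi>) ?v = cnj m *\<^sub>C ?v"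
      by (rule cadj_eqI) (use l in \<open>simp add: hardy_fun_mult_op [OF \<Psi>_Hinf] eig
          cinner_scaleC_right cinner_szego_kernel\<close>)
    ultimately show ?thesis
      using v S1_S2_cadj [OF \<Psi> v(1)] by (auto simp: Omega_def joint_eigenvalue_def)
  qed
  moreover have "(l, m) \<in> zero_set (Ann J \<Psi>)" if lm: "(l, m) \<in> Omega J \<Psi>" for l m
  proof -
    obtain v where v: "v \<in> K_space J \<Psi>" "v \<noteq> 0"
      and "cadj_on (K_space J \<Psi>) (S1 J \<Psi>) v = cnj l *\<^sub>C v"
      and "cadj_on (K_space J \<Psi>) (S2 J \<Psi>) v = cnj m *\<^sub>C v"
      using lm by (auto simp: Omega_def joint_eigenvalue_def)
    then have "cadj shift_op v = cnj l *\<^sub>C v" and adj_\<Psi>: "cadj (mult_op \<Psi>) v = cnj m *\<^sub>C v"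
      using S1_S2_cadj [OF \<Psi> v(1)] by simp_all
    then have "cinner (shift_op u) v = l * cinner u v" for u
      using cinner_mult_op_cadj [OF Hinf_matrix_mat, of u v] by (simp add: shift_op_def cinner_scaleC_right)
    then obtain x where x: "x \<noteq> 0" "l \<in> disc" "v = szego_kernel l x"
      using shift_eigenvector [OF v(2)] by blast
    \<comment> \<open>The kernel vectors at 0 are the constant functions.\<close>
    have const: "hardy_fun (szego_kernel 0 y) l = y" for y :: "complex ^ 'd"
      using hardy_fun_szego_kernel [of 0 l y] x(2) by simp
    have eig: "vcinner (\<Psi> l *v y) x = m * vcinner y x" for y
      using cinner_mult_op_cadj [OF \<Psi>_Hinf, of "szego_kernel 0 y" v]
      unfolding adj_\<Psi>
      unfolding x(3) cinner_mult_op_szego_kernel [OF \<Psi>_Hinf x(2)]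
      by (simp add: const cinner_scaleC_right cinner_szego_kernel [OF x(2)])
    have "\<not> invertible (mat m - \<Psi> l)"
    proof
      assume "invertible (mat m - \<Psi> l)"
      then have "surj (\<lambda>y. (mat m - \<Psi> l) *v y)"
        by (simp only: invertible_right_inverse matrix_right_invertible_surjective)
      then obtain y where "x = (mat m - \<Psi> l) *v y"
        by (meson surjD)
      moreover have "vcinner ((mat m - \<Psi> l) *v y) x = 0"
        by (simp add: matrix_vector_mult_diff_rdistrib mat_vector_mult vcinner_diff_left vcinner_scale_left eig)
      ultimately have "vcinner x x = 0"
        by simp
      then show False
        using x(1) by (simp add: vcinner_self_of_real)
    qed
    then have m: "m \<in> disc"
      using stable_multiplierD(4) [OF \<Psi> x(2)] by (auto simp: matrix_spectrum_def)
    have "f (l, m) = 0" if f: "f \<in> Ann J \<Psi>" for f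
    proof -
      have "f (l, m) * cinner v v = 0"
        using v(1) f cinner_model_calc_szego_kernel [OF \<Psi> Ann_Hinf [OF f] x(2) m eig, of v]
        by (simp add: K_space_iff [OF \<Psi>] x(3))
      then show ?thesis
        using v(2) cinner_self_eq_0 by auto
    qed
    then show ?thesis
      using x(2) m by (simp add: zero_set_def)
  qed
  ultimately show ?thesis
    by auto
qed

end
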